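(* Let $b,c\in\mathbb R$ satisfy $b>-1$, $0\le 2-c+b<1$ and $c>1$. Then the following hold. (i) $S_{-1,b,c}$ is unbounded from $L^{\frac{1}{2-c+b}}(\mathbb D)$ to $L^{1,\infty}(\mathbb D)$. (ii) If $0\le 2-c+b<1/2$, then $T_{-1,b,c}$ is unbounded from $L^{\frac{1}{2-c+b}}(\mathbb D)$ to $L^{1,\infty}(\mathbb D)$. (iii) If $1/2\le 2-c+b<1$, then $T_{-1,b,c}$ is bounded from $L^{\frac{1}{2-c+b}}(\mathbb D)$ to $L^{1,\infty}(\mathbb D)$. Here, in the borderline case $2-c+b=0$, the space $L^{\frac{1}{2-c+b}}(\mathbb D)$ is understood as $L^\infty(\mathbb D)$.
   Context: $\mathbb D$ is the open unit disc in $\mathbb C$, $dA$ is normalized area measure on $\mathbb D$, and $|E|$ is the $dA$-measure of $E\subseteq\mathbb D$. For $a,b,c\in\mathbb R$, $$T_{a,b,c}f(z):=(1-|z|^2)^a\int_{\mathbb D}\frac{(1-|w|^2)^b}{(1-z\overline w)^c}f(w)\,dA(w),\qquad S_{a,b,c}f(z):=(1-|z|^2)^a\int_{\mathbb D}\frac{(1-|w|^2)^b}{|1-z\overline w|^c}f(w)\,dA(w),$$ with the principal branch of the power; here $a=-1$. $L^p(\mathbb D)=L^p(\mathbb D,dA)$, and $\|f\|_{L^{1,\infty}}=\sup_{\lambda>0}\lambda|\{|f|>\lambda\}|$. An operator $\mathcal T$ is bounded from $X$ to $Y$ if for every $f\in X$ the defining integral converges absolutely for a.e. $z$ and $\|\mathcal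 Tf\|_Y\le C\|f\|_X$ with $C$ independent of $f$; otherwise it is unbounded from $X$ to $Y$. *)

theory Defs
  imports "HOL-Analysis.Analysis" "HOL-Probability.Essential_Supremum"
begin

definition dA :: "complex measure" where
  "dA = density (lebesgue_on (ball 0 1)) (\<lambda>_. ennreal (1 / pi))"

lemma emeasure_dA_disc: "emeasure dA (ball 0 1) = 1"
proof -
  have "emeasure dA (ball 0 1) = ennreal (1 / pi) * emeasure lborel (ball (0::complex) 1)"
    by (simp add: dA_def emeasure_density_const emeasure_restrict_space)
  also have "\<dots> = ennreal (1 / pi) * ennreal pi"
    by (simp add: emeasure_ball unit_ball_vol_2)
  also have "\<dots> = 1"
    by (simp flip: ennreal_mult)
  finally show ?thesis .
qed

text \<open>The integral kernels, including the weight in \<open>w\<close>. On the disc the real part of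
  \<open>1 - z * cnj w\<close> is positive; \<open>powr\<close> on complex numbers uses the principal logarithm.\<close>

definition T_kernel :: "real \<Rightarrow> real \<Rightarrow> complex \<Rightarrow> complex \<Rightarrow> complex" where
  "T_kernel b c z w =
     of_real ((1 - (norm w)\<^sup>2) powr b) / (1 - z * cnj w) powr of_real c"

definition S_kernel :: "real \<Rightarrow> real \<Rightarrow> complex \<Rightarrow> complex \<Rightarrow> complex" where
  "S_kernel b c z w =
     of_real ((1 - (norm w)\<^sup>2) powr b / norm (1 - z * cnj w) powr c)"

definition kernel_op ::
    "real \<Rightarrow> (complex \<Rightarrow> complex \<Rightarrow> complex) \<Rightarrow> (complex \<Rightarrow> complex) \<Rightarrow> complex \<Rightarrow> complex" where
  "kernel_op a K f z =
     of_real ((1 - (norm z)\<^sup>2) powr a) * (LINT w|dA. K z w * f w)"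

text \<open>Norms take values in \<open>ennreal\<close>; a function belongs to the space determined by a norm
  iff it is measurable and its norm is finite. In \<open>Lp_norm p\<close> the exponent is intended to
  satisfy \<open>1 \<le> p \<le> \<infinity>\<close>. As \<open>ennreal\<close> has no real powers, the \<open>p\<close>-th root
  of the integral is taken in the reals when the integral is finite.\<close>

definition Lp_norm :: "ennreal \<Rightarrow> (complex \<Rightarrow> complex) \<Rightarrow> ennreal" where
  "Lp_norm p f =
     (if p = \<infinity> then esssup dA (\<lambda>z. ennreal (norm (f z)))
      else let I = (\<integral>\<^sup>+z. ennreal (norm (f z) powr enn2real p) \<partial>dA)
           in if I = \<infinity> then \<infinity> else ennreal (enn2real I powr (1 / enn2real p)))"

definition weak_L1_norm :: "(complex \<Rightarrow> complex) \<Rightarrow> ennreal" where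
  "weak_L1_norm f =
     (SUP t\<in>{0<..}. ennreal t * emeasure dA {z \<in> space dA. norm (f z) > t})"

definition norm_space :: "((complex \<Rightarrow> complex) \<Rightarrow> ennreal) \<Rightarrow> (complex \<Rightarrow> complex) set" where
  "norm_space N = {f \<in> borel_measurable dA. N f < \<infinity>}"

text \<open>The Bochner integral is \<open>0\<close> where the integrand is not integrable, so absolute
  convergence almost everywhere has to be required separately.\<close>

definition bounded_kernel_op ::
    "real \<Rightarrow> (complex \<Rightarrow> complex \<Rightarrow> complex) \<Rightarrow> ((complex \<Rightarrow> complex) \<Rightarrow> ennreal) \<Rightarrow>
     ((complex \<Rightarrow> complex) \<Rightarrow> ennreal) \<Rightarrow> bool" where
  "bounded_kernel_op a K NX NY \<longleftrightarrow>
     (\<exists>C::real. \<forall>f\<in>norm_space NX.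
        (AE z in dA. integrable dA (\<lambda>w. K z w * f w)) \<and>
        kernel_op a K f \<in> norm_space NY \<and>
        NY (kernel_op a K f) \<le> ennreal C * NX f)"

text \<open>The exponent \<open>1 / s\<close>, where \<open>s = 0\<close> corresponds to \<open>L\<^sup>\<infinity>\<close>.\<close>

definition recip_exponent :: "real \<Rightarrow> ennreal" where
  "recip_exponent s = (if s = 0 then \<infinity> else ennreal (1 / s))"

end

theory Submission
  imports Defs "HOL-Probability.Distribution_Functions"
begin

text \<open>
  Put \<open>s = 2 - c + b\<close>, \<open>p = 1 / s\<close>, and let \<open>F\<close> be the analytic function with
  \<open>T f z = F z / (1 - (norm z)\<^sup>2)\<close>.

  (iii) For \<open>1 < p \<le> 2\<close> split \<open>f\<close> according to the size of \<open>norm f * (1 - (norm w)\<^sup>2) powr s\<close>, so that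
  the two parts lie in weighted \<open>L\<^sup>1\<close> and \<open>L\<^sup>2\<close> spaces. For the \<open>L\<^sup>1\<close> part, the radial maximal
  function of \<open>F\<close> is integrable over the circle because \<open>c > 1\<close>, which gives the weak type bound. For
  the \<open>L\<^sup>2\<close> part, Bessel's inequality and the log convexity of \<open>Gamma\<close> bound the \<open>H\<^sup>2\<close> norm of
  \<open>F\<close>; a Chebyshev estimate on \<open>1 - (norm z)\<^sup>2 \<ge> \<eta>\<close> and the trivial estimate on the remaining annulus,
  balanced in \<open>\<eta>\<close>, give the weak type bound.

  (i) With \<open>f = (1 - (norm w)\<^sup>2) powr - s\<close> cut off where \<open>1 - (norm w)\<^sup>2 < exp (- L)\<close>, the norm of
  \<open>f\<close> is at most \<open>L powr s\<close>, while the weak norm of \<open>S f\<close> is at least a multiple of \<open>L\<close>.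

  (ii) There is \<open>f\<close> of norm \<open>O(N powr s)\<close> for which \<open>F\<close> is the lacunary polynomial
  \<open>\<Sum>j=1..N. z ^ 4 ^ j\<close>. This has modulus of order \<open>sqrt N\<close> on a fixed proportion of the
  annulus \<open>1 - (norm z)\<^sup>2 < 1 / 4 ^ N\<close>, so the weak norm of \<open>T f\<close> is at least a multiple of
  \<open>sqrt N\<close>.
\<close>

section \<open>The area measure\<close>

text \<open>The weight \<open>1 / (1 - (norm z)\<^sup>2)\<close> lies in weak
  \<open>L\<^sup>1\<close> but not in \<open>L\<^sup>1\<close>, so the question is how much growth
  of the integral factor it tolerates. With
  \<open>q = norm (f w) * (1 - (norm w)\<^sup>2) powr s\<close> the p-th power of the norm of
  \<open>f\<close> is the integral of \<open>q powr p\<close> against the infinite measure dA / (1 -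
  |w|^2). The same measure turns the two weighted endpoint conditions into the plain L^1 and L^2
  norms of \<open>q\<close>. Hence a single cut of \<open>q\<close>, at a bound for the norm of
  \<open>f\<close> and independent of the level of the weak norm, controls both parts at once; the
  small part is square integrable because p is at most 2. The thresholds come from counting scales.
  A test function spread over N annuli at geometrically decreasing distance from the circle has norm
  of order N^s. A positive kernel adds the N contributions to N, which wins for s < 1. The analytic
  kernel sends them to orthogonal monomials, whose sum has size sqrt N only, which wins exactly for
  s < 1/2.\<close>

lemma sets_borel_ball [measurable]: "ball a r \<in> sets borel"
  by (rule borel_open) simp

lemma space_dA [simp]: "space dA = ball 0 1"
  by (simp add: dA_def)

lemma sets_dA: "sets dA = sets (lebesgue_on (ball 0 1))"
  by (simp add: dA_def)

interpretation dA: prob_space dA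
  by standard (simp add: emeasure_dA_disc)

lemma measurable_id_dA: "(\<lambda>z. z) \<in> borel_measurable dA"
proof -
  have "(\<lambda>z. z) \<in> borel_measurable (lebesgue_on (ball 0 1 :: complex set))"
    by (intro measurable_restrict_space1 measurable_completion) simp
  then show ?thesis
    by (simp add: dA_def)
qed

lemma borel_measurable_dA: "f \<in> borel_measurable borel \<Longrightarrow> f \<in> borel_measurable dA"
  by (rule measurable_compose[OF measurable_id_dA])

lemma measurable_dA_borel:
  "f \<in> M \<rightarrow>\<^sub>M dA \<Longrightarrow> f \<in> borel_measurable M"
  by (rule measurable_compose[OF _ measurable_id_dA])

lemma sets_dA_Collect:
  assumes "Measurable.pred borel P"
  shows "{z \<in> ball 0 1. P z} \<in> sets dA"
proof -
  have "{z. P z} \<in> sets borel"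
    using assms by (simp add: pred_def)
  then have "{z. P z} \<inter> space dA \<in> sets dA"
    using measurable_sets[OF measurable_id_dA, of "{z. P z}"] by (simp add: vimage_def)
  moreover have "{z. P z} \<inter> space dA = {z \<in> ball 0 1. P z}" by auto
  ultimately show ?thesis by simp
qed

lemma borel_measurable_dA_pair:
  assumes "g \<in> borel_measurable (borel \<Otimes>\<^sub>M borel)"
  shows "g \<in> borel_measurable (dA \<Otimes>\<^sub>M dA)"
proof -
  have "(\<lambda>p. (fst p, snd p)) \<in> dA \<Otimes>\<^sub>M dA \<rightarrow>\<^sub>M borel \<Otimes>\<^sub>M borel"
    by (intro measurable_Pair measurable_dA_borel measurable_fst measurable_snd)
  from measurable_compose[OF this assms] show ?thesis by simp
qed

lemma nn_integral_dA_lborel: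
  assumes [measurable]: "g \<in> borel_measurable borel"
  shows "(\<integral>\<^sup>+z. g z \<partial>dA) = (\<integral>\<^sup>+z. ennreal (1 / pi) * g z * indicator (ball 0 1) z \<partial>lborel)"
proof -
  have "(\<integral>\<^sup>+z. g z \<partial>dA) = (\<integral>\<^sup>+z. ennreal (1 / pi) * g z \<partial>lebesgue_on (ball 0 1))"
    unfolding dA_def by (rule nn_integral_density) (auto intro!: measurable_restrict_space1 measurable_completion)
  also have "\<dots> = (\<integral>\<^sup>+z. ennreal (1 / pi) * g z * indicator (ball 0 1) z \<partial>lebesgue)"
    by (rule nn_integral_restrict_space) simp
  also have "\<dots> = (\<integral>\<^sup>+z. ennreal (1 / pi) * g z * indicator (ball 0 1) z \<partial>lborel)"
    by (rule nn_integral_completion)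
  finally show ?thesis .
qed

lemma emeasure_dA_lborel:
  assumes [measurable]: "A \<in> sets borel"
  shows "emeasure dA (A \<inter> ball 0 1) = ennreal (1 / pi) * emeasure lborel (A \<inter> ball 0 1)"
proof -
  have *: "A \<inter> ball 0 1 \<in> sets dA"
    unfolding sets_dA by (subst sets_restrict_space_iff) auto
  have "emeasure dA (A \<inter> ball 0 1) = (\<integral>\<^sup>+z. indicator (A \<inter> ball 0 1) z \<partial>dA)"
    using * by simp
  also have "\<dots> = (\<integral>\<^sup>+z. ennreal (1 / pi) * indicator (A \<inter> ball 0 1) z \<partial>lborel)"
    by (subst nn_integral_dA_lborel) (auto intro!: nn_integral_cong split: split_indicator)
  also have "\<dots> = ennreal (1 / pi) * emeasure lborel (A \<inter> ball 0 1)"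
    by (subst nn_integral_cmult) auto
  finally show ?thesis .
qed

section \<open>Rotation invariance\<close>

text \<open>The invariance of Lebesgue measure under orthogonal maps is available on \<open>real^2\<close> only, so it is
  transported to the complex plane.\<close>

definition vec2_complex :: "real^2 \<Rightarrow> complex" where
  "vec2_complex x = Complex (x $ 1) (x $ 2)"

definition complex_vec2 :: "complex \<Rightarrow> real^2" where
  "complex_vec2 z = (\<chi> i. if i = 1 then Re z else Im z)"

lemma complex_vec2_inverse [simp]: "vec2_complex (complex_vec2 z) = z"
  by (simp add: vec2_complex_def complex_vec2_def)

lemma vec2_complex_inverse [simp]: "complex_vec2 (vec2_complex x) = x"
  using exhaust_2 by (auto simp: vec2_complex_def complex_vec2_def vec_eq_iff)

lemma linear_complex_vec2: "linear complex_vec2"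
  by (rule linearI) (auto simp: complex_vec2_def vec_eq_iff)

lemma linear_vec2_complex: "linear vec2_complex"
  by (rule linearI) (auto simp: vec2_complex_def complex_eq_iff)

lemma norm_complex_vec2 [simp]: "norm (complex_vec2 z) = norm z"
  by (simp add: norm_eq_sqrt_inner inner_vec_def complex_vec2_def UNIV_2 inner_complex_def)

lemma norm_vec2_complex [simp]: "norm (vec2_complex x) = norm x"
  by (metis norm_complex_vec2 vec2_complex_inverse)

lemma borel_measurable_vec2_complex [measurable]: "vec2_complex \<in> borel_measurable borel"
  by (intro borel_measurable_continuous_onI linear_continuous_on linear_vec2_complex
        linear_conv_bounded_linear[THEN iffD1])

lemma vec2_complex_vimage_box:
  "vec2_complex -` box l u = box (complex_vec2 l) (complex_vec2 u)"
  by (auto simp: vec2_complex_def complex_vec2_def in_box_complex_iff mem_box_cart forall_2)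

lemma distr_lborel_vec2_complex: "distr lborel borel vec2_complex = lborel"
proof (rule lborel_eqI[symmetric])
  fix l u :: complex assume le: "\<And>b. b \<in> Basis \<Longrightarrow> l \<bullet> b \<le> u \<bullet> b"
  then have "Re l \<le> Re u" "Im l \<le> Im u"
    using le[of 1] le[of \<i>] by (auto simp: Basis_complex_def)
  then have "emeasure lborel (box (complex_vec2 l) (complex_vec2 u)) = (Re u - Re l) * (Im u - Im l)"
    by (subst emeasure_lborel_box)
       (auto simp: Basis_vec_def complex_vec2_def inner_axis UNIV_2 axis_eq_axis)
  then show "emeasure (distr lborel borel vec2_complex) (box l u) = ennreal (\<Prod>b\<in>Basis. (u - l) \<bullet> b)"
    by (simp add: emeasure_distr vec2_complex_vimage_box Basis_complex_def)
qed simp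

text \<open>Lebesgue measure is determined by its values on boxes. The preimage of a box under
  multiplication by \<zeta> is its image under multiplication by \<open>cnj \<zeta>\<close>, an
  orthogonal map once read on \<open>real^2\<close>.\<close>

lemma distr_lborel_rotation:
  fixes \<zeta> :: complex
  assumes "norm \<zeta> = 1"
  shows "distr lborel borel ((*) \<zeta>) = lborel"
proof (rule lborel_eqI[symmetric])
  fix l u :: complex assume le: "\<And>b. b \<in> Basis \<Longrightarrow> l \<bullet> b \<le> u \<bullet> b"
  have lin: "linear (\<lambda>x. complex_vec2 (cnj \<zeta> * vec2_complex x))"
    using linear_compose[OF linear_compose[OF linear_vec2_complex linear_times] linear_complex_vec2]
    by (simp add: o_def)
  have rot: "orthogonal_transformation (\<lambda>x. complex_vec2 (cnj \<zeta> * vec2_complex x))"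
    using lin assms by (auto simp: orthogonal_transformation norm_mult)
  have inv: "cnj \<zeta> * (\<zeta> * z) = z" "\<zeta> * (cnj \<zeta> * z) = z" for z
    using assms by (simp_all add: complex_norm_square[symmetric] mult.assoc[symmetric] mult.commute[of "cnj \<zeta>"])
  let ?R = "\<lambda>x. complex_vec2 (cnj \<zeta> * vec2_complex x)"
  let ?B = "box (complex_vec2 l) (complex_vec2 u)"
  have img: "vec2_complex -` (*) \<zeta> -` box l u = ?R ` ?B"
  proof (intro set_eqI iffI)
    fix x assume "x \<in> vec2_complex -` (*) \<zeta> -` box l u"
    then have "complex_vec2 (\<zeta> * vec2_complex x) \<in> ?B"
      by (simp flip: vec2_complex_vimage_box)
    then show "x \<in> ?R ` ?B"
      by (rule rev_image_eqI) (simp add: inv)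
  qed (auto simp: inv simp flip: vec2_complex_vimage_box)
  have [measurable]: "(*) \<zeta> \<in> borel_measurable borel" "box l u \<in> sets borel"
    by (auto simp: borel_open)
  have [measurable]: "(*) \<zeta> -` box l u \<in> sets borel"
    by (rule measurable_sets_borel) measurable
  have "emeasure (distr lborel borel ((*) \<zeta>)) (box l u) = emeasure lborel ((*) \<zeta> -` box l u)"
    by (subst emeasure_distr) (simp_all add: borel_open)
  also have "\<dots> = emeasure lborel (vec2_complex -` (*) \<zeta> -` box l u)"
    by (subst distr_lborel_vec2_complex[symmetric], subst emeasure_distr)
       simp_all
  also have "\<dots> = emeasure lebesgue (vec2_complex -` (*) \<zeta> -` box l u)"
    using measurable_sets_borel[OF borel_measurable_vec2_complex, of "(*) \<zeta> -` box l u"] by simp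
  also have "\<dots> = emeasure lebesgue (?R ` ?B)"
    by (simp only: img)
  also have "\<dots> = emeasure lebesgue ?B"
    by (simp only: emeasure_eq_measure2[OF measurable_orthogonal_image[OF rot lmeasurable_box]]
        emeasure_eq_measure2[OF lmeasurable_box] measure_orthogonal_image[OF rot lmeasurable_box])
  also have "\<dots> = emeasure lborel (vec2_complex -` box l u)"
    by (simp add: vec2_complex_vimage_box)
  also have "\<dots> = emeasure lborel (box l u)"
    using emeasure_distr[of vec2_complex lborel borel "box l u"]
    by (simp add: distr_lborel_vec2_complex)
  also have "\<dots> = ennreal (\<Prod>b\<in>Basis. (u - l) \<bullet> b)"
    using le by simp
  finally show "emeasure (distr lborel borel ((*) \<zeta>)) (box l u) = \<dots>" .
qed simp

lemma nn_integral_dA_rotation: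
  assumes "norm \<zeta> = 1" and [measurable]: "g \<in> borel_measurable borel"
  shows "(\<integral>\<^sup>+z. g (\<zeta> * z) \<partial>dA) = (\<integral>\<^sup>+z. g z \<partial>dA)"
proof -
  have "(\<integral>\<^sup>+z. g (\<zeta> * z) \<partial>dA) = 
      (\<integral>\<^sup>+z. ennreal (1 / pi) * g (\<zeta> * z) * indicator (ball 0 1) (\<zeta> * z) \<partial>lborel)"
    using assms by (subst nn_integral_dA_lborel) (auto simp: norm_mult indicator_def)
  also have "\<dots> = (\<integral>\<^sup>+z. ennreal (1 / pi) * g z * indicator (ball 0 1) z \<partial>distr lborel borel ((*) \<zeta>))"
    by (subst nn_integral_distr) auto
  also have "\<dots> = (\<integral>\<^sup>+z. g z \<partial>dA)"
    by (simp add: distr_lborel_rotation assms nn_integral_dA_lborel)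
  finally show ?thesis .
qed

text \<open>Both sides are push-forwards to the Borel sets: \<open>dA\<close> itself carries the
  larger sigma-algebra of Lebesgue sets, while the functions rotated below are Borel.\<close>

lemma distr_dA_rotation:
  assumes "norm \<zeta> = 1"
  shows "distr dA borel ((*) \<zeta>) = distr dA borel (\<lambda>z. z)"
proof (rule measure_eqI)
  fix A assume "A \<in> sets (distr dA borel ((*) \<zeta>))"
  then have [measurable]: "A \<in> sets borel" by simp
  have "(\<integral>\<^sup>+z. indicator A z \<partial>distr dA borel ((*) \<zeta>)) = (\<integral>\<^sup>+z. indicator A z \<partial>distr dA borel (\<lambda>z. z))"
    using nn_integral_dA_rotation[OF assms, of "indicator A"]
    by (subst (1 2) nn_integral_distr) (auto intro!: borel_measurable_dA)
  then show "emeasure (distr dA borel ((*) \<zeta>)) A = emeasure (distr dA borel (\<lambda>z. z)) A"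
    by simp
qed simp

lemma integral_dA_rotation:
  fixes g :: "complex \<Rightarrow> 'a :: {banach, second_countable_topology}"
  assumes "norm \<zeta> = 1" and [measurable]: "g \<in> borel_measurable borel"
  shows "(LINT z|dA. g (\<zeta> * z)) = (LINT z|dA. g z)"
  using measurable_id_dA borel_measurable_dA[of "(*) \<zeta>"] integral_distr[of "(*) \<zeta>" dA borel g] integral_distr[of "\<lambda>z. z" dA borel g]
  by (simp add: distr_dA_rotation assms)

section \<open>Radial functions\<close>

lemma emeasure_dA_norm_le:
  assumes "0 \<le> t" "t \<le> 1"
  shows "emeasure dA {z \<in> ball 0 1. (norm z)\<^sup>2 \<le> t} = ennreal t"
proof (cases "t = 1")
  case True
  have "{z \<in> ball 0 1. (norm z)\<^sup>2 \<le> 1} = ball (0::complex) 1"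
    by (auto simp: power_le_one_iff)
  then show ?thesis using True emeasure_dA_disc by simp
next
  case False
  have eq: "(norm z)\<^sup>2 \<le> t \<longleftrightarrow> norm z \<le> sqrt t" for z :: complex
    using assms real_sqrt_le_iff[of "(norm z)\<^sup>2" t] by simp
  have "sqrt t < 1" using assms False by simp
  then have "{z \<in> ball 0 1. (norm z)\<^sup>2 \<le> t} = cball (0::complex) (sqrt t) \<inter> ball 0 1"
    unfolding eq by auto
  moreover have "cball 0 (sqrt t) \<inter> ball 0 1 = cball (0::complex) (sqrt t)"
    using \<open>sqrt t < 1\<close> by (auto intro: le_less_trans simp del: real_sqrt_lt_1_iff)
  ultimately show ?thesis
    using emeasure_dA_lborel[of "cball 0 (sqrt t)"] assms
    by (simp add: emeasure_cball unit_ball_vol_2 flip: ennreal_mult)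
qed

text \<open>The disc of radius sqrt t has normalized area t, so |z|^2 is uniformly distributed on
  [0, 1]; equality of the distribution functions suffices.\<close>

lemma distr_dA_norm_squared:
  "distr dA borel (\<lambda>z. (norm z)\<^sup>2) = density lborel (indicator {0..1})"
proof (rule cdf_unique)
  have [measurable]: "(\<lambda>z::complex. (norm z)\<^sup>2) \<in> borel_measurable dA"
    by (rule borel_measurable_dA) measurable
  show "real_distribution (distr dA borel (\<lambda>z. (norm z)\<^sup>2))"
    unfolding real_distribution_def real_distribution_axioms_def
    by (auto intro!: dA.prob_space_distr)
  show "real_distribution (density lborel (indicator {0..1::real}))"
    unfolding real_distribution_def real_distribution_axioms_def
    by (auto intro!: prob_spaceI simp: emeasure_density)
  show "cdf (distr dA borel (\<lambda>z. (norm z)\<^sup>2)) = cdf (density lborel (indicator {0..1}))"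
  proof
    fix t :: real
    have 1: "emeasure (distr dA borel (\<lambda>z. (norm z)\<^sup>2)) {..t} = emeasure dA {z \<in> ball 0 1. (norm z)\<^sup>2 \<le> t}"
      by (subst emeasure_distr) (auto simp: vimage_def Int_def conj_commute)
    have 2: "emeasure (density lborel (indicator {0..1})) {..t} = emeasure lborel ({..t} \<inter> {0..1})"
      by (subst emeasure_density) (auto simp flip: indicator_inter_arith simp: Int_commute)
    consider "t < 0" | "0 \<le> t" "t \<le> 1" | "t > 1" by linarith
    then have "emeasure dA {z \<in> ball 0 1. (norm z)\<^sup>2 \<le> t} = emeasure lborel ({..t} \<inter> {0..1})"
    proof cases
      case 1
      then have "{z \<in> ball (0::complex) 1. (norm z)\<^sup>2 \<le> t} = {}" "{..t} \<inter> {0..1} = {}"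
        using order_trans[OF zero_le_power2, of "norm _" t] by auto
      then show ?thesis by (simp only: emeasure_empty)
    next
      case 2
      moreover have "{..t} \<inter> {0..1} = {0..t}" using 2 by auto
      ultimately show ?thesis using emeasure_dA_norm_le[of t] by (simp only: emeasure_lborel_Icc) simp
    next
      case 3
      have "{z \<in> ball (0::complex) 1. (norm z)\<^sup>2 \<le> t} = ball 0 1"
        using 3 by (auto intro!: order_trans[OF power_le_one[of "norm _" 2]])
      moreover have "{..t} \<inter> {0..1} = {0..1}" using 3 by auto
      ultimately show ?thesis by (simp add: emeasure_dA_disc)
    qed
    with 1 2 show "cdf (distr dA borel (\<lambda>z. (norm z)\<^sup>2)) t = cdf (density lborel (indicator {0..1})) t"
      by (simp add: cdf_def measure_def)
  qed
qed

text \<open>With |z|^2 also 1 - |z|^2 is uniform on [0, 1]. This variable is used because all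
  weights below are functions of it.\<close>

lemma nn_integral_dA_radial:
  assumes [measurable]: "g \<in> borel_measurable borel"
  shows "(\<integral>\<^sup>+z. g (1 - (norm z)\<^sup>2) \<partial>dA) = (\<integral>\<^sup>+t. g t * indicator {0..1} t \<partial>lborel)"
proof -
  have [measurable]: "(\<lambda>z::complex. (norm z)\<^sup>2) \<in> borel_measurable dA"
    by (rule borel_measurable_dA) measurable
  have "(\<integral>\<^sup>+z. g (1 - (norm z)\<^sup>2) \<partial>dA) = (\<integral>\<^sup>+t. g (1 - t) \<partial>distr dA borel (\<lambda>z. (norm z)\<^sup>2))"
    by (subst nn_integral_distr) auto
  also have "\<dots> = (\<integral>\<^sup>+t. g (1 - t) * indicator {0..1} t \<partial>lborel)"
    unfolding distr_dA_norm_squared by (subst nn_integral_density) (auto simp: mult.commute)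
  also have "\<dots> = (\<integral>\<^sup>+t. g t * indicator {0..1} t \<partial>lborel)"
    by (subst nn_integral_real_affine[where c = "-1" and t = 1])
       (auto intro!: nn_integral_cong split: split_indicator)
  finally show ?thesis .
qed

section \<open>Angular averages\<close>

lemma borel_measurable_sgn_complex [measurable]: "(sgn :: complex \<Rightarrow> complex) \<in> borel_measurable borel"
  unfolding sgn_div_norm[abs_def] by measurable

lemma AE_dA_nonzero: "AE z in dA. z \<noteq> 0"
proof (rule AE_I)
  show "emeasure dA ({0} \<inter> ball 0 1) = 0"
    by (subst emeasure_dA_lborel) (auto intro: emeasure_lborel_countable)
  show "{0} \<inter> ball 0 1 \<in> sets dA"
    unfolding sets_dA by (subst sets_restrict_space_iff) auto
qed auto

text \<open>Under the area measure, \<open>sgn z\<close> and \<open>norm z\<close> are independent. This replaces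
  polar coordinates: the integral over the angle becomes an integral over \<open>sgn u\<close>.\<close>

lemma nn_integral_dA_polar:
  fixes \<Psi> :: "complex \<Rightarrow> real \<Rightarrow> ennreal"
  assumes [measurable]: "case_prod \<Psi> \<in> borel_measurable (borel \<Otimes>\<^sub>M borel)"
  shows "(\<integral>\<^sup>+z. \<Psi> (sgn z) (norm z) \<partial>dA) = (\<integral>\<^sup>+u. (\<integral>\<^sup>+z. \<Psi> (sgn u) (norm z) \<partial>dA) \<partial>dA)"
proof -
  interpret P: pair_sigma_finite dA dA
    by (intro pair_sigma_finite.intro) unfold_locales
  let ?I = "\<integral>\<^sup>+z. \<Psi> (sgn z) (norm z) \<partial>dA"
  have 1: "(\<integral>\<^sup>+z. \<Psi> (sgn u * sgn z) (norm z) \<partial>dA) = ?I" if "u \<noteq> 0" for u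
    using nn_integral_dA_rotation[of "sgn u" "\<lambda>z. \<Psi> (sgn z) (norm z)"] that
    by (simp add: norm_mult sgn_mult norm_sgn)
  have 2: "(\<integral>\<^sup>+u. \<Psi> (sgn u * sgn z) x \<partial>dA) = (\<integral>\<^sup>+u. \<Psi> (sgn u) x \<partial>dA)" if "z \<noteq> 0" for z x
    using nn_integral_dA_rotation[of "sgn z" "\<lambda>u. \<Psi> (sgn u) x"] that
    by (simp add: norm_mult sgn_mult norm_sgn mult.commute)
  \<comment> \<open>Average over a dummy u, rotate z by \<open>sgn u\<close>, exchange the
    integrals, then rotate u to absorb \<open>sgn z\<close>. The origin, where \<open>sgn\<close> is
    not unimodular, is a null set.\<close>
  have "?I = (\<integral>\<^sup>+u. ?I \<partial>dA)"
    by (simp add: emeasure_dA_disc)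
  also have "\<dots> = (\<integral>\<^sup>+u. (\<integral>\<^sup>+z. \<Psi> (sgn u * sgn z) (norm z) \<partial>dA) \<partial>dA)"
    using AE_dA_nonzero by (intro nn_integral_cong_AE) (auto simp: 1)
  also have "\<dots> = (\<integral>\<^sup>+z. (\<integral>\<^sup>+u. \<Psi> (sgn u * sgn z) (norm z) \<partial>dA) \<partial>dA)"
    by (rule P.Fubini', rule borel_measurable_dA_pair) measurable
  also have "\<dots> = (\<integral>\<^sup>+z. (\<integral>\<^sup>+u. \<Psi> (sgn u) (norm z) \<partial>dA) \<partial>dA)"
    using AE_dA_nonzero by (intro nn_integral_cong_AE) (auto simp: 2)
  also have "\<dots> = (\<integral>\<^sup>+u. (\<integral>\<^sup>+z. \<Psi> (sgn u) (norm z) \<partial>dA) \<partial>dA)"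
    by (rule P.Fubini', rule borel_measurable_dA_pair) measurable
  finally show ?thesis .
qed

section \<open>Circle means of the kernel, expressed through \<open>sgn u\<close>\<close>

lemma emeasure_dA_strip:
  assumes "0 \<le> t"
  shows "emeasure dA {u \<in> ball 0 1. \<bar>Im u\<bar> \<le> t} \<le> ennreal (4 * t / pi)"
proof -
  have [measurable]: "{u. \<bar>Im u\<bar> \<le> t} \<in> sets borel" by measurable
  have "{u \<in> ball 0 1. \<bar>Im u\<bar> \<le> t} = {u. \<bar>Im u\<bar> \<le> t} \<inter> ball 0 1"
    by auto
  then have "emeasure dA {u \<in> ball 0 1. \<bar>Im u\<bar> \<le> t} = ennreal (1 / pi) * emeasure lborel ({u. \<bar>Im u\<bar> \<le> t} \<inter> ball 0 1)"
    by (simp add: emeasure_dA_lborel)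
  also have "\<dots> \<le> ennreal (1 / pi) * emeasure lborel (cbox (Complex (-1) (-t)) (Complex 1 t))"
    using order.strict_implies_order[OF le_less_trans[OF abs_Re_le_cmod]]
    by (intro mult_left_mono emeasure_mono) (fastforce simp: in_cbox_complex_iff abs_le_iff)+
  also have "emeasure lborel (cbox (Complex (-1) (-t)) (Complex 1 t)) = ennreal (4 * t)"
    using assms by (subst emeasure_lborel_cbox) (auto simp: Basis_complex_def)
  also have "ennreal (1 / pi) * \<dots> = ennreal (4 * t / pi)"
    using assms by (simp flip: ennreal_mult)
  finally show ?thesis .
qed

lemma nn_integral_powr_atLeast:
  assumes "1 < c" "0 < \<delta>" "0 \<le> y"
  shows "(\<integral>\<^sup>+t. ennreal ((\<delta> + t) powr - c) * indicator {y..} t \<partial>lborel) =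
    ennreal ((\<delta> + y) powr (1 - c) / (c - 1))"
proof -
  have "(\<integral>\<^sup>+t. ennreal ((\<delta> + t) powr - c) * indicator {y..} t \<partial>lborel) =
      0 - (\<delta> + y) powr (1 - c) / (1 - c)"
  proof (rule nn_integral_FTC_atLeast)
    fix t assume "y \<le> t"
    then have "\<delta> + t > 0" using assms by simp
    then have "((\<lambda>t. (\<delta> + t) powr (1 - c)) has_real_derivative (1 - c) * (\<delta> + t) powr - c) (at t)"
      by (auto intro!: derivative_eq_intros)
    from DERIV_cdivide[OF this, of "1 - c"] assms
    show "((\<lambda>t. (\<delta> + t) powr (1 - c) / (1 - c)) has_real_derivative (\<delta> + t) powr - c) (at t)"
      by simp
  next
    have "filterlim (\<lambda>t. \<delta> + t) at_top at_top"
      by (intro filterlim_tendsto_add_at_top[OF tendsto_const]) (rule filterlim_ident)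
    then have "((\<lambda>t. (\<delta> + t) powr (1 - c)) \<longlongrightarrow> 0) at_top"
      using assms by (intro tendsto_neg_powr) auto
    from tendsto_divide[OF this tendsto_const[of "1 - c"]] assms
    show "((\<lambda>t. (\<delta> + t) powr (1 - c) / (1 - c)) \<longlongrightarrow> 0) at_top"
      by simp
  qed auto
  also have "0 - (\<delta> + y) powr (1 - c) / (1 - c) = (\<delta> + y) powr (1 - c) / (c - 1)"
    using assms by (simp add: field_simps)
  finally show ?thesis .
qed

text \<open>Layer cake: (\<delta> + y)^(-c) is the integral of c (\<delta> + t)^(-c-1) over t \<ge>
  y, and the strip |Im u| \<le> t has measure at most 4 t / \<pi>. Here |Im u| plays the role of the
  angle in the classical circle integral.\<close>

lemma nn_integral_dA_strip_powr:
  assumes c: "1 < c" and \<delta>: "0 < \<delta>"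
  shows "(\<integral>\<^sup>+u. ennreal ((\<delta> + \<bar>Im u\<bar>) powr - c) \<partial>dA) \<le> ennreal (4 * c / (pi * (c - 1)) * \<delta> powr (1 - c))"
proof -
  interpret P: pair_sigma_finite dA lborel
    by (intro pair_sigma_finite.intro) unfold_locales
  let ?f = "\<lambda>t. ennreal (c * (\<delta> + t) powr (- c - 1))"
  have layer: "ennreal ((\<delta> + y) powr - c) = (\<integral>\<^sup>+t. ?f t * indicator {y..} t \<partial>lborel)" if "0 \<le> y" for y
  proof -
    have "(\<integral>\<^sup>+t. ?f t * indicator {y..} t \<partial>lborel) =
        (\<integral>\<^sup>+t. ennreal c * (ennreal ((\<delta> + t) powr - (c + 1)) * indicator {y..} t) \<partial>lborel)"
      using c by (intro nn_integral_cong) (auto simp: ennreal_mult mult.assoc)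
    also have "\<dots> = ennreal ((\<delta> + y) powr - c)"
      using nn_integral_powr_atLeast[of "c + 1" \<delta> y] c \<delta> that
      by (subst nn_integral_cmult) (auto simp flip: ennreal_mult)
    finally show ?thesis ..
  qed
  have m: "(\<lambda>(u, t). ?f t * indicator {\<bar>Im u\<bar>..} t) \<in> borel_measurable (dA \<Otimes>\<^sub>M lborel)"
  proof -
    have [measurable]: "(\<lambda>p. Im (fst p)) \<in> borel_measurable (dA \<Otimes>\<^sub>M lborel)"
      by (rule measurable_compose[OF measurable_fst borel_measurable_dA]) measurable
    have "(\<lambda>p. ?f (snd p) * (if \<bar>Im (fst p)\<bar> \<le> snd p then 1 else 0)) \<in> borel_measurable (dA \<Otimes>\<^sub>M lborel)"
      by measurable
    then show ?thesis
      by (simp add: case_prod_unfold indicator_def)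
  qed
  have "(\<integral>\<^sup>+u. ennreal ((\<delta> + \<bar>Im u\<bar>) powr - c) \<partial>dA) =
      (\<integral>\<^sup>+u. (\<integral>\<^sup>+t. ?f t * indicator {\<bar>Im u\<bar>..} t \<partial>lborel) \<partial>dA)"
    by (intro nn_integral_cong layer) simp
  also have "\<dots> = (\<integral>\<^sup>+t. (\<integral>\<^sup>+u. ?f t * indicator {\<bar>Im u\<bar>..} t \<partial>dA) \<partial>lborel)"
    by (rule P.Fubini'[OF m, symmetric])
  also have "\<dots> \<le> (\<integral>\<^sup>+t. ennreal (4 * c / pi) * (ennreal ((\<delta> + t) powr - c) * indicator {0..} t) \<partial>lborel)"
  proof (rule nn_integral_mono)
    fix t :: real
    have [measurable]: "{u \<in> ball 0 1. \<bar>Im u\<bar> \<le> t} \<in> sets dA"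
      using measurable_sets[OF borel_measurable_dA[of "\<lambda>u. \<bar>Im u\<bar>"], of "{..t}"]
      by (simp add: vimage_def Int_def conj_commute)
    have "(\<integral>\<^sup>+u. ?f t * indicator {\<bar>Im u\<bar>..} t \<partial>dA) = (\<integral>\<^sup>+u. ?f t * indicator {u \<in> ball 0 1. \<bar>Im u\<bar> \<le> t} u \<partial>dA)"
      by (intro nn_integral_cong) (auto split: split_indicator)
    also have "\<dots> = ?f t * emeasure dA {u \<in> ball 0 1. \<bar>Im u\<bar> \<le> t}"
      by (rule nn_integral_cmult_indicator) measurable
    also have "\<dots> \<le> ennreal (4 * c / pi) * (ennreal ((\<delta> + t) powr - c) * indicator {0..} t)"
    proof (cases "0 \<le> t")
      case True
      have "?f t * emeasure dA {u \<in> ball 0 1. \<bar>Im u\<bar> \<le> t} \<le> ?f t * ennreal (4 * t / pi)"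
        by (intro mult_left_mono emeasure_dA_strip True) simp
      also have "\<dots> = ennreal (4 * c / pi * (t * (\<delta> + t) powr (- c - 1)))"
        using True c by (simp add: field_simps flip: ennreal_mult)
      also have "\<dots> \<le> ennreal (4 * c / pi * ((\<delta> + t) powr - c))"
      proof (intro ennreal_leI mult_left_mono)
        have "t * (\<delta> + t) powr (- c - 1) \<le> (\<delta> + t) * (\<delta> + t) powr (- c - 1)"
          using \<delta> by (intro mult_right_mono) auto
        also have "\<dots> = (\<delta> + t) powr - c"
          using True \<delta> powr_add[of "\<delta> + t" 1 "- c - 1"] by simp
        finally show "t * (\<delta> + t) powr (- c - 1) \<le> (\<delta> + t) powr - c" .
      qed (use c in auto)
      finally show ?thesis
        using True c by (simp flip: ennreal_mult)
    next
      case False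
      then have "{u \<in> ball 0 1. \<bar>Im u\<bar> \<le> t} = {}" by auto
      then show ?thesis by (simp only: emeasure_empty) simp
    qed
    finally show "(\<integral>\<^sup>+u. ?f t * indicator {\<bar>Im u\<bar>..} t \<partial>dA) \<le> \<dots>" .
  qed
  also have "\<dots> = ennreal (4 * c / pi) * ennreal (\<delta> powr (1 - c) / (c - 1))"
    using nn_integral_powr_atLeast[of c \<delta> 0] c \<delta> by (subst nn_integral_cmult) auto
  also have "\<dots> = ennreal (4 * c / (pi * (c - 1)) * \<delta> powr (1 - c))"
    using c by (simp add: field_simps flip: ennreal_mult)
  finally show ?thesis .
qed

text \<open>Both 1 - r and r |Im u| are lower bounds for the left-over distance. The second is weak
  for small r, but for r < 1/2 the first exceeds 1/2 and so dominates |Im u| \<le> 1 as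
  well.\<close>

lemma norm_one_minus_sgn_ge:
  assumes "0 \<le> r" "r < 1" "norm u < 1"
  shows "(1 - r + \<bar>Im u\<bar>) / 4 \<le> norm (1 - of_real r * sgn u)"
proof -
  have "norm (of_real r * sgn u) \<le> r"
    using assms by (simp add: norm_mult norm_sgn)
  then have 1: "1 - r \<le> norm (1 - of_real r * sgn u)"
    using norm_triangle_ineq2[of 1 "of_real r * sgn u"] by simp
  have u: "\<bar>Im u\<bar> \<le> 1"
    using abs_Im_le_cmod[of u] assms by linarith
  have "\<bar>Im u\<bar> \<le> \<bar>Im (sgn u)\<bar>"
  proof (cases "u = 0")
    case False
    then have "\<bar>Im u\<bar> * norm u \<le> \<bar>Im u\<bar>"
      using assms by (intro mult_left_le) auto
    then show ?thesis
      using False by (simp add: Im_sgn le_divide_eq abs_divide)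
  qed simp
  then have "r * \<bar>Im u\<bar> \<le> \<bar>Im (1 - of_real r * sgn u)\<bar>"
    using assms mult_left_mono[of "\<bar>Im u\<bar>" "\<bar>Im (sgn u)\<bar>" r] by (simp add: abs_mult)
  also have "\<dots> \<le> norm (1 - of_real r * sgn u)"
    by (rule abs_Im_le_cmod)
  finally have 2: "r * \<bar>Im u\<bar> \<le> norm (1 - of_real r * sgn u)" .
  show ?thesis
  proof (cases "r \<ge> 1 / 2")
    case True
    then have "1 / 2 * \<bar>Im u\<bar> \<le> r * \<bar>Im u\<bar>"
      by (intro mult_right_mono) auto
    with 1 2 assms show ?thesis by (simp add: field_simps)
  next
    case False
    with 1 u show ?thesis by (simp add: field_simps)
  qed
qed

text \<open>Rotating u by \<open>sgn w\<close> makes the second factor real, so the mean depends on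
  |w| only.\<close>

lemma nn_integral_dA_angular_eq:
  "(\<integral>\<^sup>+u. ennreal (norm (1 - sgn u * cnj w) powr - c) \<partial>dA) =
    (\<integral>\<^sup>+u. ennreal (norm (1 - of_real (norm w) * sgn u) powr - c) \<partial>dA)"
proof (cases "w = 0")
  case False
  have "sgn w * cnj w = of_real (norm w)"
    using False by (simp add: sgn_div_norm scaleR_conv_of_real complex_norm_square[symmetric]
        field_simps power2_eq_square flip: of_real_inverse)
  then have "sgn (sgn w * u) * cnj w = of_real (norm w) * sgn u" for u
    by (simp add: sgn_mult mult_ac)
  then show ?thesis
    using nn_integral_dA_rotation[of "sgn w" "\<lambda>u. ennreal (norm (1 - sgn u * cnj w) powr - c)"] False
    by (simp add: norm_sgn)
qed simp

lemma nn_integral_dA_angular_le: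
  assumes c: "1 < c" and w: "norm w < 1"
  shows "(\<integral>\<^sup>+u. ennreal (norm (1 - sgn u * cnj w) powr - c) \<partial>dA) \<le>
    ennreal (4 powr c * (4 * c / (pi * (c - 1))) * (1 - norm w) powr (1 - c))"
proof -
  let ?g = "\<lambda>r u. ennreal (norm (1 - of_real r * sgn u) powr - c)"
  have "(\<integral>\<^sup>+u. ?g (norm w) u \<partial>dA) \<le> (\<integral>\<^sup>+u. ennreal (4 powr c) * ennreal ((1 - norm w + \<bar>Im u\<bar>) powr - c) \<partial>dA)"
  proof (rule nn_integral_mono)
    fix u assume "u \<in> space dA"
    then have "(1 - norm w + \<bar>Im u\<bar>) / 4 \<le> norm (1 - of_real (norm w) * sgn u)"
      using w by (intro norm_one_minus_sgn_ge) auto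
    then have "norm (1 - of_real (norm w) * sgn u) powr - c \<le> ((1 - norm w + \<bar>Im u\<bar>) / 4) powr - c"
      using w c by (intro powr_mono2') auto
    also have "\<dots> = 4 powr c * (1 - norm w + \<bar>Im u\<bar>) powr - c"
      using w by (simp add: powr_divide powr_minus field_simps)
    finally show "?g (norm w) u \<le> ennreal (4 powr c) * ennreal ((1 - norm w + \<bar>Im u\<bar>) powr - c)"
      by (simp flip: ennreal_mult)
  qed
  also have "\<dots> = ennreal (4 powr c) * (\<integral>\<^sup>+u. ennreal ((1 - norm w + \<bar>Im u\<bar>) powr - c) \<partial>dA)"
    by (intro nn_integral_cmult borel_measurable_dA) measurable
  also have "\<dots> \<le> ennreal (4 powr c) * ennreal (4 * c / (pi * (c - 1)) * (1 - norm w) powr (1 - c))"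
    using w c by (intro mult_left_mono nn_integral_dA_strip_powr) auto
  also have "\<dots> = ennreal (4 powr c * (4 * c / (pi * (c - 1))) * (1 - norm w) powr (1 - c))"
    using c by (simp add: mult.assoc flip: ennreal_mult)
  finally show ?thesis
    unfolding nn_integral_dA_angular_eq .
qed

text \<open>Only directions within an angle of order 1 - r from 1 are kept; there the distance is at
  most 3 (1 - r), and they already give the full order (1 - r)^(1-c).\<close>

lemma nn_integral_dA_angular_ge:
  assumes c: "1 < c" and r: "0 \<le> r" "r < 1"
  shows "ennreal (3 powr - c / (8 * pi) * (1 - r) powr (1 - c)) \<le>
    (\<integral>\<^sup>+u. ennreal (norm (1 - of_real r * sgn u) powr - c) \<partial>dA)"
proof -
  define \<delta> where "\<delta> = 1 - r"
  have \<delta>: "0 < \<delta>" "\<delta> \<le> 1" using r by (auto simp: \<delta>_def)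
  \<comment> \<open>A box of area \<delta>/8 inside the disc. Its real parts are at least 1/2, which
    keeps |u| away from 0, so that |u - norm u| \<le> \<delta> yields |1 - sgn u| \<le> 2
    \<delta>.\<close>
  let ?B = "cbox (Complex (1 / 2) 0) (Complex (3 / 4) (\<delta> / 2))"
  have B: "?B \<subseteq> ball 0 1"
  proof
    fix u assume u: "u \<in> ?B"
    have "(Re u)\<^sup>2 + (Im u)\<^sup>2 \<le> (3 / 4)\<^sup>2 + (1 / 2)\<^sup>2"
      using u \<delta> by (intro add_mono power_mono) (auto simp: in_cbox_complex_iff)
    also have "\<dots> < 1" by (simp add: power2_eq_square)
    finally show "u \<in> ball 0 1"
      by (simp add: cmod_def)
  qed
  have ptw: "norm (1 - of_real r * sgn u) \<le> 3 * \<delta>" if u: "u \<in> ?B" for u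
  proof -
    have x: "1 / 2 \<le> Re u" "0 \<le> Im u" "Im u \<le> \<delta> / 2"
      using u by (auto simp: in_cbox_complex_iff)
    then have nu: "1 / 2 \<le> norm u" "u \<noteq> 0"
      using complex_Re_le_cmod[of u] by auto
    have "norm u * norm (1 - sgn u) = norm (of_real (norm u) * (1 - sgn u))"
      by (simp add: norm_mult)
    also have "of_real (norm u) * (1 - sgn u) = of_real (norm u) - u"
      using nu by (simp add: sgn_eq right_diff_distrib)
    also have "norm (of_real (norm u) - u) \<le> \<bar>norm u - Re u\<bar> + \<bar>Im u\<bar>"
      using cmod_le[of "of_real (norm u) - u"] by simp
    also have "\<dots> \<le> \<delta>"
      using cmod_le[of u] complex_Re_le_cmod[of u] x by linarith
    finally have "1 / 2 * norm (1 - sgn u) \<le> \<delta>"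
      using nu mult_right_mono[of "1 / 2" "norm u" "norm (1 - sgn u)"] by simp
    then have "r * norm (1 - sgn u) \<le> 2 * \<delta>"
      using r mult_right_mono[of r 1 "norm (1 - sgn u)"] by simp
    moreover have "1 - of_real r * sgn u = of_real \<delta> + of_real r * (1 - sgn u)"
      by (simp add: \<delta>_def algebra_simps)
    moreover have "norm (of_real \<delta> + of_real r * (1 - sgn u)) \<le> \<delta> + r * norm (1 - sgn u)"
      using norm_triangle_ineq[of "of_real \<delta>" "of_real r * (1 - sgn u)"] r \<delta> by (simp add: norm_mult)
    ultimately show ?thesis by simp
  qed
  have pos: "0 < norm (1 - of_real r * sgn u)" if "u \<in> ball 0 1" for u :: complex
    using norm_one_minus_sgn_ge[of r u] r that by auto
  have [measurable]: "?B \<in> sets dA"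
    unfolding sets_dA using B by (subst sets_restrict_space_iff) auto
  have "ennreal (3 powr - c / (8 * pi) * \<delta> powr (1 - c)) = ennreal ((3 * \<delta>) powr - c) * ennreal (1 / pi * (\<delta> / 8))"
  proof -
    have "\<delta> powr (1 - c) = \<delta> * \<delta> powr - c"
      using \<delta> powr_add[of \<delta> 1 "- c"] by simp
    then show ?thesis
      using \<delta> by (simp add: powr_mult mult_ac flip: ennreal_mult)
  qed
  also have "ennreal (1 / pi * (\<delta> / 8)) = ennreal (1 / pi) * emeasure lborel ?B"
    using \<delta> by (subst emeasure_lborel_cbox) (auto simp: Basis_complex_def simp flip: ennreal_mult)
  also have "\<dots> = emeasure dA ?B"
    using emeasure_dA_lborel[of ?B] B by (simp add: Int_absorb2)
  also have "ennreal ((3 * \<delta>) powr - c) * emeasure dA ?B =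
      (\<integral>\<^sup>+u. ennreal ((3 * \<delta>) powr - c) * indicator ?B u \<partial>dA)"
    by (rule nn_integral_cmult_indicator[symmetric]) measurable
  also have "\<dots> \<le> (\<integral>\<^sup>+u. ennreal (norm (1 - of_real r * sgn u) powr - c) \<partial>dA)"
    using c pos ptw
    by (intro nn_integral_mono) (auto split: split_indicator intro!: ennreal_leI powr_mono2')
  finally show ?thesis
    unfolding \<delta>_def .
qed

section \<open>Orthogonality of monomials\<close>

lemma borel_measurable_cnj [measurable]: "cnj \<in> borel_measurable borel"
  by (intro borel_measurable_continuous_onI continuous_intros)

text \<open>A rotation by \<pi> / (m - n) multiplies the integrand by -1 and preserves the integral,
  which is therefore its own negative.\<close>

lemma integral_dA_monomials:
  fixes W :: "real \<Rightarrow> real"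
  assumes [measurable]: "W \<in> borel_measurable borel" and mn: "m \<noteq> n"
  shows "(LINT z|dA. of_real (W (norm z)) * (z ^ m * cnj z ^ n)) = 0"
proof -
  let ?g = "\<lambda>z. of_real (W (norm z)) * (z ^ m * cnj z ^ n)"
  define \<zeta> where "\<zeta> = cis (pi / (real m - real n))"
  have "real m - real n \<noteq> 0" using mn by simp
  then have "real m * (pi / (real m - real n)) - real n * (pi / (real m - real n)) = pi"
    by (simp add: divide_simps) (simp add: algebra_simps)
  then have "\<zeta> ^ m * cnj \<zeta> ^ n = -1"
    unfolding \<zeta>_def cis_cnj Complex.DeMoivre cis_mult by (simp add: right_diff_distrib)
  then have "?g (\<zeta> * z) = - ?g z" for z
    by (simp add: norm_mult \<zeta>_def power_mult_distrib mult_ac)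
  moreover have "(LINT z|dA. ?g (\<zeta> * z)) = (LINT z|dA. ?g z)"
    by (rule integral_dA_rotation) (auto simp: \<zeta>_def)
  ultimately have "- (LINT z|dA. ?g z) = (LINT z|dA. ?g z)"
    by simp
  then show ?thesis
    by (simp add: equation_minus_iff[symmetric] neg_equal_zero) 
qed

text \<open>Parseval for a radial weight: in the expanded square only the diagonal survives, because
  \<open>n\<close> is injective on \<open>I\<close>. The index type is arbitrary since the square of
  a lacunary sum is indexed by pairs.\<close>

lemma nn_integral_dA_norm_sum_monomials:
  fixes a :: "'i \<Rightarrow> complex" and W :: "real \<Rightarrow> real"
  assumes I: "finite I" "inj_on n I"
    and W [measurable]: "W \<in> borel_measurable borel" and W0: "\<And>x. 0 \<le> W x"
    and int: "integrable dA (\<lambda>z. W (norm z))"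
  shows "(\<integral>\<^sup>+z. ennreal (W (norm z) * (norm (\<Sum>i\<in>I. a i * z ^ n i))\<^sup>2) \<partial>dA) =
    ennreal (\<Sum>i\<in>I. (norm (a i))\<^sup>2 * (LINT z|dA. W (norm z) * norm z ^ (2 * n i)))"
proof -
  let ?S = "\<lambda>z. \<Sum>i\<in>I. a i * z ^ n i"
  have bound: "norm (z ^ k * cnj z ^ l) \<le> 1" if "norm z < 1" for z :: complex and k l
    using that by (simp add: norm_mult norm_power mult_le_one power_le_one)
  have int_kl: "integrable dA (\<lambda>z. of_real (W (norm z)) * (z ^ k * cnj z ^ l))" for k l
  proof (rule Bochner_Integration.integrable_bound[OF int])
    show "AE z in dA. norm (complex_of_real (W (norm z)) * (z ^ k * cnj z ^ l)) \<le> norm (W (norm z))"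
      by (intro AE_I2) (use bound in \<open>auto simp: norm_mult[of "of_real _"] intro!: mult_left_le\<close>)
  qed (rule borel_measurable_dA, measurable)
  have eq: "of_real (W (norm z) * (norm (?S z))\<^sup>2) =
      (\<Sum>i\<in>I. \<Sum>j\<in>I. (a i * cnj (a j)) * (of_real (W (norm z)) * (z ^ n i * cnj z ^ n j)))" for z
  proof -
    have "of_real (W (norm z) * (norm (?S z))\<^sup>2) = of_real (W (norm z)) * (?S z * cnj (?S z))"
      by (simp only: of_real_mult complex_norm_square)
    also have "?S z * cnj (?S z) = (\<Sum>i\<in>I. \<Sum>j\<in>I. (a i * cnj (a j)) * (z ^ n i * cnj z ^ n j))"
      by (simp add: sum_product mult_ac)
    finally show ?thesis by (simp add: sum_distrib_left mult_ac)
  qed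
  have int_sq: "integrable dA (\<lambda>z. complex_of_real (W (norm z) * (norm (?S z))\<^sup>2))"
    unfolding eq by (intro Bochner_Integration.integrable_sum integrable_mult_right int_kl)
  then have int_sq': "integrable dA (\<lambda>z. W (norm z) * (norm (?S z))\<^sup>2)"
    using integrable_Re by fastforce
  have diag: "z ^ k * cnj z ^ k = of_real (norm z ^ (2 * k))" for z k
    by (simp add: power_mult_distrib[symmetric] complex_norm_square[symmetric] power_mult)
  have "complex_of_real (LINT z|dA. W (norm z) * (norm (?S z))\<^sup>2) =
      (LINT z|dA. complex_of_real (W (norm z) * (norm (?S z))\<^sup>2))"
    by (rule integral_complex_of_real[symmetric])
  also have "\<dots> = (\<Sum>i\<in>I. \<Sum>j\<in>I. (a i * cnj (a j)) * (LINT z|dA. of_real (W (norm z)) * (z ^ n i * cnj z ^ n j)))"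
    unfolding eq by (simp only: Bochner_Integration.integral_sum Bochner_Integration.integrable_sum integrable_mult_right int_kl integral_mult_right integral_mult_right_zero)
  also have "\<dots> = (\<Sum>i\<in>I. \<Sum>j\<in>I. if i = j then (a i * cnj (a i)) * (LINT z|dA. of_real (W (norm z)) * (z ^ n i * cnj z ^ n i)) else 0)"
    using I(2) by (intro sum.cong refl) (auto simp: integral_dA_monomials inj_on_eq_iff)
  also have "\<dots> = (\<Sum>i\<in>I. (a i * cnj (a i)) * (LINT z|dA. of_real (W (norm z)) * (z ^ n i * cnj z ^ n i)))"
    using I(1) by (simp add: sum.delta')
  also have "\<dots> = complex_of_real (\<Sum>i\<in>I. (norm (a i))\<^sup>2 * (LINT z|dA. W (norm z) * norm z ^ (2 * n i)))"
    unfolding diag of_real_sum of_real_mult complex_norm_square integral_complex_of_real[symmetric] ..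
  finally have "(LINT z|dA. W (norm z) * (norm (?S z))\<^sup>2) = 
      (\<Sum>i\<in>I. (norm (a i))\<^sup>2 * (LINT z|dA. W (norm z) * norm z ^ (2 * n i)))"
    by (simp only: of_real_eq_iff)
  then show ?thesis
    using nn_integral_eq_integral[OF int_sq'] W0 by simp
qed

section \<open>Bessel's inequality for square integrable functions\<close>

lemma of_real_integral_norm_square:
  fixes f :: "'a \<Rightarrow> complex"
  shows "complex_of_real (LINT x|M. (norm (f x))\<^sup>2) = (LINT x|M. f x * cnj (f x))"
  by (simp only: integral_complex_of_real[symmetric] complex_norm_square)

lemma integrable_mult_cnj:
  fixes f g :: "'a \<Rightarrow> complex"
  assumes [measurable]: "f \<in> borel_measurable M" "g \<in> borel_measurable M"
    and "integrable M (\<lambda>x. (norm (f x))\<^sup>2)" "integrable M (\<lambda>x. (norm (g x))\<^sup>2)"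
  shows "integrable M (\<lambda>x. f x * cnj (g x))"
proof (rule Bochner_Integration.integrable_bound)
  show "integrable M (\<lambda>x. (norm (f x))\<^sup>2 + (norm (g x))\<^sup>2)"
    using assms by simp
  have "norm (f x * cnj (g x)) \<le> (norm (f x))\<^sup>2 + (norm (g x))\<^sup>2" for x
  proof -
    have "2 * norm (f x) * norm (g x) \<le> (norm (f x))\<^sup>2 + (norm (g x))\<^sup>2"
      by (rule sum_squares_bound)
    moreover have "0 \<le> norm (f x) * norm (g x)" by simp
    ultimately show ?thesis unfolding norm_mult complex_mod_cnj by linarith
  qed
  then show "AE x in M. norm (f x * cnj (g x)) \<le> norm ((norm (f x))\<^sup>2 + (norm (g x))\<^sup>2)"
    by simp
qed measurable

text \<open>The squared distance from \<open>g\<close> to its projection on the span of the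
  \<open>e i\<close> is nonnegative. The \<open>e i\<close> are orthogonal but not normalized, so
  the projection coefficients \<open>y i\<close> and the sum carry the divisor
  \<open>\<gamma> i\<close>.\<close>

lemma Bessel_inequality_integral:
  fixes e :: "'i \<Rightarrow> 'a \<Rightarrow> complex"
  assumes I: "finite I"
    and [measurable]: "g \<in> borel_measurable M" "\<And>i. e i \<in> borel_measurable M"
    and int_g: "integrable M (\<lambda>x. (norm (g x))\<^sup>2)"
    and int_e: "\<And>i. integrable M (\<lambda>x. (norm (e i x))\<^sup>2)"
    and orth: "\<And>i j. i \<noteq> j \<Longrightarrow> (LINT x|M. e i x * cnj (e j x)) = 0"
    and pos: "\<And>i. 0 < (LINT x|M. (norm (e i x))\<^sup>2)"
  shows "(\<Sum>i\<in>I. (norm (LINT x|M. g x * cnj (e i x)))\<^sup>2 / (LINT x|M. (norm (e i x))\<^sup>2)) \<le>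
    (LINT x|M. (norm (g x))\<^sup>2)"
proof -
  define \<gamma> where "\<gamma> i = (LINT x|M. (norm (e i x))\<^sup>2)" for i
  define \<beta> where "\<beta> i = (LINT x|M. g x * cnj (e i x))" for i
  define y where "y i = \<beta> i / of_real (\<gamma> i)" for i
  let ?S = "\<lambda>x. \<Sum>i\<in>I. y i * e i x"
  let ?B = "\<Sum>i\<in>I. (norm (\<beta> i))\<^sup>2 / \<gamma> i"
  have \<gamma>: "\<gamma> i > 0" for i using pos by (simp add: \<gamma>_def)
  have ge: "integrable M (\<lambda>x. g x * cnj (e i x))" and ee: "integrable M (\<lambda>x. e i x * cnj (e j x))"
    and gg: "integrable M (\<lambda>x. g x * cnj (g x))" for i j
    by (intro integrable_mult_cnj int_g int_e; measurable)+
  have eg: "integrable M (\<lambda>x. e i x * cnj (g x))" for i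
    by (intro integrable_mult_cnj int_g int_e) measurable
  have expand: "complex_of_real ((norm (g x - ?S x))\<^sup>2) = g x * cnj (g x)
      - (\<Sum>i\<in>I. cnj (y i) * (g x * cnj (e i x))) - (\<Sum>i\<in>I. y i * (e i x * cnj (g x)))
      + (\<Sum>i\<in>I. \<Sum>j\<in>I. (y i * cnj (y j)) * (e i x * cnj (e j x)))" for x
  proof -
    have "complex_of_real ((norm (g x - ?S x))\<^sup>2) =
        g x * cnj (g x) - g x * cnj (?S x) - ?S x * cnj (g x) + ?S x * cnj (?S x)"
      unfolding complex_norm_square by (simp only: complex_cnj_diff) (simp only: algebra_simps)
    moreover have "g x * cnj (?S x) = (\<Sum>i\<in>I. cnj (y i) * (g x * cnj (e i x)))"
      by (simp add: sum_distrib_left mult_ac)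
    moreover have "?S x * cnj (g x) = (\<Sum>i\<in>I. y i * (e i x * cnj (g x)))"
      by (simp only: sum_distrib_right mult.assoc)
    moreover have "?S x * cnj (?S x) = (\<Sum>i\<in>I. \<Sum>j\<in>I. (y i * cnj (y j)) * (e i x * cnj (e j x)))"
      by (simp add: sum_product mult_ac)
    ultimately show ?thesis by simp
  qed
  have "(LINT x|M. e i x * cnj (g x)) = cnj (\<beta> i)" for i
    unfolding \<beta>_def using integral_bounded_linear[OF bounded_linear_cnj ge[of i]] by (simp add: mult.commute)
  moreover have "(LINT x|M. e i x * cnj (e j x)) = (if i = j then of_real (\<gamma> i) else 0)" for i j
    using orth by (simp add: \<gamma>_def of_real_integral_norm_square)
  ultimately have "(LINT x|M. complex_of_real ((norm (g x - ?S x))\<^sup>2)) = (LINT x|M. g x * cnj (g x))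
      - (\<Sum>i\<in>I. cnj (y i) * \<beta> i) - (\<Sum>i\<in>I. y i * cnj (\<beta> i))
      + (\<Sum>i\<in>I. \<Sum>j\<in>I. (y i * cnj (y j)) * (if i = j then of_real (\<gamma> i) else 0))"
    unfolding expand
    by (simp add: Bochner_Integration.integral_sum Bochner_Integration.integrable_sum integrable_mult_right ge ee gg eg integral_mult_right
        Bochner_Integration.integrable_diff Bochner_Integration.integral_diff
        Bochner_Integration.integral_add Bochner_Integration.integrable_add flip: \<beta>_def)
  also have "(\<Sum>i\<in>I. \<Sum>j\<in>I. (y i * cnj (y j)) * (if i = j then of_real (\<gamma> i) else 0)) =
      (\<Sum>i\<in>I. y i * cnj (y i) * of_real (\<gamma> i))"
    using I by (simp add: if_distrib[of "\<lambda>x. _ * x"] sum.delta cong: if_cong)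
  also have "\<dots> = (\<Sum>i\<in>I. y i * cnj (\<beta> i))"
    using \<gamma> by (intro sum.cong) (auto simp: y_def less_imp_neq[symmetric])
  also have "(\<Sum>i\<in>I. cnj (y i) * \<beta> i) = of_real ?B"
    unfolding of_real_sum of_real_divide complex_norm_square
    by (intro sum.cong) (auto simp: y_def mult.commute)
  also have "(LINT x|M. g x * cnj (g x)) = of_real (LINT x|M. (norm (g x))\<^sup>2)"
    by (simp only: of_real_integral_norm_square)
  finally have "complex_of_real (LINT x|M. (norm (g x - ?S x))\<^sup>2) = of_real ((LINT x|M. (norm (g x))\<^sup>2) - ?B)"
    by (simp only: integral_complex_of_real of_real_diff diff_add_cancel)
  then have "(LINT x|M. (norm (g x))\<^sup>2) - ?B = (LINT x|M. (norm (g x - ?S x))\<^sup>2)"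
    by (simp only: of_real_eq_iff)
  also have "\<dots> \<ge> 0" by simp
  finally show ?thesis
    by (simp add: \<beta>_def \<gamma>_def)
qed

section \<open>The binomial series\<close>

text \<open>The Taylor coefficient of (1 - x)^(-c) at \<open>x ^ n\<close>. In this form it is
  visibly positive for c > 0, whereas \<open>- c gchoose n\<close> alternates in sign.\<close>

definition binom_coeff :: "real \<Rightarrow> nat \<Rightarrow> real" where
  "binom_coeff c n = pochhammer c n / fact n"

lemma binom_coeff_pos: "0 < c \<Longrightarrow> 0 < binom_coeff c n"
  by (simp add: binom_coeff_def pochhammer_pos)

lemma sums_binom_coeff_real:
  assumes "\<bar>x\<bar> < 1"
  shows "(\<lambda>n. binom_coeff c n * x ^ n) sums (1 - x) powr - c"
proof -
  have "(\<lambda>n. (- c gchoose n) * (- x) ^ n) sums (1 + - x) powr - c"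
    using assms by (intro gen_binomial_real) simp
  moreover have "(- c gchoose n) * (- x) ^ n = binom_coeff c n * x ^ n" for n
  proof -
    have "(- c gchoose n) * (- x) ^ n = ((- 1) ^ n * (- 1) ^ n) * (binom_coeff c n * x ^ n)"
      by (simp add: gbinomial_pochhammer binom_coeff_def power_minus[of x])
    then show ?thesis by (simp flip: power_mult_distrib)
  qed
  ultimately show ?thesis by simp
qed

lemma sums_binom_coeff_complex:
  assumes "norm x < 1"
  shows "(\<lambda>n. of_real (binom_coeff c n) * x ^ n) sums (1 / (1 - x) powr of_real c :: complex)"
proof -
  have "(\<lambda>n. (- of_real c gchoose n) * (- x) ^ n) sums (1 + - x) powr - of_real c"
    using assms by (intro gen_binomial_complex) simp
  moreover have "(- of_real c gchoose n) * (- x) ^ n = of_real (binom_coeff c n) * x ^ n" for n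
  proof -
    have "(- of_real c gchoose n) * (- x) ^ n = ((- 1) ^ n * (- 1) ^ n) * (of_real (binom_coeff c n) * x ^ n)"
      by (simp add: gbinomial_pochhammer binom_coeff_def power_minus[of x] pochhammer_of_real)
    then show ?thesis by (simp flip: power_mult_distrib)
  qed
  ultimately show ?thesis
    by (simp add: powr_minus divide_inverse)
qed

text \<open>For fixed z in the disc, |z cnj w| \<le> |z| < 1 uniformly in w, so the binomial series
  can be integrated term by term against an integrable \<open>G\<close>. The integral thus converges
  absolutely at every z, and its Taylor coefficients are moments of \<open>G\<close> times binomial
  coefficients.\<close>

lemma
  fixes G :: "complex \<Rightarrow> complex"
  assumes c: "0 < c" and z: "norm z < 1" and G: "integrable dA G"
  shows integrable_cauchy_kernel: "integrable dA (\<lambda>w. G w / (1 - z * cnj w) powr of_real c)"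
    and sums_cauchy_kernel: "(\<lambda>n. of_real (binom_coeff c n) * (LINT w|dA. cnj w ^ n * G w) * z ^ n) sums
      (LINT w|dA. G w / (1 - z * cnj w) powr of_real c)"
proof -
  let ?f = "\<lambda>n w. of_real (binom_coeff c n) * (z * cnj w) ^ n * G w"
  have [measurable]: "G \<in> borel_measurable dA" using G by simp
  have [measurable]: "(\<lambda>w. w) \<in> borel_measurable dA" by (rule measurable_id_dA)
  have bnd: "norm (?f n w) \<le> binom_coeff c n * norm z ^ n * norm (G w)" if "norm w < 1" for n w
  proof -
    have "norm w ^ n \<le> 1" using that by (simp add: power_le_one)
    then have "(binom_coeff c n * norm z ^ n * norm (G w)) * norm w ^ n \<le> binom_coeff c n * norm z ^ n * norm (G w)"
      using binom_coeff_pos[OF c, of n] by (intro mult_left_le) auto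
    then show ?thesis
      using binom_coeff_pos[OF c, of n]
      by (simp add: norm_mult norm_power power_mult_distrib mult_ac)
  qed
  have summ: "summable (\<lambda>n. binom_coeff c n * norm z ^ n)"
    using sums_binom_coeff_real[of "norm z" c] z by (auto simp: sums_iff)
  have int_f: "integrable dA (?f n)" for n
  proof (rule Bochner_Integration.integrable_bound)
    show "integrable dA (\<lambda>w. binom_coeff c n * norm z ^ n * norm (G w))"
      using G by simp
    show "AE w in dA. norm (?f n w) \<le> norm (binom_coeff c n * norm z ^ n * norm (G w))"
      unfolding real_norm_def by (intro AE_I2 order_trans[OF bnd abs_ge_self]) simp
  qed measurable
  have ae: "AE w in dA. summable (\<lambda>n. norm (?f n w))"
  proof (rule AE_I2)
    fix w assume "w \<in> space dA"
    then show "summable (\<lambda>n. norm (?f n w))"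
      using bnd by (intro summable_comparison_test'[OF summable_mult2[OF summ, of "norm (G w)"]]) auto
  qed
  have summI: "summable (\<lambda>n. LINT w|dA. norm (?f n w))"
  proof (rule summable_comparison_test'[OF summable_mult2[OF summ, of "LINT w|dA. norm (G w)"]])
    fix n
    have "(LINT w|dA. norm (?f n w)) \<le> (LINT w|dA. binom_coeff c n * norm z ^ n * norm (G w))"
      using G int_f bnd by (intro integral_mono) auto
    then show "norm (LINT w|dA. norm (?f n w)) \<le> binom_coeff c n * norm z ^ n * (LINT w|dA. norm (G w))"
      by simp
  qed
  have eq: "(\<Sum>n. ?f n w) = G w / (1 - z * cnj w) powr of_real c" if "w \<in> space dA" for w
  proof -
    have "norm (z * cnj w) < 1"
      using z that mult_strict_mono'[of "norm z" 1 "norm w" 1] by (simp add: norm_mult)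
    from sums_mult2[OF sums_binom_coeff_complex[OF this, of c], of "G w"]
    show ?thesis by (auto simp: sums_iff)
  qed
  show "integrable dA (\<lambda>w. G w / (1 - z * cnj w) powr of_real c)"
  proof (rule iffD1[OF Bochner_Integration.integrable_cong[OF refl] integrable_suminf[OF int_f ae summI]])
  qed (rule eq)
  have "(\<lambda>n. LINT w|dA. ?f n w) sums (LINT w|dA. (\<Sum>n. ?f n w))"
    by (rule sums_integral[OF int_f ae summI])
  moreover have "(LINT w|dA. ?f n w) = of_real (binom_coeff c n) * (LINT w|dA. cnj w ^ n * G w) * z ^ n" for n
  proof -
    have "(LINT w|dA. ?f n w) = (LINT w|dA. (of_real (binom_coeff c n) * z ^ n) * (cnj w ^ n * G w))"
      by (simp add: power_mult_distrib mult_ac)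
    also have "\<dots> = (of_real (binom_coeff c n) * z ^ n) * (LINT w|dA. cnj w ^ n * G w)"
      by (rule integral_mult_right_zero)
    finally show ?thesis by (simp add: mult_ac)
  qed
  moreover have "(LINT w|dA. (\<Sum>n. ?f n w)) = (LINT w|dA. G w / (1 - z * cnj w) powr of_real c)"
    by (intro Bochner_Integration.integral_cong refl eq)
  ultimately show "(\<lambda>n. of_real (binom_coeff c n) * (LINT w|dA. cnj w ^ n * G w) * z ^ n) sums
      (LINT w|dA. G w / (1 - z * cnj w) powr of_real c)"
    by simp
qed

text \<open>The quotient n^(c-1) / \<open>binom_coeff c n\<close> is exactly
  \<open>Gamma_series' c n\<close>, which converges to Gamma c and hence is bounded.\<close>

lemma binom_coeff_ge:
  assumes c: "0 < c"
  obtains \<kappa> where "0 < \<kappa>" "\<And>n. 0 < n \<Longrightarrow> \<kappa> * real n powr (c - 1) \<le> binom_coeff c n"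
proof -
  have "Bseq (Gamma_series' c)"
    by (intro convergent_imp_Bseq convergentI[OF Gamma_series'_LIMSEQ])
  then obtain B where B: "0 < B" "\<And>n. norm (Gamma_series' c n) \<le> B"
    by (auto simp: Bseq_def)
  show thesis
  proof
    show "0 < 1 / B" using B by simp
    fix n :: nat assume n: "0 < n"
    have p: "0 < pochhammer c n" using c by (rule pochhammer_pos)
    have "fact n = real n * fact (n - 1)"
      using n by (simp add: fact_reduce)
    moreover have "real n powr c = real n * real n powr (c - 1)"
      using n powr_add[of "real n" 1 "c - 1"] by simp
    ultimately have "real n powr (c - 1) / binom_coeff c n = Gamma_series' c n"
      using n p by (simp add: Gamma_series'_def binom_coeff_def powr_def field_simps)
    also have "\<dots> \<le> B" using B(2)[of n] by simp
    finally show "1 / B * real n powr (c - 1) \<le> binom_coeff c n"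
      using B(1) binom_coeff_pos[OF c, of n] by (simp add: field_simps)
  qed
qed

text \<open>n + c is the midpoint of n + 1 and n + 2c - 1, so log convexity bounds Gamma(n + c)^2 by
  the product of the two values. The Beta factor will be the squared norm of the n-th monomial, and
  the point is that the bound does not depend on n.\<close>

lemma binom_coeff_sq_Beta_le:
  assumes c: "1 < c"
  shows "(binom_coeff c n)\<^sup>2 * Beta (real n + 1) (2 * c - 2) \<le> Gamma (2 * c - 2) / (Gamma c)\<^sup>2"
proof -
  have "(1 - 1 / 2) *\<^sub>R (real n + 1) + (1 / 2) *\<^sub>R (real n + 2 * c - 1) = real n + c"
    by (simp add: field_simps)
  then have "ln (Gamma (real n + c)) \<le> (1 - 1 / 2) * ln (Gamma (real n + 1)) + 1 / 2 * ln (Gamma (real n + 2 * c - 1))"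
    using convex_onD[OF log_convex_Gamma_real, of "1 / 2" "real n + 1" "real n + 2 * c - 1"] c
    by simp
  then have "2 * ln (Gamma (real n + c)) \<le> ln (Gamma (real n + 1)) + ln (Gamma (real n + 2 * c - 1))"
    by simp
  moreover have pos: "0 < Gamma (real n + c)" "0 < Gamma (real n + 1)" "0 < Gamma (real n + 2 * c - 1)"
    "0 < Gamma c" "0 < Gamma (2 * c - 2)"
    using c by (auto intro!: Gamma_real_pos)
  moreover have "x\<^sup>2 \<le> y * z" if "2 * ln x \<le> ln y + ln z" "0 < x" "0 < y" "0 < z" for x y z :: real
  proof -
    have "ln (x\<^sup>2) \<le> ln (y * z)"
      using that by (simp add: ln_realpow ln_mult)
    then show ?thesis
      using that by (subst (asm) ln_le_cancel_iff) auto
  qed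
  ultimately have *: "(Gamma (real n + c))\<^sup>2 \<le> Gamma (real n + 1) * Gamma (real n + 2 * c - 1)"
    by blast
  have k: "binom_coeff c n = Gamma (real n + c) / (Gamma c * Gamma (real n + 1))"
    using c by (simp add: binom_coeff_def pochhammer_Gamma nonpos_Ints_def add.commute Gamma_fact)
  have "(binom_coeff c n)\<^sup>2 * Beta (real n + 1) (2 * c - 2) =
      (Gamma (2 * c - 2) / (Gamma c)\<^sup>2) * ((Gamma (real n + c))\<^sup>2 / (Gamma (real n + 1) * Gamma (real n + 2 * c - 1)))"
    using pos unfolding k Beta_def by (simp add: field_simps power2_eq_square)
  also have "\<dots> \<le> (Gamma (2 * c - 2) / (Gamma c)\<^sup>2) * 1"
    using pos * by (intro mult_left_mono) (auto simp: divide_le_eq_1)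
  finally show ?thesis by simp
qed

section \<open>Integrals of radial weights\<close>

lemma
  assumes "0 < a"
  shows integrable_dA_radial_powr: "integrable dA (\<lambda>z. norm z ^ (2 * n) * (1 - (norm z)\<^sup>2) powr (a - 1))"
    and integral_dA_radial_powr:
      "(LINT z|dA. norm z ^ (2 * n) * (1 - (norm z)\<^sup>2) powr (a - 1)) = Beta (real n + 1) a"
proof -
  let ?f = "\<lambda>z::complex. norm z ^ (2 * n) * (1 - (norm z)\<^sup>2) powr (a - 1)"
  have Bpos: "0 \<le> Beta (real n + 1) a"
    using assms by (auto simp: Beta_def intro!: divide_nonneg_pos mult_nonneg_nonneg less_imp_le[OF Gamma_real_pos])
  have "(\<integral>\<^sup>+z. ennreal (?f z) \<partial>dA) =
      (\<integral>\<^sup>+z. ennreal ((1 - (1 - (norm z)\<^sup>2)) ^ n * (1 - (norm z)\<^sup>2) powr (a - 1)) \<partial>dA)"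
    by (simp add: power_mult)
  also have "\<dots> = (\<integral>\<^sup>+t. ennreal ((1 - t) ^ n * t powr (a - 1)) * indicator {0..1} t \<partial>lborel)"
    by (rule nn_integral_dA_radial) measurable
  also have "\<dots> = (\<integral>\<^sup>+t. ennreal (t powr (a - 1) * (1 - t) powr ((real n + 1) - 1) * indicator {0..1} t) \<partial>lborel)"
  proof (rule nn_integral_cong_AE)
    \<comment> \<open>At t = 1 and n = 0 the power \<open>(1 - t) ^ n\<close> is 1 while
      \<open>0 powr 0\<close> is 0, so the integrands can differ at this one point.\<close>
    have "AE t in lborel. t \<noteq> (1::real)" by (rule AE_lborel_singleton)
    then show "AE t in lborel. ennreal ((1 - t) ^ n * t powr (a - 1)) * indicator {0..1} t =
        ennreal (t powr (a - 1) * (1 - t) powr ((real n + 1) - 1) * indicator {0..1} t)"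
      by eventually_elim (auto split: split_indicator simp: powr_realpow mult.commute)
  qed
  also have "\<dots> = ennreal (Beta a (real n + 1))"
    using nn_integral_has_integral_lebesgue[OF _ has_integral_Beta_real[of a "real n + 1"]] assms
    by (simp add: mult_ac ennreal_mult' ennreal_indicator)
  finally have *: "(\<integral>\<^sup>+z. ennreal (?f z) \<partial>dA) = ennreal (Beta (real n + 1) a)"
    by (simp add: Beta_commute)
  show "integrable dA ?f"
    by (rule integrableI_nonneg) (use * in \<open>auto intro!: borel_measurable_dA\<close>)
  show "(LINT z|dA. ?f z) = Beta (real n + 1) a"
    by (subst integral_eq_nn_integral) (use * Bpos in \<open>auto intro!: borel_measurable_dA\<close>)
qed

text \<open>The logarithm behind both counterexamples: it is the size of the measure dA / (1 -
  |z|^2) after cutting off the boundary.\<close>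

lemma nn_integral_dA_powr_minus_one:
  assumes \<epsilon>: "0 < \<epsilon>" "\<epsilon> \<le> 1"
  shows "(\<integral>\<^sup>+z. ennreal ((1 - (norm z)\<^sup>2) powr - 1 * of_bool (\<epsilon> \<le> 1 - (norm z)\<^sup>2)) \<partial>dA) = ennreal (ln (1 / \<epsilon>))"
proof -
  have "(\<integral>\<^sup>+z. ennreal ((1 - (norm z)\<^sup>2) powr - 1 * of_bool (\<epsilon> \<le> 1 - (norm z)\<^sup>2)) \<partial>dA) =
      (\<integral>\<^sup>+t. ennreal (t powr - 1 * of_bool (\<epsilon> \<le> t)) * indicator {0..1} t \<partial>lborel)"
    by (rule nn_integral_dA_radial) measurable
  also have "\<dots> = (\<integral>\<^sup>+t. ennreal (1 / t) * indicator {\<epsilon>..1} t \<partial>lborel)"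
    using \<epsilon> by (intro nn_integral_cong) (auto split: split_indicator simp: powr_minus_divide)
  also have "\<dots> = ln 1 - ln \<epsilon>"
    using \<epsilon> by (intro nn_integral_FTC_Icc) (auto intro!: derivative_eq_intros simp: divide_inverse)
  finally show ?thesis using \<epsilon> by (simp add: ln_div)
qed

lemma nn_integral_dA_powr_minus_two_le:
  assumes \<epsilon>: "0 < \<epsilon>"
  shows "(\<integral>\<^sup>+z. ennreal (of_bool (\<epsilon> \<le> 1 - (norm z)\<^sup>2) / (1 - (norm z)\<^sup>2)\<^sup>2) \<partial>dA) \<le> ennreal (1 / \<epsilon>)"
proof -
  have "(\<integral>\<^sup>+z. ennreal (of_bool (\<epsilon> \<le> 1 - (norm z)\<^sup>2) / (1 - (norm z)\<^sup>2)\<^sup>2) \<partial>dA) =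
      (\<integral>\<^sup>+t. ennreal (of_bool (\<epsilon> \<le> t) / t\<^sup>2) * indicator {0..1} t \<partial>lborel)"
    by (rule nn_integral_dA_radial) measurable
  also have "\<dots> \<le> (\<integral>\<^sup>+t. ennreal ((0 + t) powr - 2) * indicator {\<epsilon>..} t \<partial>lborel)"
    using \<epsilon> by (intro nn_integral_mono) (auto split: split_indicator simp: powr_minus_divide)
  also have "\<dots> = (\<integral>\<^sup>+t. ennreal ((\<epsilon> + t) powr - 2) * indicator {0..} t \<partial>lborel)"
    by (subst nn_integral_real_affine[where c = 1 and t = \<epsilon>])
       (auto intro!: nn_integral_cong split: split_indicator)
  also have "\<dots> = ennreal (1 / \<epsilon>)"
    using nn_integral_powr_atLeast[of 2 \<epsilon> 0] \<epsilon> by (simp add: powr_minus_divide)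
  finally show ?thesis .
qed

text \<open>Read with \<eta> = 1/\<lambda>, this says that the outer weight 1 / (1 - |z|^2) has weak
  norm 1. The upper bound is stated without \<eta> \<le> 1, since it is applied to thresholds that
  may be large.\<close>

lemma emeasure_dA_norm_gt:
  assumes "0 \<le> \<eta>"
  shows "emeasure dA {z \<in> ball 0 1. 1 - (norm z)\<^sup>2 < \<eta>} \<le> ennreal \<eta>"
    and "\<eta> \<le> 1 \<Longrightarrow> emeasure dA {z \<in> ball 0 1. 1 - (norm z)\<^sup>2 < \<eta>} = ennreal \<eta>"
proof -
  have m: "{z \<in> ball (0::complex) 1. 1 - (norm z)\<^sup>2 < \<eta>} \<in> sets dA"
    by (rule sets_dA_Collect) measurable
  have "emeasure dA {z \<in> ball 0 1. 1 - (norm z)\<^sup>2 < \<eta>} = (\<integral>\<^sup>+z. indicator {..<\<eta>} (1 - (norm z)\<^sup>2) \<partial>dA)"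
    unfolding nn_integral_indicator[OF m, symmetric]
    by (intro nn_integral_cong) (auto split: split_indicator)
  also have "\<dots> = (\<integral>\<^sup>+t. indicator {..<\<eta>} t * indicator {0..1} t \<partial>lborel)"
    by (rule nn_integral_dA_radial) measurable
  also have "\<dots> = emeasure lborel ({..<\<eta>} \<inter> {0..1})"
    by (simp flip: indicator_inter_arith)
  finally have *: "emeasure dA {z \<in> ball 0 1. 1 - (norm z)\<^sup>2 < \<eta>} = emeasure lborel ({..<\<eta>} \<inter> {0..1})" .
  have "emeasure lborel ({..<\<eta>} \<inter> {0..1}) \<le> emeasure lborel {0..<\<eta>}"
    by (intro emeasure_mono) auto
  with * assms show "emeasure dA {z \<in> ball 0 1. 1 - (norm z)\<^sup>2 < \<eta>} \<le> ennreal \<eta>"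
    by simp
  assume "\<eta> \<le> 1"
  then have "{..<\<eta>} \<inter> {0..1} = {0..<\<eta>}" by auto
  with * assms show "emeasure dA {z \<in> ball 0 1. 1 - (norm z)\<^sup>2 < \<eta>} = ennreal \<eta>"
    by simp
qed

section \<open>Weak type estimates for the analytic operator\<close>

text \<open>Writing \<open>G w = (1 - (norm w)\<^sup>2) powr b * f w\<close>, the operator \<open>T\<close> is
  \<open>z \<mapsto> cauchy_int c G z / (1 - (norm z)\<^sup>2)\<close>.\<close>

definition cauchy_int :: "real \<Rightarrow> (complex \<Rightarrow> complex) \<Rightarrow> complex \<Rightarrow> complex" where
  "cauchy_int c G z = (LINT w|dA. G w / (1 - z * cnj w) powr of_real c)"

text \<open>On the disc the function is the sum of its power series, which is Borel measurable as a
  countable sum of monomials.\<close>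

lemma borel_measurable_cauchy_int:
  assumes c: "0 < c" and G: "integrable dA G"
  shows "cauchy_int c G \<in> borel_measurable dA"
proof -
  have m: "(\<lambda>z. \<Sum>n. of_real (binom_coeff c n) * (LINT w|dA. cnj w ^ n * G w) * z ^ n) \<in> borel_measurable borel"
    by (intro borel_measurable_suminf) measurable
  have eq: "cauchy_int c G z = (\<Sum>n. of_real (binom_coeff c n) * (LINT w|dA. cnj w ^ n * G w) * z ^ n)"
    if "z \<in> space dA" for z
    using sums_cauchy_kernel[OF c _ G, of z] that by (simp add: cauchy_int_def sums_iff)
  show ?thesis
    using borel_measurable_dA[OF m] by (subst measurable_cong[OF eq])
qed

lemma one_minus_norm_squared:
  assumes "norm (z::complex) < 1"
  shows "0 < 1 - (norm z)\<^sup>2" "1 - (norm z)\<^sup>2 \<le> 1"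
  using assms by (auto simp: power_less_one_iff abs_square_less_1)

lemma one_minus_mult_cnj_nonzero:
  assumes "norm z < 1" "norm w < 1"
  shows "1 - z * cnj w \<noteq> 0"
proof -
  have "norm (z * cnj w) < 1"
    using assms mult_strict_mono'[of "norm z" 1 "norm w" 1] by (simp add: norm_mult)
  then show ?thesis by auto
qed

text \<open>Pushing z radially to the circle moves z cnj w by at most 1 - |z|, and this is itself at
  most |1 - z cnj w|. So the kernel on a whole radius is controlled by its value at the
  endpoint.\<close>

lemma norm_one_minus_sgn_le:
  assumes z: "norm z < 1" and w: "norm w < 1"
  shows "norm (1 - sgn z * cnj w) \<le> 2 * norm (1 - z * cnj w)"
proof -
  have "norm (z * cnj w) \<le> norm z"
    using w by (simp add: norm_mult mult_left_le)
  then have 1: "1 - norm z \<le> norm (1 - z * cnj w)"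
    using norm_triangle_ineq2[of 1 "z * cnj w"] by simp
  have "z = of_real (norm z) * sgn z"
    by (cases "z = 0") (simp_all add: sgn_eq)
  then have "1 - sgn z * cnj w = (1 - z * cnj w) - of_real (1 - norm z) * (sgn z * cnj w)"
    by (simp add: algebra_simps)
  also have "norm \<dots> \<le> norm (1 - z * cnj w) + norm (of_real (1 - norm z) * (sgn z * cnj w))"
    by (rule norm_triangle_ineq4)
  also have "norm (of_real (1 - norm z) * (sgn z * cnj w)) \<le> 1 - norm z"
  proof -
    have "norm (sgn z * cnj w) \<le> 1"
      using w by (simp add: norm_mult norm_sgn)
    then have "\<bar>1 - norm z\<bar> * norm (sgn z * cnj w) \<le> \<bar>1 - norm z\<bar>"
      by (intro mult_left_le) auto
    then show ?thesis
      using z unfolding norm_mult[of "of_real _"] norm_of_real by simp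
  qed
  finally show ?thesis using 1 by simp
qed

lemma nn_integral_dA_angular_le':
  assumes c: "1 < c" and w: "norm w < 1"
  shows "(\<integral>\<^sup>+u. ennreal (norm (1 - sgn u * cnj w) powr - c) \<partial>dA) \<le>
    ennreal (8 powr c * (4 * c / (pi * (c - 1))) * (1 - (norm w)\<^sup>2) powr (1 - c))"
proof -
  have "(1 - (norm w)\<^sup>2) / 2 \<le> 1 - norm w"
    using w sum_squares_bound[of 1 "norm w"] by (simp add: power2_eq_square field_simps)
  then have "(1 - norm w) powr (1 - c) \<le> ((1 - (norm w)\<^sup>2) / 2) powr (1 - c)"
    using c one_minus_norm_squared[OF w] by (intro powr_mono2') auto
  also have "\<dots> = 2 powr (c - 1) * (1 - (norm w)\<^sup>2) powr (1 - c)"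
    using one_minus_norm_squared[OF w] powr_minus[of 2 "c - 1"] by (simp add: powr_divide field_simps)
  also have "\<dots> \<le> 2 powr c * (1 - (norm w)\<^sup>2) powr (1 - c)"
    by (intro mult_right_mono powr_mono) auto
  finally have "4 powr c * (4 * c / (pi * (c - 1))) * (1 - norm w) powr (1 - c) \<le>
      4 powr c * (4 * c / (pi * (c - 1))) * (2 powr c * (1 - (norm w)\<^sup>2) powr (1 - c))"
    using c by (intro mult_left_mono) auto
  also have "\<dots> = 8 powr c * (4 * c / (pi * (c - 1))) * (1 - (norm w)\<^sup>2) powr (1 - c)"
    using powr_mult[of 4 2 c] by simp
  finally show ?thesis
    using nn_integral_dA_angular_le[OF c w] by (meson ennreal_leI order_trans)
qed

text \<open>The maximal function of \<open>cauchy_int c G\<close> along the radius through \<open>z\<close> is at most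
  \<open>2 powr c * H (sgn z)\<close>, and \<open>H\<close> is integrable over the circle.\<close>

lemma weak_type_cauchy_int_L1:
  assumes c: "1 < c" and [measurable]: "G \<in> borel_measurable dA" and M: "0 \<le> M"
    and le: "(\<integral>\<^sup>+w. ennreal (norm (G w) * (1 - (norm w)\<^sup>2) powr (1 - c)) \<partial>dA) \<le> ennreal M"
    and \<kappa>: "0 < \<kappa>"
  shows "integrable dA G"
    and "emeasure dA {z \<in> ball 0 1. \<kappa> * (1 - (norm z)\<^sup>2) < norm (cauchy_int c G z)} \<le>
      ennreal (16 powr c * (4 * c / (pi * (c - 1))) * M / \<kappa>)"
proof -
  interpret P: pair_sigma_finite dA dA
    by (intro pair_sigma_finite.intro) unfold_locales
  have meas_snd [measurable]: "snd \<in> borel_measurable (N \<Otimes>\<^sub>M dA)" for N :: "complex measure"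
    by (rule measurable_dA_borel) simp
  have meas_fst [measurable]: "fst \<in> borel_measurable (dA \<Otimes>\<^sub>M N)" for N :: "complex measure"
    by (rule measurable_dA_borel) simp
  have [measurable]: "(\<lambda>w. w) \<in> borel_measurable dA" by (rule measurable_id_dA)
  show int_G: "integrable dA G"
  proof (rule integrableI_bounded)
    have "(\<integral>\<^sup>+w. ennreal (norm (G w)) \<partial>dA) \<le> (\<integral>\<^sup>+w. ennreal (norm (G w) * (1 - (norm w)\<^sup>2) powr (1 - c)) \<partial>dA)"
    proof (intro nn_integral_mono ennreal_leI)
      fix w assume "w \<in> space dA"
      then have "1 \<le> (1 - (norm w)\<^sup>2) powr (1 - c)"
        using powr_mono2'[of "1 - c" "1 - (norm w)\<^sup>2" 1] c one_minus_norm_squared[of w] by simp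
      then show "norm (G w) \<le> norm (G w) * (1 - (norm w)\<^sup>2) powr (1 - c)"
        using mult_left_mono[of 1 _ "norm (G w)"] by simp
    qed
    also have "\<dots> < \<infinity>" using le by (simp add: le_less_trans)
    finally show "(\<integral>\<^sup>+w. ennreal (norm (G w)) \<partial>dA) < \<infinity>" .
  qed measurable
  define H where "H \<zeta> = (\<integral>\<^sup>+w. ennreal (norm (G w) * norm (1 - \<zeta> * cnj w) powr - c) \<partial>dA)" for \<zeta>
  have H [measurable]: "H \<in> borel_measurable borel"
    unfolding H_def by measurable
  have F_le: "ennreal (norm (cauchy_int c G z)) \<le> ennreal (2 powr c) * H (sgn z)" if z: "z \<in> ball 0 1" for z
  proof -
    have "ennreal (norm (cauchy_int c G z)) \<le> (\<integral>\<^sup>+w. ennreal (norm (G w / (1 - z * cnj w) powr of_real c)) \<partial>dA)"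
      unfolding cauchy_int_def using c z int_G by (intro integral_norm_bound_ennreal integrable_cauchy_kernel) auto
    also have "\<dots> \<le> (\<integral>\<^sup>+w. ennreal (2 powr c) * ennreal (norm (G w) * norm (1 - sgn z * cnj w) powr - c) \<partial>dA)"
    proof (rule nn_integral_mono)
      fix w assume w: "w \<in> space dA"
      have nz: "1 - z * cnj w \<noteq> 0"
        using z w by (intro one_minus_mult_cnj_nonzero) auto
      have nz': "1 - sgn z * cnj w \<noteq> 0"
      proof -
        have "norm (sgn z * cnj w) < 1"
          using w by (auto simp: norm_mult norm_sgn)
        then show ?thesis by auto
      qed
      have "norm (1 - z * cnj w) powr - c \<le> (norm (1 - sgn z * cnj w) / 2) powr - c"
        using c z w nz' norm_one_minus_sgn_le[of z w] by (intro powr_mono2') auto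
      also have "\<dots> = 2 powr c * norm (1 - sgn z * cnj w) powr - c"
        by (simp add: powr_divide powr_minus field_simps)
      finally have "norm (G w) * norm (1 - z * cnj w) powr - c \<le>
          norm (G w) * (2 powr c * norm (1 - sgn z * cnj w) powr - c)"
        by (intro mult_left_mono) auto
      then show "ennreal (norm (G w / (1 - z * cnj w) powr of_real c)) \<le>
          ennreal (2 powr c) * ennreal (norm (G w) * norm (1 - sgn z * cnj w) powr - c)"
        by (simp add: norm_mult norm_inverse norm_powr_real_powr' powr_minus divide_inverse mult_ac flip: ennreal_mult)
    qed
    also have "\<dots> = ennreal (2 powr c) * H (sgn z)"
      unfolding H_def by (intro nn_integral_cmult) measurable
    finally show ?thesis .
  qed
  have intH: "(\<integral>\<^sup>+u. H (sgn u) \<partial>dA) \<le> ennreal (8 powr c * (4 * c / (pi * (c - 1))) * M)"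
  proof -
    \<comment> \<open>Exchanging the integrals leaves the circle mean of the kernel at w, of order
      (1 - |w|^2)^(1-c); this is the weight in the hypothesis \<open>le\<close>.\<close>
    have "(\<integral>\<^sup>+u. H (sgn u) \<partial>dA) = (\<integral>\<^sup>+w. (\<integral>\<^sup>+u. ennreal (norm (G w) * norm (1 - sgn u * cnj w) powr - c) \<partial>dA) \<partial>dA)"
      unfolding H_def by (rule P.Fubini') measurable
    also have "\<dots> = (\<integral>\<^sup>+w. ennreal (norm (G w)) * (\<integral>\<^sup>+u. ennreal (norm (1 - sgn u * cnj w) powr - c) \<partial>dA) \<partial>dA)"
      by (subst nn_integral_cmult[symmetric]) (auto intro!: borel_measurable_dA simp: ennreal_mult)
    also have "\<dots> \<le> (\<integral>\<^sup>+w. ennreal (8 powr c * (4 * c / (pi * (c - 1)))) * ennreal (norm (G w) * (1 - (norm w)\<^sup>2) powr (1 - c)) \<partial>dA)"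
    proof (rule nn_integral_mono)
      fix w assume "w \<in> space dA"
      then have "ennreal (norm (G w)) * (\<integral>\<^sup>+u. ennreal (norm (1 - sgn u * cnj w) powr - c) \<partial>dA) \<le>
         ennreal (norm (G w)) * ennreal (8 powr c * (4 * c / (pi * (c - 1))) * (1 - (norm w)\<^sup>2) powr (1 - c))"
        using c by (intro mult_left_mono nn_integral_dA_angular_le') auto
      then show "ennreal (norm (G w)) * (\<integral>\<^sup>+u. ennreal (norm (1 - sgn u * cnj w) powr - c) \<partial>dA) \<le>
         ennreal (8 powr c * (4 * c / (pi * (c - 1)))) * ennreal (norm (G w) * (1 - (norm w)\<^sup>2) powr (1 - c))"
        using c by (simp add: mult_ac flip: ennreal_mult)
    qed
    also have "\<dots> = ennreal (8 powr c * (4 * c / (pi * (c - 1)))) * (\<integral>\<^sup>+w. ennreal (norm (G w) * (1 - (norm w)\<^sup>2) powr (1 - c)) \<partial>dA)"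
      by (rule nn_integral_cmult) measurable
    also have "\<dots> \<le> ennreal (8 powr c * (4 * c / (pi * (c - 1)))) * ennreal M"
      by (intro mult_left_mono le) simp
    also have "\<dots> = ennreal (8 powr c * (4 * c / (pi * (c - 1))) * M)"
      using c M by (simp flip: ennreal_mult)
    finally show ?thesis .
  qed
  \<comment> \<open>The enlarged set \<open>S\<close> is described by direction and modulus
    separately, as the polar formula requires. In a fixed direction with \<open>H\<close> equal to h
    it is a condition 1 - |z|^2 < 2^c h / \<kappa>, of measure at most the right-hand side, and
    integrating over directions gives the bound.\<close>
  define \<Psi> :: "complex \<Rightarrow> real \<Rightarrow> ennreal" where
    "\<Psi> \<zeta> r = (if ennreal (\<kappa> * (1 - r\<^sup>2)) < ennreal (2 powr c) * H \<zeta> then 1 else 0)" for \<zeta> r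
  have \<Psi>: "case_prod \<Psi> \<in> borel_measurable (borel \<Otimes>\<^sub>M borel)"
    unfolding \<Psi>_def by measurable
  define S where "S = {z \<in> ball 0 1. ennreal (\<kappa> * (1 - (norm z)\<^sup>2)) < ennreal (2 powr c) * H (sgn z)}"
  have S [measurable]: "S \<in> sets dA"
    unfolding S_def by (rule sets_dA_Collect) measurable
  have "emeasure dA {z \<in> ball 0 1. \<kappa> * (1 - (norm z)\<^sup>2) < norm (cauchy_int c G z)} \<le> emeasure dA S"
  proof (rule emeasure_mono)
    show "{z \<in> ball 0 1. \<kappa> * (1 - (norm z)\<^sup>2) < norm (cauchy_int c G z)} \<subseteq> S"
    proof safe
      fix z :: complex assume z: "z \<in> ball 0 1" and "\<kappa> * (1 - (norm z)\<^sup>2) < norm (cauchy_int c G z)"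
      then have "ennreal (\<kappa> * (1 - (norm z)\<^sup>2)) < ennreal (norm (cauchy_int c G z))"
        using \<kappa> one_minus_norm_squared(1)[of z] by (subst ennreal_less_iff) auto
      with F_le[OF z] show "z \<in> S"
        using z by (auto simp: S_def intro: less_le_trans)
    qed
  qed measurable
  also have "\<dots> = (\<integral>\<^sup>+z. \<Psi> (sgn z) (norm z) \<partial>dA)"
    unfolding nn_integral_indicator[OF S, symmetric]
    by (intro nn_integral_cong) (auto simp: S_def \<Psi>_def split: split_indicator)
  also have "\<dots> = (\<integral>\<^sup>+u. (\<integral>\<^sup>+z. \<Psi> (sgn u) (norm z) \<partial>dA) \<partial>dA)"
    by (rule nn_integral_dA_polar[OF \<Psi>])
  also have "\<dots> \<le> (\<integral>\<^sup>+u. ennreal (2 powr c / \<kappa>) * H (sgn u) \<partial>dA)"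
  proof (rule nn_integral_mono)
    fix u
    show "(\<integral>\<^sup>+z. \<Psi> (sgn u) (norm z) \<partial>dA) \<le> ennreal (2 powr c / \<kappa>) * H (sgn u)"
    proof (cases "H (sgn u)" rule: ennreal_cases)
      case (real h)
      have "(\<integral>\<^sup>+z. \<Psi> (sgn u) (norm z) \<partial>dA) = (\<integral>\<^sup>+z. indicator {z \<in> ball 0 1. 1 - (norm z)\<^sup>2 < 2 powr c * h / \<kappa>} z \<partial>dA)"
      proof (rule nn_integral_cong)
        fix z assume z: "z \<in> space dA"
        then have "0 < 1 - (norm z)\<^sup>2" using one_minus_norm_squared[of z] by simp
        then have "ennreal (\<kappa> * (1 - (norm z)\<^sup>2)) < ennreal (2 powr c) * H (sgn u) \<longleftrightarrow>
            1 - (norm z)\<^sup>2 < 2 powr c * h / \<kappa>"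
          using \<kappa> real
          by (simp add: ennreal_less_iff pos_less_divide_eq mult.commute flip: ennreal_mult)
        then show "\<Psi> (sgn u) (norm z) = indicator {z \<in> ball 0 1. 1 - (norm z)\<^sup>2 < 2 powr c * h / \<kappa>} z"
          using z by (auto simp: \<Psi>_def)
      qed
      also have "\<dots> = emeasure dA {z \<in> ball 0 1. 1 - (norm z)\<^sup>2 < 2 powr c * h / \<kappa>}"
        by (rule nn_integral_indicator, rule sets_dA_Collect) measurable
      also have "\<dots> \<le> ennreal (2 powr c * h / \<kappa>)"
        using real \<kappa> by (intro emeasure_dA_norm_gt) auto
      also have "\<dots> = ennreal (2 powr c / \<kappa>) * H (sgn u)"
        using real \<kappa> by (simp flip: ennreal_mult)
      finally show ?thesis .
    next
      \<comment> \<open>\<open>H\<close> is finite only for almost every direction; where it is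
        infinite the claimed bound is trivial.\<close>
      case top
      then show ?thesis using \<kappa> by (simp add: ennreal_mult_top)
    qed
  qed
  also have "\<dots> = ennreal (2 powr c / \<kappa>) * (\<integral>\<^sup>+u. H (sgn u) \<partial>dA)"
    by (intro nn_integral_cmult borel_measurable_dA) measurable
  also have "\<dots> \<le> ennreal (2 powr c / \<kappa>) * ennreal (8 powr c * (4 * c / (pi * (c - 1))) * M)"
    by (intro mult_left_mono intH) simp
  also have "\<dots> = ennreal (16 powr c * (4 * c / (pi * (c - 1))) * M / \<kappa>)"
    using c M \<kappa> powr_mult[of 2 8 c] by (simp add: mult_ac flip: ennreal_mult)
  finally show "emeasure dA {z \<in> ball 0 1. \<kappa> * (1 - (norm z)\<^sup>2) < norm (cauchy_int c G z)} \<le>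
      ennreal (16 powr c * (4 * c / (pi * (c - 1))) * M / \<kappa>)" .
qed

text \<open>The exponent 3 - 2c is dual to 2c - 3, the weight for which \<open>z ^ n\<close> has
  squared norm \<open>Beta (n + 1) (2 * c - 2)\<close>. By duality and Bessel the moments of
  \<open>G\<close> are square summable relative to these Beta values, and the squared binomial
  coefficients compensate them up to a constant. So the Taylor coefficients of
  \<open>cauchy_int c G\<close> are square summable with sum of order M^2.\<close>

lemma weak_type_cauchy_int_L2:
  assumes c: "1 < c" and [measurable]: "G \<in> borel_measurable dA" and M: "0 < M"
    and le: "(\<integral>\<^sup>+w. ennreal ((norm (G w))\<^sup>2 * (1 - (norm w)\<^sup>2) powr (3 - 2 * c)) \<partial>dA) \<le> ennreal (M\<^sup>2)"
    and \<kappa>: "0 < \<kappa>"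
  shows "integrable dA G"
    and "emeasure dA {z \<in> ball 0 1. \<kappa> * (1 - (norm z)\<^sup>2) < norm (cauchy_int c G z)} \<le>
      ennreal ((1 + Gamma (2 * c - 2) / (Gamma c)\<^sup>2) * M / \<kappa>)"
proof -
  have id_meas [measurable]: "(\<lambda>w. w) \<in> borel_measurable dA" by (rule measurable_id_dA)
  define C where "C = Gamma (2 * c - 2) / (Gamma c)\<^sup>2"
  have C: "0 \<le> C"
    using c by (auto simp: C_def intro!: divide_nonneg_nonneg less_imp_le[OF Gamma_real_pos])
  have int_sq: "integrable dA (\<lambda>w. (norm (G w))\<^sup>2 * (1 - (norm w)\<^sup>2) powr (3 - 2 * c))"
    by (rule integrableI_bounded) (use le in \<open>auto intro: le_less_trans\<close>)
  have sq_le: "(LINT w|dA. (norm (G w))\<^sup>2 * (1 - (norm w)\<^sup>2) powr (3 - 2 * c)) \<le> M\<^sup>2"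
    using le M by (subst integral_eq_nn_integral) (auto simp: enn2real_leI)
  have int_powr: "integrable dA (\<lambda>w::complex. norm w ^ (2 * n) * (1 - (norm w)\<^sup>2) powr (2 * c - 3))" for n
    using integrable_dA_radial_powr[of "2 * c - 2" n] c by simp
  show int_G: "integrable dA G"
  proof (rule Bochner_Integration.integrable_bound)
    show "integrable dA (\<lambda>w. (norm (G w))\<^sup>2 * (1 - (norm w)\<^sup>2) powr (3 - 2 * c) + (1 - (norm w)\<^sup>2) powr (2 * c - 3))"
      using int_sq int_powr[of 0] by simp
    show "AE w in dA. norm (G w) \<le> norm ((norm (G w))\<^sup>2 * (1 - (norm w)\<^sup>2) powr (3 - 2 * c) + (1 - (norm w)\<^sup>2) powr (2 * c - 3))"
    proof (rule AE_I2)
      fix w assume "w \<in> space dA"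
      then have t: "0 < 1 - (norm w)\<^sup>2" using one_minus_norm_squared[of w] by simp
      \<comment> \<open>The arithmetic-geometric mean inequality for |G| / \<tau> and \<tau>: the
        first square has the weight of the hypothesis, the second is integrable because 2c - 3 >
        -1.\<close>
      define \<tau> where "\<tau> = (1 - (norm w)\<^sup>2) powr (c - 3 / 2)"
      have "\<tau>\<^sup>2 = (1 - (norm w)\<^sup>2) powr (2 * c - 3)"
        using t by (simp add: \<tau>_def powr_power algebra_simps)
      then have \<tau>: "0 < \<tau>" "\<tau>\<^sup>2 = (1 - (norm w)\<^sup>2) powr (2 * c - 3)" "(1 - (norm w)\<^sup>2) powr (3 - 2 * c) = 1 / \<tau>\<^sup>2"
        using t powr_minus_divide[of "1 - (norm w)\<^sup>2" "2 * c - 3"] by (auto simp: \<tau>_def)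
      have "2 * (norm (G w) / \<tau>) * \<tau> \<le> (norm (G w) / \<tau>)\<^sup>2 + \<tau>\<^sup>2"
        by (rule sum_squares_bound)
      then have "2 * norm (G w) \<le> (norm (G w))\<^sup>2 * (1 / \<tau>\<^sup>2) + \<tau>\<^sup>2"
        using \<tau>(1) by (simp add: power_divide)
      moreover have "norm (G w) \<le> 2 * norm (G w)" by simp
      ultimately have "norm (G w) \<le> (norm (G w))\<^sup>2 * (1 / \<tau>\<^sup>2) + \<tau>\<^sup>2"
        by (rule order_trans[rotated])
      then show "norm (G w) \<le> norm ((norm (G w))\<^sup>2 * (1 - (norm w)\<^sup>2) powr (3 - 2 * c) + (1 - (norm w)\<^sup>2) powr (2 * c - 3))"
        unfolding \<tau>(2,3)[symmetric] using \<tau> by simp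
    qed
  qed measurable
  define \<beta> where "\<beta> n = (LINT w|dA. cnj w ^ n * G w)" for n
  define a where "a n = of_real (binom_coeff c n) * \<beta> n" for n
  \<comment> \<open>The weight is split symmetrically: the factors of \<open>g\<close> and
    \<open>e n\<close> cancel in the inner product, which becomes the unweighted moment
    \<open>\<beta> n\<close>, while their squares carry the weights 3 - 2c and 2c - 3.\<close>
  define g where "g w = G w * of_real ((1 - (norm w)\<^sup>2) powr (3 / 2 - c))" for w
  define e where "e n w = w ^ n * complex_of_real ((1 - (norm w)\<^sup>2) powr (c - 3 / 2))" for n :: nat and w
  have [measurable]: "g \<in> borel_measurable dA" "e n \<in> borel_measurable dA" for n
    unfolding g_def e_def by measurable
  have g_sq: "(norm (g w))\<^sup>2 = (norm (G w))\<^sup>2 * (1 - (norm w)\<^sup>2) powr (3 - 2 * c)" if "w \<in> space dA" for w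
    using that one_minus_norm_squared[of w]
    by (simp add: g_def norm_mult power_mult_distrib powr_power algebra_simps)
  have e_sq: "(norm (e n w))\<^sup>2 = norm w ^ (2 * n) * (1 - (norm w)\<^sup>2) powr (2 * c - 3)" if "w \<in> space dA" for n w
    using that one_minus_norm_squared[of w]
    by (simp add: e_def norm_mult norm_power power_mult_distrib powr_power algebra_simps flip: power_mult)
  have e_int: "(LINT w|dA. (norm (e n w))\<^sup>2) = Beta (real n + 1) (2 * c - 2)" for n
    using integral_dA_radial_powr[of "2 * c - 2" n] c
    by (subst Bochner_Integration.integral_cong[OF refl e_sq]) auto
  have Beta_pos: "0 < Beta (real n + 1) (2 * c - 2)" for n
    using c by (auto simp: Beta_def intro!: divide_pos_pos mult_pos_pos Gamma_real_pos)
  have ge: "(LINT w|dA. g w * cnj (e n w)) = \<beta> n" for n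
    unfolding \<beta>_def
  proof (rule Bochner_Integration.integral_cong[OF refl])
    fix w assume "w \<in> space dA"
    then have "0 < 1 - (norm w)\<^sup>2" using one_minus_norm_squared[of w] by simp
    then have "(1 - (norm w)\<^sup>2) powr (3 / 2 - c) * (1 - (norm w)\<^sup>2) powr (c - 3 / 2) = 1"
      by (simp flip: powr_add)
    then have "complex_of_real ((1 - (norm w)\<^sup>2) powr (3 / 2 - c)) * complex_of_real ((1 - (norm w)\<^sup>2) powr (c - 3 / 2)) = 1"
      by (metis of_real_1 of_real_mult)
    moreover have "g w * cnj (e n w) = cnj w ^ n * G w * (complex_of_real ((1 - (norm w)\<^sup>2) powr (3 / 2 - c)) * complex_of_real ((1 - (norm w)\<^sup>2) powr (c - 3 / 2)))"
      by (simp add: g_def e_def mult_ac)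
    ultimately show "g w * cnj (e n w) = cnj w ^ n * G w"
      by simp
  qed
  have orth: "(LINT w|dA. e m w * cnj (e n w)) = 0" if "m \<noteq> n" for m n
  proof -
    have "(LINT w|dA. e m w * cnj (e n w)) =
        (LINT w|dA. of_real ((1 - (norm w)\<^sup>2) powr (c - 3 / 2) * (1 - (norm w)\<^sup>2) powr (c - 3 / 2)) * (w ^ m * cnj w ^ n))"
      by (simp add: e_def mult_ac)
    also have "\<dots> = 0"
      using that by (intro integral_dA_monomials[of "\<lambda>r. (1 - r\<^sup>2) powr (c - 3 / 2) * (1 - r\<^sup>2) powr (c - 3 / 2)"]) measurable
    finally show ?thesis .
  qed
  have sum_le: "(\<Sum>n<N. (norm (a n))\<^sup>2) \<le> C * M\<^sup>2" for N
  proof -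
    have "(\<Sum>n<N. (norm (a n))\<^sup>2) \<le> (\<Sum>n<N. C * ((norm (\<beta> n))\<^sup>2 / Beta (real n + 1) (2 * c - 2)))"
    proof (rule sum_mono)
      fix n
      have "(norm (a n))\<^sup>2 = ((binom_coeff c n)\<^sup>2 * Beta (real n + 1) (2 * c - 2)) * ((norm (\<beta> n))\<^sup>2 / Beta (real n + 1) (2 * c - 2))"
        using Beta_pos[of n] by (simp add: a_def norm_mult power_mult_distrib)
      also have "\<dots> \<le> C * ((norm (\<beta> n))\<^sup>2 / Beta (real n + 1) (2 * c - 2))"
        unfolding C_def using Beta_pos[of n] by (intro mult_right_mono binom_coeff_sq_Beta_le c) auto
      finally show "(norm (a n))\<^sup>2 \<le> C * ((norm (\<beta> n))\<^sup>2 / Beta (real n + 1) (2 * c - 2))" .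
    qed
    also have "\<dots> = C * (\<Sum>n<N. (norm (LINT w|dA. g w * cnj (e n w)))\<^sup>2 / (LINT w|dA. (norm (e n w))\<^sup>2))"
      unfolding ge e_int by (simp add: sum_distrib_left)
    also have "\<dots> \<le> C * (LINT w|dA. (norm (g w))\<^sup>2)"
    proof (intro mult_left_mono Bessel_inequality_integral)
      show "integrable dA (\<lambda>w. (norm (g w))\<^sup>2)"
        using int_sq by (subst Bochner_Integration.integrable_cong[OF refl g_sq])
      show "integrable dA (\<lambda>w. (norm (e n w))\<^sup>2)" for n
        using int_powr by (subst Bochner_Integration.integrable_cong[OF refl e_sq])
      show "0 < (LINT w|dA. (norm (e n w))\<^sup>2)" for n
        unfolding e_int by (rule Beta_pos)
    qed (use C orth in auto)
    also have "(LINT w|dA. (norm (g w))\<^sup>2) = (LINT w|dA. (norm (G w))\<^sup>2 * (1 - (norm w)\<^sup>2) powr (3 - 2 * c))"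
      by (rule Bochner_Integration.integral_cong[OF refl g_sq])
    also have "C * \<dots> \<le> C * M\<^sup>2"
      using sq_le C by (intro mult_left_mono) auto
    finally show ?thesis .
  qed
  \<comment> \<open>The annulus costs \<eta> and the Chebyshev bound costs C M^2 / (\<eta>
    \<kappa>^2); this \<eta> makes both of order M / \<kappa>.\<close>
  define \<eta> where "\<eta> = M / \<kappa>"
  have \<eta>: "0 < \<eta>" using M \<kappa> by (simp add: \<eta>_def)
  \<comment> \<open>Away from the annulus, \<kappa> (1 - |z|^2) < |F| implies 1 \<le> W |F|^2 /
    \<kappa>^2, the form needed for Markov's inequality. The integral of \<open>W\<close> is at most
    1 / \<eta>.\<close>
  define W where "W r = of_bool (\<eta> \<le> 1 - r\<^sup>2) / (1 - r\<^sup>2)\<^sup>2" for r :: real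
  have [measurable]: "W \<in> borel_measurable borel" unfolding W_def by measurable
  have W0: "0 \<le> W r" for r by (simp add: W_def)
  have W_nn: "(\<integral>\<^sup>+z. ennreal (W (norm z)) \<partial>dA) \<le> ennreal (1 / \<eta>)"
    unfolding W_def by (rule nn_integral_dA_powr_minus_two_le[OF \<eta>])
  have W_int: "integrable dA (\<lambda>z. W (norm z))"
    by (rule integrableI_bounded) (use W_nn W0 in \<open>auto intro: le_less_trans\<close>)
  have W_le: "(LINT z|dA. W (norm z)) \<le> 1 / \<eta>"
    using W_nn \<eta> W0 by (subst integral_eq_nn_integral) (auto simp: enn2real_leI)
  have F_meas [measurable]: "cauchy_int c G \<in> borel_measurable dA"
    using c int_G by (intro borel_measurable_cauchy_int) auto
  have partial: "(\<integral>\<^sup>+z. ennreal (W (norm z) * (norm (\<Sum>n<N. a n * z ^ n))\<^sup>2) \<partial>dA) \<le> ennreal (C * M * \<kappa>)" for N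
  proof -
    have "(\<Sum>n<N. (norm (a n))\<^sup>2 * (LINT z|dA. W (norm z) * norm z ^ (2 * n))) \<le>
        (\<Sum>n<N. (norm (a n))\<^sup>2 * (1 / \<eta>))"
    proof (intro sum_mono mult_left_mono)
      fix n
      have "(LINT z|dA. W (norm z) * norm z ^ (2 * n)) \<le> (LINT z|dA. W (norm z))"
        using W_int W0 by (intro integral_mono_AE' AE_I2) (auto intro!: mult_left_le power_le_one)
      with W_le show "(LINT z|dA. W (norm z) * norm z ^ (2 * n)) \<le> 1 / \<eta>" by linarith
    qed auto
    also have "\<dots> \<le> C * M\<^sup>2 * (1 / \<eta>)"
      using sum_le[of N] \<eta> by (simp add: divide_right_mono flip: sum_divide_distrib)
    also have "\<dots> = C * M * \<kappa>"
      using M \<kappa> by (simp add: \<eta>_def power2_eq_square)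
    finally show ?thesis
      by (subst nn_integral_dA_norm_sum_monomials[of "{..<N}" "\<lambda>n. n"]) (auto simp: W_int W0 ennreal_leI)
  qed
  \<comment> \<open>Orthogonality was applied to Taylor polynomials only; Fatou's lemma carries the
    bound over to their pointwise limit.\<close>
  have "(\<integral>\<^sup>+z. ennreal (W (norm z) * (norm (cauchy_int c G z))\<^sup>2) \<partial>dA) =
      (\<integral>\<^sup>+z. liminf (\<lambda>N. ennreal (W (norm z) * (norm (\<Sum>n<N. a n * z ^ n))\<^sup>2)) \<partial>dA)"
  proof (rule nn_integral_cong)
    fix z assume "z \<in> space dA"
    then have "(\<lambda>n. a n * z ^ n) sums cauchy_int c G z"
      using sums_cauchy_kernel[of c z G] c int_G by (simp add: a_def \<beta>_def cauchy_int_def)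
    then have "(\<lambda>N. ennreal (W (norm z) * (norm (\<Sum>n<N. a n * z ^ n))\<^sup>2)) \<longlonglongrightarrow>
        ennreal (W (norm z) * (norm (cauchy_int c G z))\<^sup>2)"
      unfolding sums_def by (intro tendsto_ennrealI tendsto_intros)
    then show "ennreal (W (norm z) * (norm (cauchy_int c G z))\<^sup>2) =
        liminf (\<lambda>N. ennreal (W (norm z) * (norm (\<Sum>n<N. a n * z ^ n))\<^sup>2))"
      by (simp add: lim_imp_Liminf)
  qed
  also have "\<dots> \<le> liminf (\<lambda>N. \<integral>\<^sup>+z. ennreal (W (norm z) * (norm (\<Sum>n<N. a n * z ^ n))\<^sup>2) \<partial>dA)"
    by (rule nn_integral_liminf) measurable
  also have "\<dots> \<le> ennreal (C * M * \<kappa>)"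
    by (rule Liminf_le) (use partial in auto)
  finally have fatou: "(\<integral>\<^sup>+z. ennreal (W (norm z) * (norm (cauchy_int c G z))\<^sup>2) \<partial>dA) \<le> ennreal (C * M * \<kappa>)" .
  define A where "A = {z \<in> space dA. 1 - (norm z)\<^sup>2 < \<eta>}"
  define B where "B = {z \<in> space dA. 1 \<le> ennreal (1 / \<kappa>\<^sup>2) * ennreal (W (norm z) * (norm (cauchy_int c G z))\<^sup>2)}"
  have [measurable]: "A \<in> sets dA" "B \<in> sets dA"
    unfolding A_def B_def by measurable
  have "emeasure dA {z \<in> ball 0 1. \<kappa> * (1 - (norm z)\<^sup>2) < norm (cauchy_int c G z)} \<le> emeasure dA (A \<union> B)"
  proof (rule emeasure_mono)
    show "{z \<in> ball 0 1. \<kappa> * (1 - (norm z)\<^sup>2) < norm (cauchy_int c G z)} \<subseteq> A \<union> B"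
    proof safe
      fix z :: complex assume z: "z \<in> ball 0 1" and gt: "\<kappa> * (1 - (norm z)\<^sup>2) < norm (cauchy_int c G z)" and "z \<notin> B"
      show "z \<in> A"
      proof (rule ccontr)
        assume "z \<notin> A"
        then have W: "W (norm z) = 1 / (1 - (norm z)\<^sup>2)\<^sup>2"
          using z by (simp add: W_def A_def)
        have t: "0 < 1 - (norm z)\<^sup>2" using z one_minus_norm_squared[of z] by simp
        have "(\<kappa> * (1 - (norm z)\<^sup>2))\<^sup>2 \<le> (norm (cauchy_int c G z))\<^sup>2"
          using gt t \<kappa> by (intro power_mono) auto
        then have "1 \<le> 1 / \<kappa>\<^sup>2 * (W (norm z) * (norm (cauchy_int c G z))\<^sup>2)"
          using t \<kappa> zero_less_power[of "\<kappa> * (1 - (norm z)\<^sup>2)" 2]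
          by (simp add: W power_mult_distrib[symmetric])
        then have "1 \<le> ennreal (1 / \<kappa>\<^sup>2) * ennreal (W (norm z) * (norm (cauchy_int c G z))\<^sup>2)"
          using W0 by (simp add: ennreal_mult[symmetric] del: ennreal_1 flip: ennreal_1)
        with \<open>z \<notin> B\<close> z show False by (simp add: B_def)
      qed
    qed
  qed measurable
  also have "\<dots> \<le> emeasure dA A + emeasure dA B"
    by (rule emeasure_subadditive) measurable
  also have "\<dots> \<le> ennreal \<eta> + ennreal (C * M / \<kappa>)"
  proof (rule add_mono)
    show "emeasure dA A \<le> ennreal \<eta>"
      using emeasure_dA_norm_gt(1)[of \<eta>] \<eta> by (simp add: A_def)
    have "emeasure dA B \<le> ennreal (1 / \<kappa>\<^sup>2) * (\<integral>\<^sup>+z. ennreal (W (norm z) * (norm (cauchy_int c G z))\<^sup>2) * indicator (space dA) z \<partial>dA)"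
      unfolding B_def by (rule nn_integral_Markov_inequality) measurable
    also have "\<dots> = ennreal (1 / \<kappa>\<^sup>2) * (\<integral>\<^sup>+z. ennreal (W (norm z) * (norm (cauchy_int c G z))\<^sup>2) \<partial>dA)"
      by (intro arg_cong2[of _ _ _ _ "(*)"] nn_integral_cong refl) (simp add: indicator_def)
    also have "\<dots> \<le> ennreal (1 / \<kappa>\<^sup>2) * ennreal (C * M * \<kappa>)"
      by (intro mult_left_mono fatou) simp
    also have "\<dots> = ennreal (C * M / \<kappa>)"
      using \<kappa> C M by (simp add: power2_eq_square flip: ennreal_mult)
    finally show "emeasure dA B \<le> ennreal (C * M / \<kappa>)" .
  qed
  also have "\<dots> = ennreal ((1 + C) * M / \<kappa>)"
    using \<eta> C M \<kappa> by (simp add: \<eta>_def add_divide_distrib ring_distribs flip: ennreal_plus)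
  finally show "emeasure dA {z \<in> ball 0 1. \<kappa> * (1 - (norm z)\<^sup>2) < norm (cauchy_int c G z)} \<le>
      ennreal ((1 + Gamma (2 * c - 2) / (Gamma c)\<^sup>2) * M / \<kappa>)"
    by (simp add: C_def)
qed

section \<open>Boundedness of the analytic operator for s \<ge> 1/2\<close>

lemma kernel_op_T_eq:
  assumes "z \<in> ball 0 1"
  shows "kernel_op (-1) (T_kernel b c) f z =
    cauchy_int c (\<lambda>w. of_real ((1 - (norm w)\<^sup>2) powr b) * f w) z / of_real (1 - (norm z)\<^sup>2)"
  using assms one_minus_norm_squared[of z]
  by (simp add: kernel_op_def T_kernel_def cauchy_int_def powr_minus divide_inverse mult_ac)

lemma norm_kernel_op_T_gt_iff:
  assumes "z \<in> ball 0 1"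
  shows "\<mu> < norm (kernel_op (-1) (T_kernel b c) f z) \<longleftrightarrow>
    \<mu> * (1 - (norm z)\<^sup>2) < norm (cauchy_int c (\<lambda>w. of_real ((1 - (norm w)\<^sup>2) powr b) * f w) z)"
  using assms one_minus_norm_squared[of z] unfolding kernel_op_T_eq[OF assms]
  by (simp add: norm_divide pos_less_divide_eq del: of_real_diff)

text \<open>Splitting \<open>f\<close> where \<open>norm f * (1 - (norm w)\<^sup>2) powr s\<close> exceeds \<open>M\<close>, the large part
  is controlled in the weighted \<open>L\<^sup>1\<close> norm and the small part in the weighted \<open>L\<^sup>2\<close> norm.\<close>

lemma weak_type_T:
  fixes s b c :: real
  defines "p \<equiv> 1 / s"
  defines "K \<equiv> 2 * (16 powr c * (4 * c / (pi * (c - 1))) + (1 + Gamma (2 * c - 2) / (Gamma c)\<^sup>2))"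
  assumes c: "1 < c" and s: "1 / 2 \<le> s" "s < 1" and b: "b = s + c - 2"
    and f [measurable]: "f \<in> borel_measurable dA" and M: "0 < M"
    and le: "(\<integral>\<^sup>+w. ennreal (norm (f w) powr p) \<partial>dA) \<le> ennreal (M powr p)"
    and \<mu>: "0 < \<mu>"
  shows "integrable dA (\<lambda>w. of_real ((1 - (norm w)\<^sup>2) powr b) * f w)"
    and "emeasure dA {z \<in> ball 0 1. \<mu> < norm (kernel_op (-1) (T_kernel b c) f z)} \<le> ennreal (K * M / \<mu>)"
proof -
  have [measurable]: "(\<lambda>w. w) \<in> borel_measurable dA" by (rule measurable_id_dA)
  have p: "1 < p" "p \<le> 2" "s * p = 1" "0 < s"
    using s by (auto simp: p_def field_simps)
  define q where "q w = norm (f w) * (1 - (norm w)\<^sup>2) powr s" for w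
  define G where "G w = of_real ((1 - (norm w)\<^sup>2) powr b) * f w" for w
  define G1 where "G1 w = (if M < q w then G w else 0)" for w
  define G2 where "G2 w = (if M < q w then 0 else G w)" for w
  have [measurable]: "q \<in> borel_measurable dA" "G \<in> borel_measurable dA"
    unfolding q_def G_def by measurable
  have [measurable]: "G1 \<in> borel_measurable dA" "G2 \<in> borel_measurable dA"
    unfolding G1_def G2_def by measurable
  have G_split: "G w = G1 w + G2 w" for w
    by (simp add: G1_def G2_def)
  \<comment> \<open>From b = s + c - 2 come b + 1 - c = s - 1 and 2b + 3 - 2c = 2s - 1, and from s p
    = 1 the third identity: each quantity is a power of \<open>q\<close> over 1 - |w|^2.\<close>
  have facts: "norm (G w) * (1 - (norm w)\<^sup>2) powr (1 - c) = q w / (1 - (norm w)\<^sup>2)"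
      "(norm (G w))\<^sup>2 * (1 - (norm w)\<^sup>2) powr (3 - 2 * c) = (q w)\<^sup>2 / (1 - (norm w)\<^sup>2)"
      "q w powr p / (1 - (norm w)\<^sup>2) = norm (f w) powr p" "0 \<le> q w" "0 < 1 - (norm w)\<^sup>2"
    if "w \<in> space dA" for w
  proof -
    define t where "t = 1 - (norm w)\<^sup>2"
    have t: "0 < t" using that one_minus_norm_squared[of w] by (simp add: t_def)
    have G: "norm (G w) = norm (f w) * t powr b"
      by (simp add: G_def norm_mult t_def mult.commute)
    have "t powr b * t powr (1 - c) = t powr s / t"
      using t powr_diff[of t s 1] by (simp add: b algebra_simps flip: powr_add)
    then show "norm (G w) * (1 - (norm w)\<^sup>2) powr (1 - c) = q w / (1 - (norm w)\<^sup>2)"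
      unfolding G q_def t_def[symmetric] by (simp add: mult.assoc)
    have "(t powr b)\<^sup>2 * t powr (3 - 2 * c) = (t powr s)\<^sup>2 / t"
      using t powr_diff[of t "s * 2" 1] by (simp add: powr_power b algebra_simps flip: powr_add)
    then show "(norm (G w))\<^sup>2 * (1 - (norm w)\<^sup>2) powr (3 - 2 * c) = (q w)\<^sup>2 / (1 - (norm w)\<^sup>2)"
      unfolding G q_def t_def[symmetric] power_mult_distrib by (simp add: mult.assoc)
    show "q w powr p / (1 - (norm w)\<^sup>2) = norm (f w) powr p"
      using t p unfolding q_def t_def[symmetric] by (simp add: powr_mult powr_powr)
    show "0 \<le> q w" "0 < 1 - (norm w)\<^sup>2"
      using t by (simp_all add: q_def t_def)
  qed
  have int_f: "(\<integral>\<^sup>+w. ennreal (K * norm (f w) powr p) \<partial>dA) \<le> ennreal (K * M powr p)" if "0 \<le> K" for K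
  proof -
    have "(\<integral>\<^sup>+w. ennreal (K * norm (f w) powr p) \<partial>dA) = ennreal K * (\<integral>\<^sup>+w. ennreal (norm (f w) powr p) \<partial>dA)"
      using that by (subst nn_integral_cmult[symmetric]) (auto simp: ennreal_mult)
    also have "\<dots> \<le> ennreal K * ennreal (M powr p)"
      by (intro mult_left_mono le) simp
    finally show ?thesis using that by (simp flip: ennreal_mult)
  qed
  have G1: "(\<integral>\<^sup>+w. ennreal (norm (G1 w) * (1 - (norm w)\<^sup>2) powr (1 - c)) \<partial>dA) \<le> ennreal M"
  proof -
    have "(\<integral>\<^sup>+w. ennreal (norm (G1 w) * (1 - (norm w)\<^sup>2) powr (1 - c)) \<partial>dA) \<le>
        (\<integral>\<^sup>+w. ennreal (M powr (1 - p) * norm (f w) powr p) \<partial>dA)"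
    proof (intro nn_integral_mono ennreal_leI)
      fix w assume w: "w \<in> space dA"
      show "norm (G1 w) * (1 - (norm w)\<^sup>2) powr (1 - c) \<le> M powr (1 - p) * norm (f w) powr p"
      proof (cases "M < q w")
        case True
        then have "q w = q w powr p * q w powr (1 - p)"
          using M by (simp flip: powr_add)
        also have "\<dots> \<le> q w powr p * M powr (1 - p)"
          using True M p by (intro mult_left_mono powr_mono2') auto
        finally have "q w / (1 - (norm w)\<^sup>2) \<le> q w powr p * M powr (1 - p) / (1 - (norm w)\<^sup>2)"
          using facts[OF w] by (intro divide_right_mono) auto
        then show ?thesis
          using True facts(1)[OF w] unfolding facts(3)[OF w, symmetric] by (simp add: G1_def mult_ac)
      qed (simp add: G1_def)
    qed
    also have "\<dots> \<le> ennreal (M powr (1 - p) * M powr p)"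
      by (rule int_f) simp
    finally show ?thesis using M by (simp flip: powr_add)
  qed
  have G2: "(\<integral>\<^sup>+w. ennreal ((norm (G2 w))\<^sup>2 * (1 - (norm w)\<^sup>2) powr (3 - 2 * c)) \<partial>dA) \<le> ennreal (M\<^sup>2)"
  proof -
    have "(\<integral>\<^sup>+w. ennreal ((norm (G2 w))\<^sup>2 * (1 - (norm w)\<^sup>2) powr (3 - 2 * c)) \<partial>dA) \<le>
        (\<integral>\<^sup>+w. ennreal (M powr (2 - p) * norm (f w) powr p) \<partial>dA)"
    proof (intro nn_integral_mono ennreal_leI)
      fix w assume w: "w \<in> space dA"
      show "(norm (G2 w))\<^sup>2 * (1 - (norm w)\<^sup>2) powr (3 - 2 * c) \<le> M powr (2 - p) * norm (f w) powr p"
      proof (cases "M < q w")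
        case False
        have "(q w)\<^sup>2 \<le> q w powr p * M powr (2 - p)"
        proof (cases "q w = 0")
          case False
          then have q: "0 < q w" using facts(4)[OF w] by simp
          then have "(q w)\<^sup>2 = q w powr p * q w powr (2 - p)"
            by (simp flip: powr_add)
          \<comment> \<open>Here s \<ge> 1/2 enters: it makes 2 - p nonnegative, so the factor
            increases with \<open>q\<close>, which is at most M.\<close>
          also have "\<dots> \<le> q w powr p * M powr (2 - p)"
            using \<open>\<not> M < q w\<close> q p by (intro mult_left_mono powr_mono2) auto
          finally show ?thesis .
        qed simp
        then have "(q w)\<^sup>2 / (1 - (norm w)\<^sup>2) \<le> q w powr p * M powr (2 - p) / (1 - (norm w)\<^sup>2)"
          using facts[OF w] by (intro divide_right_mono) auto
        then show ?thesis
          using False facts(2)[OF w] unfolding facts(3)[OF w, symmetric] by (simp add: G2_def mult_ac)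
      qed (simp add: G2_def)
    qed
    also have "\<dots> \<le> ennreal (M powr (2 - p) * M powr p)"
      by (rule int_f) simp
    finally show ?thesis using M by (simp flip: powr_add)
  qed
  define K1 where "K1 = 16 powr c * (4 * c / (pi * (c - 1)))"
  define K2 where "K2 = 1 + Gamma (2 * c - 2) / (Gamma c)\<^sup>2"
  have K12: "0 \<le> K1" "0 \<le> K2"
    using c by (auto simp: K1_def K2_def intro!: add_nonneg_nonneg divide_nonneg_nonneg less_imp_le[OF Gamma_real_pos])
  note L1 = weak_type_cauchy_int_L1[OF c _ less_imp_le[OF M] G1]
  note L2 = weak_type_cauchy_int_L2[OF c _ M G2]
  have int1: "integrable dA G1" and int2: "integrable dA G2"
    by (rule L1(1)[OF _ zero_less_one] L2(1)[OF _ zero_less_one], measurable)+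
  then show int_G: "integrable dA (\<lambda>w. of_real ((1 - (norm w)\<^sup>2) powr b) * f w)"
    using Bochner_Integration.integrable_add[OF int1 int2] by (simp flip: G_split) (simp add: G_def[abs_def])
  have F_split: "cauchy_int c G z = cauchy_int c G1 z + cauchy_int c G2 z" if "z \<in> ball 0 1" for z
    unfolding cauchy_int_def G_split add_divide_distrib
    using that c int1 int2 by (intro Bochner_Integration.integral_add integrable_cauchy_kernel) auto
  have [measurable]: "cauchy_int c G1 \<in> borel_measurable dA" "cauchy_int c G2 \<in> borel_measurable dA"
    using c int1 int2 by (auto intro!: borel_measurable_cauchy_int)
  define A where "A H = {z \<in> ball 0 1. \<mu> / 2 * (1 - (norm z)\<^sup>2) < norm (cauchy_int c H z)}" for H
  have [measurable]: "A G1 \<in> sets dA" "A G2 \<in> sets dA"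
    unfolding A_def space_dA[symmetric] by measurable
  have "emeasure dA {z \<in> ball 0 1. \<mu> < norm (kernel_op (-1) (T_kernel b c) f z)} \<le> emeasure dA (A G1 \<union> A G2)"
  proof (rule emeasure_mono)
    show "{z \<in> ball 0 1. \<mu> < norm (kernel_op (-1) (T_kernel b c) f z)} \<subseteq> A G1 \<union> A G2"
    proof safe
      fix z :: complex assume z: "z \<in> ball 0 1" and "\<mu> < norm (kernel_op (-1) (T_kernel b c) f z)" and "z \<notin> A G2"
      then have "\<mu> * (1 - (norm z)\<^sup>2) < norm (cauchy_int c G z)"
        by (simp only: norm_kernel_op_T_gt_iff G_def[abs_def])
      also have "\<dots> \<le> norm (cauchy_int c G1 z) + norm (cauchy_int c G2 z)"
        unfolding F_split[OF z] by (rule norm_triangle_ineq)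
      finally show "z \<in> A G1"
        using z \<open>z \<notin> A G2\<close> by (auto simp: A_def)
    qed
  qed measurable
  also have "\<dots> \<le> emeasure dA (A G1) + emeasure dA (A G2)"
    by (rule emeasure_subadditive) measurable
  also have "\<dots> \<le> ennreal (K1 * M / (\<mu> / 2)) + ennreal (K2 * M / (\<mu> / 2))"
    unfolding A_def K1_def K2_def using \<mu> by (intro add_mono L1(2) L2(2)) auto
  also have "\<dots> = ennreal (K * M / \<mu>)"
  proof -
    have "K = 2 * (K1 + K2)" by (simp only: K_def K1_def K2_def)
    then show ?thesis
      using K12 M \<mu> by (simp add: field_simps flip: ennreal_plus)
  qed
  finally show "emeasure dA {z \<in> ball 0 1. \<mu> < norm (kernel_op (-1) (T_kernel b c) f z)} \<le> ennreal (K * M / \<mu>)" .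
qed

lemma Lp_norm_recip_exponent:
  assumes "0 < s"
  shows "Lp_norm (recip_exponent s) f =
    (let I = \<integral>\<^sup>+z. ennreal (norm (f z) powr (1 / s)) \<partial>dA in if I = \<infinity> then \<infinity> else ennreal (enn2real I powr s))"
proof -
  have "enn2real (ennreal (1 / s)) = 1 / s"
    using assms by (intro enn2real_ennreal) simp
  then show ?thesis
    using assms by (simp add: Lp_norm_def recip_exponent_def Let_def)
qed

lemma bounded_kernel_op_T:
  assumes c: "1 < c" and s: "1 / 2 \<le> s" "s < 1" and b: "b = s + c - 2"
  shows "bounded_kernel_op (-1) (T_kernel b c) (Lp_norm (recip_exponent s)) weak_L1_norm"
proof -
  define K where "K = 2 * (16 powr c * (4 * c / (pi * (c - 1))) + (1 + Gamma (2 * c - 2) / (Gamma c)\<^sup>2))"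
  have K: "0 \<le> K"
    using c by (auto simp: K_def intro!: add_nonneg_nonneg divide_nonneg_nonneg less_imp_le[OF Gamma_real_pos])
  show ?thesis
    unfolding bounded_kernel_op_def
  proof (intro exI[of _ K] ballI)
    fix f assume "f \<in> norm_space (Lp_norm (recip_exponent s))"
    then have f [measurable]: "f \<in> borel_measurable dA" and fin: "Lp_norm (recip_exponent s) f < \<infinity>"
      by (auto simp: norm_space_def)
    define I where "I = (\<integral>\<^sup>+z. ennreal (norm (f z) powr (1 / s)) \<partial>dA)"
    have norm_f: "Lp_norm (recip_exponent s) f = (if I = \<infinity> then \<infinity> else ennreal (enn2real I powr s))"
      using s by (simp add: Lp_norm_recip_exponent I_def Let_def)
    with fin have "I < \<infinity>" by (auto simp: less_top split: if_splits)
    define N where "N = enn2real I powr s"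
    have norm_f': "Lp_norm (recip_exponent s) f = ennreal N" and N: "0 \<le> N"
      using norm_f \<open>I < \<infinity>\<close> by (auto simp: N_def)
    \<comment> \<open>The weak type estimate wants a positive bound, but the norm N may be 0. It is
      therefore applied with every M > N, and M tends to N at the end.\<close>
    have I_le: "(\<integral>\<^sup>+z. ennreal (norm (f z) powr (1 / s)) \<partial>dA) \<le> ennreal (M powr (1 / s))" if "N < M" for M
    proof -
      have "enn2real I = N powr (1 / s)"
        using s by (simp add: N_def powr_powr)
      also have "\<dots> \<le> M powr (1 / s)"
        using that N s by (intro powr_mono2) auto
      finally show ?thesis
        using \<open>I < \<infinity>\<close> by (simp add: I_def[symmetric] enn2real_le)
    qed
    define G where "G w = of_real ((1 - (norm w)\<^sup>2) powr b) * f w" for w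
    have int_G: "integrable dA G"
      unfolding G_def by (rule weak_type_T(1)[OF c s b f _ I_le[of "N + 1"] zero_less_one]) (use N in auto)
    have int: "AE z in dA. integrable dA (\<lambda>w. T_kernel b c z w * f w)"
    proof (rule AE_I2)
      fix z assume "z \<in> space dA"
      then show "integrable dA (\<lambda>w. T_kernel b c z w * f w)"
        using integrable_cauchy_kernel[of c z G] c int_G by (simp add: G_def T_kernel_def)
    qed
    have meas: "kernel_op (-1) (T_kernel b c) f \<in> borel_measurable dA"
    proof (subst measurable_cong)
      show "kernel_op (-1) (T_kernel b c) f z = cauchy_int c G z / of_real (1 - (norm z)\<^sup>2)" if "z \<in> space dA" for z
        using that kernel_op_T_eq[of z b c f] by (simp add: G_def[abs_def])
      have [measurable]: "cauchy_int c G \<in> borel_measurable dA" "(\<lambda>w. w) \<in> borel_measurable dA"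
        using c int_G by (auto intro!: borel_measurable_cauchy_int measurable_id_dA)
      show "(\<lambda>z. cauchy_int c G z / of_real (1 - (norm z)\<^sup>2)) \<in> borel_measurable dA"
        by measurable
    qed
    have le: "weak_L1_norm (kernel_op (-1) (T_kernel b c) f) \<le> ennreal K * Lp_norm (recip_exponent s) f"
      unfolding weak_L1_norm_def
    proof (rule SUP_least)
      fix \<mu> :: real assume "\<mu> \<in> {0<..}"
      then have \<mu>: "0 < \<mu>" by simp
      let ?E = "emeasure dA {z \<in> space dA. \<mu> < norm (kernel_op (-1) (T_kernel b c) f z)}"
      have *: "ennreal \<mu> * ?E \<le> ennreal (K * M)" if M: "N < M" for M
      proof -
        have "?E \<le> ennreal (K * M / \<mu>)"
          using weak_type_T(2)[OF c s b f _ I_le[OF M] \<mu>] M N by (simp add: K_def)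
        then have "ennreal \<mu> * ?E \<le> ennreal \<mu> * ennreal (K * M / \<mu>)"
          by (rule mult_left_mono) simp
        also have "\<dots> = ennreal (K * M)"
          using \<mu> K M N by (simp flip: ennreal_mult)
        finally show ?thesis .
      qed
      have "ennreal \<mu> * ?E \<le> ennreal (K * N)"
      proof (rule ennreal_le_epsilon)
        fix e :: real assume e: "0 < e"
        have "K * (N + e / (K + 1)) \<le> K * N + e"
          using K e by (simp add: distrib_left divide_le_eq)
        then have "ennreal (K * (N + e / (K + 1))) \<le> ennreal (K * N) + ennreal e"
          using K N e ennreal_leI by (simp flip: ennreal_plus)
        then show "ennreal \<mu> * ?E \<le> ennreal (K * N) + ennreal e"
          using *[of "N + e / (K + 1)"] K e by (meson order_trans less_add_same_cancel1 divide_pos_pos add_nonneg_pos zero_less_one)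
      qed
      then show "ennreal \<mu> * ?E \<le> ennreal K * Lp_norm (recip_exponent s) f"
        using K N by (simp add: norm_f' ennreal_mult)
    qed
    also have "\<dots> < \<infinity>"
      by (simp add: norm_f' ennreal_mult_less_top)
    finally show "(AE z in dA. integrable dA (\<lambda>w. T_kernel b c z w * f w)) \<and>
        kernel_op (-1) (T_kernel b c) f \<in> norm_space weak_L1_norm \<and>
        weak_L1_norm (kernel_op (-1) (T_kernel b c) f) \<le> ennreal K * Lp_norm (recip_exponent s) f"
      using int meas le by (simp add: norm_space_def)
  qed
qed

section \<open>Test functions\<close>

text \<open>For s > 0 the power 1/s turns (1 - |w|^2)^(-s) into 1 / (1 - |w|^2), whose integral up
  to the cutoff is ln (1 / \<epsilon>). The formula also covers s = 0, where the bound is just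
  D.\<close>

lemma Lp_norm_recip_exponent_le:
  assumes s: "0 \<le> s" and \<epsilon>: "0 < \<epsilon>" "\<epsilon> < 1" and D: "0 \<le> D"
    and f [measurable]: "f \<in> borel_measurable dA"
    and le: "\<And>w. norm w < 1 \<Longrightarrow> norm (f w) \<le> D * (1 - (norm w)\<^sup>2) powr - s * of_bool (\<epsilon> \<le> 1 - (norm w)\<^sup>2)"
  shows "Lp_norm (recip_exponent s) f \<le> ennreal (D * ln (1 / \<epsilon>) powr s)"
proof (cases "s = 0")
  case True
  have "norm (f w) \<le> D" if "norm w < 1" for w
    using le[OF that] D True one_minus_norm_squared[OF that] by (auto intro: order_trans simp: of_bool_def split: if_splits)
  then have "esssup dA (\<lambda>z. ennreal (norm (f z))) \<le> ennreal D"
    by (intro esssup_I AE_I2) (auto intro: ennreal_leI)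
  \<comment> \<open>Strict positivity matters: \<open>0 powr 0\<close> is 0, so only a positive base
    gives the value 1.\<close>
  moreover have "0 < ln (1 / \<epsilon>)"
    using \<epsilon> by simp
  then have "ln (1 / \<epsilon>) powr s = 1"
    using True by simp
  ultimately show ?thesis
    using True by (simp add: Lp_norm_def recip_exponent_def)
next
  case False
  with s have s: "0 < s" by simp
  define I where "I = (\<integral>\<^sup>+z. ennreal (norm (f z) powr (1 / s)) \<partial>dA)"
  define J where "J = D powr (1 / s) * ln (1 / \<epsilon>)"
  have J: "0 \<le> J" using \<epsilon> by (simp add: J_def)
  have "I \<le> (\<integral>\<^sup>+w. ennreal (D powr (1 / s)) * ennreal ((1 - (norm w)\<^sup>2) powr - 1 * of_bool (\<epsilon> \<le> 1 - (norm w)\<^sup>2)) \<partial>dA)"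
    unfolding I_def
  proof (rule nn_integral_mono)
    fix w assume w: "w \<in> space dA"
    have "norm (f w) powr (1 / s) \<le> (D * (1 - (norm w)\<^sup>2) powr - s * of_bool (\<epsilon> \<le> 1 - (norm w)\<^sup>2)) powr (1 / s)"
      using w s le[of w] by (intro powr_mono2) auto
    also have "\<dots> = D powr (1 / s) * ((1 - (norm w)\<^sup>2) powr - 1 * of_bool (\<epsilon> \<le> 1 - (norm w)\<^sup>2))"
      using w s D one_minus_norm_squared[of w] by (simp add: powr_mult powr_powr of_bool_def)
    finally show "ennreal (norm (f w) powr (1 / s)) \<le>
        ennreal (D powr (1 / s)) * ennreal ((1 - (norm w)\<^sup>2) powr - 1 * of_bool (\<epsilon> \<le> 1 - (norm w)\<^sup>2))"
      by (subst ennreal_mult[symmetric]) (auto intro: ennreal_leI)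
  qed
  also have "\<dots> = ennreal (D powr (1 / s)) * ennreal (ln (1 / \<epsilon>))"
    using \<epsilon> by (subst nn_integral_cmult)
      (auto intro!: borel_measurable_dA simp: nn_integral_dA_powr_minus_one[symmetric])
  also have "\<dots> = ennreal J"
    using \<epsilon> by (simp add: J_def flip: ennreal_mult)
  finally have "I \<le> ennreal J" .
  then have "I \<noteq> \<infinity>" "enn2real I \<le> J"
    using J by (auto simp: enn2real_leI top_unique)
  then have "enn2real I powr s \<le> J powr s"
    using s by (intro powr_mono2) auto
  also have "\<dots> = D * ln (1 / \<epsilon>) powr s"
    using D \<epsilon> s by (simp add: J_def powr_mult powr_powr)
  finally show ?thesis
    using s \<open>I \<noteq> \<infinity>\<close> by (simp add: Lp_norm_recip_exponent flip: I_def) (simp add: ennreal_leI)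
qed

section \<open>The positive operator\<close>

text \<open>The exponent c - 2 is b - s, the product of kernel weight and test function. At t = 1 -
  |w|^2 the circle mean of the kernel is at least a multiple of t^(1-c) once z is nearer to the
  circle than w, so every scale between \<epsilon> and 1 contributes dt / t.\<close>

lemma nn_integral_S_kernel_ge:
  assumes c: "1 < c" and \<epsilon>: "0 < \<epsilon>" "\<epsilon> < 1" and z: "norm z < 1" "1 - (norm z)\<^sup>2 < \<epsilon>"
  shows "ennreal (3 powr - c / (8 * pi) * ln (1 / \<epsilon>)) \<le>
    (\<integral>\<^sup>+w. ennreal ((1 - (norm w)\<^sup>2) powr (c - 2) * of_bool (\<epsilon> \<le> 1 - (norm w)\<^sup>2) * norm (1 - z * cnj w) powr - c) \<partial>dA)"
proof -
  interpret P: pair_sigma_finite dA dA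
    by (intro pair_sigma_finite.intro) unfold_locales
  define \<phi> where "\<phi> r = (1 - r\<^sup>2) powr (c - 2) * of_bool (\<epsilon> \<le> 1 - r\<^sup>2)" for r :: real
  have \<phi>0: "0 \<le> \<phi> r" for r by (simp add: \<phi>_def)
  define \<Psi> where "\<Psi> \<zeta> r = ennreal (\<phi> r * norm (1 - z * cnj (of_real r * \<zeta>)) powr - c)" for \<zeta> :: complex and r :: real
  have [measurable]: "\<phi> \<in> borel_measurable borel"
    unfolding \<phi>_def by measurable
  have \<Psi> [measurable]: "case_prod \<Psi> \<in> borel_measurable (borel \<Otimes>\<^sub>M borel)"
    unfolding \<Psi>_def by measurable
  have "ennreal (3 powr - c / (8 * pi) * ln (1 / \<epsilon>)) =
      (\<integral>\<^sup>+w. ennreal (3 powr - c / (8 * pi)) * ennreal ((1 - (norm w)\<^sup>2) powr - 1 * of_bool (\<epsilon> \<le> 1 - (norm w)\<^sup>2)) \<partial>dA)"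
    using \<epsilon> nn_integral_dA_powr_minus_one[of \<epsilon>]
    by (subst nn_integral_cmult) (auto intro!: borel_measurable_dA simp flip: ennreal_mult)
  also have "\<dots> \<le> (\<integral>\<^sup>+w. (\<integral>\<^sup>+u. \<Psi> (sgn u) (norm w) \<partial>dA) \<partial>dA)"
  proof (rule nn_integral_mono)
    fix w :: complex assume "w \<in> space dA"
    then have w: "norm w < 1" by simp
    show "ennreal (3 powr - c / (8 * pi)) * ennreal ((1 - (norm w)\<^sup>2) powr - 1 * of_bool (\<epsilon> \<le> 1 - (norm w)\<^sup>2)) \<le>
        (\<integral>\<^sup>+u. \<Psi> (sgn u) (norm w) \<partial>dA)"
    proof (cases "\<epsilon> \<le> 1 - (norm w)\<^sup>2")
      case True
      define t where "t = 1 - (norm w)\<^sup>2"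
      have t: "0 < t" using one_minus_norm_squared[OF w] by (simp add: t_def)
      \<comment> \<open>Beyond the cutoff z has the larger modulus, whence 1 - |z| |w| \<le> 1 -
        |w|^2 and the bound no longer depends on z.\<close>
      have "(norm w)\<^sup>2 \<le> (norm z)\<^sup>2" using True z by linarith
      then have "norm w \<le> norm z" by (rule power2_le_imp_le) simp
      then have "norm w * norm w \<le> norm z * norm w"
        by (intro mult_right_mono) auto
      then have zw: "1 - norm z * norm w \<le> t" by (simp add: t_def power2_eq_square)
      have zw1: "norm z * norm w < 1"
        using z w mult_strict_mono'[of "norm z" 1 "norm w" 1] by simp
      have "t powr - 1 = t powr (c - 2) * t powr (1 - c)"
        by (simp flip: powr_add)
      also have "\<dots> \<le> t powr (c - 2) * (1 - norm z * norm w) powr (1 - c)"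
        using c zw zw1 by (intro mult_left_mono powr_mono2') auto
      finally have "3 powr - c / (8 * pi) * t powr - 1 \<le>
          3 powr - c / (8 * pi) * (t powr (c - 2) * (1 - norm z * norm w) powr (1 - c))"
        by (rule mult_left_mono) simp
      also have "\<dots> = \<phi> (norm w) * (3 powr - c / (8 * pi) * (1 - norm z * norm w) powr (1 - c))"
        using True by (simp add: \<phi>_def t_def)
      finally have "3 powr - c / (8 * pi) * t powr - 1 \<le>
          \<phi> (norm w) * (3 powr - c / (8 * pi) * (1 - norm z * norm w) powr (1 - c))" .
      then have "ennreal (3 powr - c / (8 * pi)) * ennreal (t powr - 1) \<le>
          ennreal (\<phi> (norm w)) * ennreal (3 powr - c / (8 * pi) * (1 - norm z * norm w) powr (1 - c))"
        using \<phi>0 by (simp add: ennreal_leI flip: ennreal_mult)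
      also have "\<dots> \<le> ennreal (\<phi> (norm w)) * (\<integral>\<^sup>+u. ennreal (norm (1 - of_real (norm z * norm w) * sgn u) powr - c) \<partial>dA)"
        using c zw1 by (intro mult_left_mono nn_integral_dA_angular_ge) auto
      also have "(\<integral>\<^sup>+u. ennreal (norm (1 - of_real (norm z * norm w) * sgn u) powr - c) \<partial>dA) =
          (\<integral>\<^sup>+u. ennreal (norm (1 - sgn u * cnj (z * of_real (norm w))) powr - c) \<partial>dA)"
        by (subst nn_integral_dA_angular_eq) (simp add: norm_mult)
      also have "ennreal (\<phi> (norm w)) * \<dots> = (\<integral>\<^sup>+u. \<Psi> (sgn u) (norm w) \<partial>dA)"
      proof -
        have "norm (1 - sgn u * cnj (z * of_real (norm w))) = norm (1 - z * cnj (of_real (norm w) * sgn u))" for u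
          using complex_mod_cnj[of "1 - sgn u * cnj (z * of_real (norm w))"] by (simp add: mult_ac)
        then show ?thesis
          using \<phi>0 unfolding \<Psi>_def
          by (subst nn_integral_cmult[symmetric]) (auto intro!: borel_measurable_dA simp: ennreal_mult)
      qed
      finally show ?thesis using True by (simp add: t_def)
    qed simp
  qed
  also have "\<dots> = (\<integral>\<^sup>+u. (\<integral>\<^sup>+w. \<Psi> (sgn u) (norm w) \<partial>dA) \<partial>dA)"
    by (rule P.Fubini', rule borel_measurable_dA_pair) measurable
  also have "\<dots> = (\<integral>\<^sup>+w. \<Psi> (sgn w) (norm w) \<partial>dA)"
    by (rule nn_integral_dA_polar[OF \<Psi>, symmetric])
  also have "\<dots> = (\<integral>\<^sup>+w. ennreal (\<phi> (norm w) * norm (1 - z * cnj w) powr - c) \<partial>dA)"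
  proof -
    have "of_real (norm w) * sgn w = w" for w :: complex
      by (cases "w = 0") (simp_all add: sgn_eq)
    then show ?thesis by (simp add: \<Psi>_def)
  qed
  finally show ?thesis by (simp add: \<phi>_def)
qed

section \<open>Unboundedness of the positive operator\<close>

lemma weak_L1_norm_ge:
  assumes "0 < t"
  shows "ennreal t * emeasure dA {z \<in> space dA. t < norm (F z)} \<le> weak_L1_norm F"
  unfolding weak_L1_norm_def using assms by (intro SUP_upper) simp

lemma unbounded_kernel_op_S:
  assumes c: "1 < c" and s: "0 \<le> s" "s < 1" and b: "b = s + c - 2"
  shows "\<not> bounded_kernel_op (-1) (S_kernel b c) (Lp_norm (recip_exponent s)) weak_L1_norm"
proof
  assume "bounded_kernel_op (-1) (S_kernel b c) (Lp_norm (recip_exponent s)) weak_L1_norm"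
  then obtain C where C: "\<And>f. f \<in> norm_space (Lp_norm (recip_exponent s)) \<Longrightarrow>
        (AE z in dA. integrable dA (\<lambda>w. S_kernel b c z w * f w)) \<and>
        kernel_op (-1) (S_kernel b c) f \<in> norm_space weak_L1_norm \<and>
        weak_L1_norm (kernel_op (-1) (S_kernel b c) f) \<le> ennreal C * Lp_norm (recip_exponent s) f"
    unfolding bounded_kernel_op_def by blast
  define k where "k = 3 powr - c / (8 * pi)"
  have k: "0 < k" by (simp add: k_def)
  have bound: "k * L \<le> \<bar>C\<bar> * L powr s" if L: "0 < L" for L
  proof -
    define \<epsilon> where "\<epsilon> = exp (- L)"
    have \<epsilon>: "0 < \<epsilon>" "\<epsilon> < 1" "ln (1 / \<epsilon>) = L"
      using L by (simp_all add: \<epsilon>_def ln_div)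
    define f where "f w = complex_of_real ((1 - (norm w)\<^sup>2) powr - s * of_bool (\<epsilon> \<le> 1 - (norm w)\<^sup>2))" for w :: complex
    have [measurable]: "f \<in> borel_measurable dA"
      unfolding f_def by (rule borel_measurable_dA) measurable
    have Lp: "Lp_norm (recip_exponent s) f \<le> ennreal (L powr s)"
      using Lp_norm_recip_exponent_le[of s \<epsilon> 1 f] s \<epsilon> by (simp add: f_def norm_mult)
    then have "f \<in> norm_space (Lp_norm (recip_exponent s))"
      by (auto simp: norm_space_def intro: le_less_trans)
    note * = C[OF this]
    let ?F = "kernel_op (-1) (S_kernel b c) f"
    have [measurable]: "?F \<in> borel_measurable dA"
      using * by (simp add: norm_space_def)
    \<comment> \<open>Only almost every z: absolute convergence is taken from the assumed
      boundedness, and it is what identifies the Bochner integral in \<open>kernel_op\<close> with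
      the nonnegative integral just estimated.\<close>
    have large: "AE z in dA. 1 - (norm z)\<^sup>2 < \<epsilon> \<longrightarrow> k * L / \<epsilon> < norm (?F z)"
      using conjunct1[OF *] AE_space
    proof eventually_elim
      case (elim z)
      show ?case
      proof
        assume t: "1 - (norm z)\<^sup>2 < \<epsilon>"
        have z: "norm z < 1" using elim by simp
        define g where "g w = (1 - (norm w)\<^sup>2) powr (c - 2) * of_bool (\<epsilon> \<le> 1 - (norm w)\<^sup>2) * norm (1 - z * cnj w) powr - c" for w
        have eq: "S_kernel b c z w * f w = of_real (g w)" for w
        proof -
          have "(1 - (norm w)\<^sup>2) powr b * (1 - (norm w)\<^sup>2) powr - s = (1 - (norm w)\<^sup>2) powr (c - 2)"
            by (simp add: b flip: powr_add)
          then have "(1 - (norm w)\<^sup>2) powr b / norm (1 - z * cnj w) powr c *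
              ((1 - (norm w)\<^sup>2) powr - s * of_bool (\<epsilon> \<le> 1 - (norm w)\<^sup>2)) = g w"
            by (simp add: g_def powr_minus divide_inverse)
          then show ?thesis
            unfolding S_kernel_def f_def of_real_mult[symmetric] by simp
        qed
        have g0: "0 \<le> g w" for w by (simp add: g_def)
        have "integrable dA (\<lambda>w. complex_of_real (g w))"
          using elim by (simp add: eq)
        then have int: "integrable dA g"
          using integrable_Re by fastforce
        have "ennreal (k * L) \<le> (\<integral>\<^sup>+w. ennreal (g w) \<partial>dA)"
          using nn_integral_S_kernel_ge[OF c \<epsilon>(1,2) z t] unfolding k_def g_def \<epsilon>(3) .
        also have "\<dots> = ennreal (LINT w|dA. g w)"
          using int g0 by (simp add: nn_integral_eq_integral)
        finally have "ennreal (k * L) \<le> ennreal (LINT w|dA. g w)" .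
        then have kL: "k * L \<le> (LINT w|dA. g w)"
          using g0 by (subst (asm) ennreal_le_iff) (auto intro: integral_nonneg_AE)
        have tz: "0 < 1 - (norm z)\<^sup>2" using one_minus_norm_squared[OF z] by simp
        have "?F z = of_real ((1 - (norm z)\<^sup>2) powr - 1 * (LINT w|dA. g w))"
          by (simp add: kernel_op_def eq)
        then have "norm (?F z) = (LINT w|dA. g w) / (1 - (norm z)\<^sup>2)"
          using tz integral_nonneg_AE[of g dA] g0 by (simp add: powr_minus_divide del: of_real_mult of_real_divide)
        moreover have "k * L / \<epsilon> < k * L / (1 - (norm z)\<^sup>2)"
          using t tz k L \<epsilon> by (intro divide_strict_left_mono) auto
        moreover have "k * L / (1 - (norm z)\<^sup>2) \<le> (LINT w|dA. g w) / (1 - (norm z)\<^sup>2)"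
          using kL tz by (intro divide_right_mono) auto
        ultimately show "k * L / \<epsilon> < norm (?F z)" by linarith
      qed
    qed
    \<comment> \<open>On an annulus of measure \<epsilon> the function exceeds k L / \<epsilon>, so
      the cutoff cancels in the weak norm.\<close>
    have "ennreal (k * L) = ennreal (k * L / \<epsilon>) * ennreal \<epsilon>"
      using k L \<epsilon> by (simp flip: ennreal_mult)
    also have "\<dots> \<le> ennreal (k * L / \<epsilon>) * emeasure dA {z \<in> space dA. k * L / \<epsilon> < norm (?F z)}"
    proof (rule mult_left_mono)
      have "ennreal \<epsilon> = emeasure dA {z \<in> ball 0 1. 1 - (norm z)\<^sup>2 < \<epsilon>}"
        using emeasure_dA_norm_gt(2)[of \<epsilon>] \<epsilon> by simp
      also have "\<dots> \<le> emeasure dA {z \<in> space dA. k * L / \<epsilon> < norm (?F z)}"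
      proof (rule emeasure_mono_AE)
        show "AE z in dA. z \<in> {z \<in> ball 0 1. 1 - (norm z)\<^sup>2 < \<epsilon>} \<longrightarrow> z \<in> {z \<in> space dA. k * L / \<epsilon> < norm (?F z)}"
          using large by eventually_elim auto
      qed measurable
      finally show "ennreal \<epsilon> \<le> emeasure dA {z \<in> space dA. k * L / \<epsilon> < norm (?F z)}" .
    qed simp
    also have "\<dots> \<le> weak_L1_norm ?F"
      using k L \<epsilon> by (intro weak_L1_norm_ge) auto
    also have "\<dots> \<le> ennreal C * Lp_norm (recip_exponent s) f"
      using * by simp
    also have "\<dots> \<le> ennreal \<bar>C\<bar> * ennreal (L powr s)"
      by (intro mult_mono Lp ennreal_leI) auto
    also have "\<dots> = ennreal (\<bar>C\<bar> * L powr s)"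
      by (simp flip: ennreal_mult)
    finally show ?thesis by (subst (asm) ennreal_le_iff) auto
  qed
  \<comment> \<open>Chosen so that L^(1-s) = |C| / k + 1, just above what the bound allows; this
    needs s < 1. The absolute value is taken because \<open>C\<close> is an arbitrary real.\<close>
  define L where "L = (\<bar>C\<bar> / k + 1) powr (1 / (1 - s))"
  have pos: "0 < \<bar>C\<bar> / k + 1"
    using k by (intro add_nonneg_pos) auto
  then have L: "0 < L" unfolding L_def by (subst powr_gt_zero) simp
  have "k * (L powr (1 - s) * L powr s) \<le> \<bar>C\<bar> * L powr s"
    using bound[OF L] L by (simp flip: powr_add)
  then have "k * L powr (1 - s) \<le> \<bar>C\<bar>"
    using L by (simp add: mult.assoc[symmetric])
  moreover have "L powr (1 - s) = \<bar>C\<bar> / k + 1"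
    using s pos by (simp add: L_def powr_powr)
  ultimately show False
    using k by (simp add: distrib_left)
qed

section \<open>Lacunary series\<close>

text \<open>Against a radial weight times \<open>w ^ n\<close> all moments but the n-th vanish, so
  one term of the Taylor series remains.\<close>

lemma cauchy_int_monomial:
  fixes W :: "real \<Rightarrow> real"
  assumes c: "0 < c" and [measurable]: "W \<in> borel_measurable borel" and int: "integrable dA (\<lambda>w. W (norm w))"
    and z: "norm z < 1"
  shows "integrable dA (\<lambda>w. of_real (W (norm w)) * w ^ n)"
    and "cauchy_int c (\<lambda>w. of_real (W (norm w)) * w ^ n) z =
      of_real (binom_coeff c n * (LINT w|dA. W (norm w) * norm w ^ (2 * n))) * z ^ n"
proof -
  let ?G = "\<lambda>w. of_real (W (norm w)) * w ^ n"
  show int_G: "integrable dA ?G"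
  proof (rule Bochner_Integration.integrable_bound[OF int])
    show "AE w in dA. norm (?G w) \<le> norm (W (norm w))"
      by (rule AE_I2) (simp add: norm_mult norm_power mult_left_le power_le_one)
  qed (rule borel_measurable_dA, measurable)
  define \<mu> where "\<mu> = (LINT w|dA. W (norm w) * norm w ^ (2 * n))"
  have "(LINT w|dA. cnj w ^ m * ?G w) = (if m = n then of_real \<mu> else 0)" for m
  proof (cases "m = n")
    case True
    have eq: "cnj w ^ n * ?G w = of_real (W (norm w) * norm w ^ (2 * n))" for w
    proof -
      have "cnj w ^ n * w ^ n = of_real (norm w ^ (2 * n))"
        by (simp add: power_mult_distrib[symmetric] complex_norm_square[symmetric] power_mult mult.commute[of "cnj w"])
      then show ?thesis by (simp add: mult_ac)
    qed
    have "(LINT w|dA. cnj w ^ m * ?G w) = (LINT w|dA. of_real (W (norm w) * norm w ^ (2 * n)))"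
      unfolding True eq ..
    also have "\<dots> = of_real \<mu>"
      unfolding \<mu>_def by (rule integral_complex_of_real)
    finally show ?thesis using True by simp
  next
    case False
    then show ?thesis
      using integral_dA_monomials[of W n m] by (simp add: mult_ac)
  qed
  then have "(\<lambda>m. if m = n then of_real (binom_coeff c m * \<mu>) * z ^ m else 0) sums cauchy_int c ?G z"
    using sums_cauchy_kernel[OF c z int_G] by (simp add: cauchy_int_def if_distrib[of "\<lambda>x. _ * x"]
        if_distrib[of "\<lambda>x. x * _"] cong: if_cong)
  then show "cauchy_int c ?G z = of_real (binom_coeff c n * (LINT w|dA. W (norm w) * norm w ^ (2 * n))) * z ^ n"
    using sums_unique2[OF _ sums_single[of n "\<lambda>m. of_real (binom_coeff c m * \<mu>) * z ^ m"]]
    unfolding \<mu>_def by blast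
qed

lemma cauchy_int_sum:
  assumes c: "0 < c" and z: "norm z < 1" and "\<And>i. i \<in> I \<Longrightarrow> integrable dA (G i)"
  shows "cauchy_int c (\<lambda>w. \<Sum>i\<in>I. a i * G i w) z = (\<Sum>i\<in>I. a i * cauchy_int c (G i) z)"
proof -
  have int: "integrable dA (\<lambda>w. G i w / (1 - z * cnj w) powr of_real c)" if "i \<in> I" for i
    using that assms by (intro integrable_cauchy_kernel) auto
  have "cauchy_int c (\<lambda>w. \<Sum>i\<in>I. a i * G i w) z =
      (LINT w|dA. (\<Sum>i\<in>I. a i * (G i w / (1 - z * cnj w) powr of_real c)))"
    by (simp add: cauchy_int_def sum_divide_distrib)
  also have "\<dots> = (\<Sum>i\<in>I. (LINT w|dA. a i * (G i w / (1 - z * cnj w) powr of_real c)))"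
    by (intro Bochner_Integration.integral_sum integrable_mult_right int)
  also have "\<dots> = (\<Sum>i\<in>I. a i * cauchy_int c (G i) z)"
    unfolding cauchy_int_def integral_mult_right_zero ..
  finally show ?thesis .
qed

text \<open>For 0 \<le> t \<le> 1/2 one has ln (1 - t) \<ge> - t - 2 t^2 \<ge> - 2 t. With t = 1 -
  |z|^2 it says that |z|^(2n) stays bounded below as long as 1 - |z|^2 \<le> 1/n.\<close>

lemma exp_minus_two_le_power:
  assumes "0 \<le> t" "t \<le> 1 / 2" "t * real n \<le> 1"
  shows "exp (- 2) \<le> (1 - t) ^ n"
proof -
  have "2 * t\<^sup>2 \<le> t"
    using assms mult_left_mono[of t "1 / 2" "2 * t"] by (simp add: power2_eq_square)
  then have "- 2 * t \<le> ln (1 - t)"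
    using ln_one_minus_pos_lower_bound[OF assms(1,2)] by simp
  then have "real n * (- 2 * t) \<le> real n * ln (1 - t)"
    by (intro mult_left_mono) auto
  moreover have "- 2 \<le> real n * (- 2 * t)"
    using assms(3) by (simp add: mult.commute)
  ultimately have "- 2 \<le> ln ((1 - t) ^ n)"
    using assms by (simp add: ln_realpow)
  then have "exp (- 2) \<le> exp (ln ((1 - t) ^ n))" by simp
  also have "\<dots> = (1 - t) ^ n" using assms by simp
  finally show ?thesis .
qed

text \<open>The larger exponent is determined by size, since 4^i + 4^j \<le> 2 * 4^j < 4^(j+1) for i
  \<le> j; cancelling it determines the smaller one.\<close>

lemma inj_on_four_powers:
  "inj_on (\<lambda>(i, j). 4 ^ i + 4 ^ j :: nat) {(i, j). i \<le> j}"
proof (rule inj_onI, clarify)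
  fix i j k l :: nat
  assume le: "i \<le> j" "k \<le> l" and eq: "4 ^ i + 4 ^ j = (4 ^ k + 4 ^ l :: nat)"
  have False if "a \<le> b" "4 ^ a + 4 ^ b = (4 ^ c + 4 ^ d :: nat)" "b < d" for a b c d :: nat
  proof -
    have "4 ^ a \<le> (4 ^ b :: nat)"
      using that(1) by (intro power_increasing) auto
    then have "4 ^ a + 4 ^ b \<le> (2 * 4 ^ b :: nat)" by linarith
    also have "\<dots> < 4 ^ Suc b" by simp
    also have "\<dots> \<le> 4 ^ d"
      using that by (intro power_increasing) auto
    finally show False using that by simp
  qed
  from this[of i j k l] this[of k l i j] le eq have "j = l" by fastforce
  with eq show "i = k \<and> j = l" by simp
qed

section \<open>Second and fourth moments of lacunary polynomials\<close>

definition lacunary :: "nat \<Rightarrow> complex \<Rightarrow> complex" where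
  "lacunary N z = (\<Sum>j=1..N. z ^ 4 ^ j)"

text \<open>Summing over i \<le> j, with coefficient 2 off the diagonal, leaves pairwise distinct
  exponents. The fourth moment then follows from orthogonality applied to this polynomial.\<close>

lemma lacunary_power2:
  "(lacunary N z)\<^sup>2 = (\<Sum>p\<in>{(i, j). 1 \<le> i \<and> i \<le> j \<and> j \<le> N}.
    (case p of (i, j) \<Rightarrow> if i = j then 1 else 2) * z ^ (case p of (i, j) \<Rightarrow> 4 ^ i + 4 ^ j))"
proof -
  let ?A = "{1..N} \<times> {1..N}"
  let ?f = "\<lambda>(i::nat, j::nat). z ^ (4 ^ i + 4 ^ j)"
  let ?a = "\<lambda>(i::nat, j::nat). if i = j then 1 else 2 :: complex"
  let ?n = "\<lambda>(i, j). 4 ^ i + 4 ^ j :: nat"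
  let ?L = "{(i, j). 1 \<le> i \<and> i < j \<and> j \<le> N}" and ?U = "{(i, j). 1 \<le> j \<and> j < i \<and> i \<le> N}"
  let ?D = "(\<lambda>i. (i, i)) ` {1..N}"
  let ?P = "{(i, j). 1 \<le> i \<and> i \<le> j \<and> j \<le> N}"
  have fin: "finite ?A" "finite ?L" "finite ?U" "finite ?D" "finite ?P"
    by (auto intro: finite_subset[of _ ?A])
  have P: "?P = ?D \<union> ?L" by auto
  have "(lacunary N z)\<^sup>2 = sum ?f ?A"
    by (simp add: lacunary_def power2_eq_square sum_product sum.cartesian_product power_add)
  also have "?A = ?D \<union> (?L \<union> ?U)" by auto
  also have "sum ?f \<dots> = sum ?f ?D + (sum ?f ?L + sum ?f ?U)"
    using fin by (subst sum.union_disjoint, auto)+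
  also have "sum ?f ?U = sum ?f ?L"
    by (rule sum.reindex_bij_witness[of _ prod.swap prod.swap]) (auto simp: add.commute)
  also have "sum ?f ?D + (sum ?f ?L + sum ?f ?L) =
      (\<Sum>p\<in>?P. ?a p * z ^ ?n p)"
  proof -
    have "(\<Sum>p\<in>?P. ?a p * z ^ ?n p) =
      (\<Sum>p\<in>?D. ?a p * z ^ ?n p) +
      (\<Sum>p\<in>?L. ?a p * z ^ ?n p)"
      unfolding P using fin by (intro sum.union_disjoint) auto
    also have "(\<Sum>p\<in>?D. ?a p * z ^ ?n p) = sum ?f ?D"
      by (intro sum.cong) auto
    also have "(\<Sum>p\<in>?L. ?a p * z ^ ?n p) = (\<Sum>x\<in>?L. 2 * ?f x)"
      by (intro sum.cong) auto
    also have "\<dots> = sum ?f ?L + sum ?f ?L"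
      by (simp add: sum_distrib_left[symmetric])
    finally show ?thesis by simp
  qed
  finally show ?thesis .
qed

text \<open>Comparing the second and fourth moments (Paley and Zygmund) shows that a lacunary polynomial
  with \<open>N\<close> terms has modulus of order \<open>sqrt N\<close> on a fixed proportion of a thin annulus.\<close>

lemma emeasure_lacunary_ge:
  fixes N :: nat
  defines "\<eta> \<equiv> (1 / 4) ^ N"
  assumes N: "1 \<le> N"
  shows "ennreal (exp (- 4) / 32 * \<eta>) \<le>
    emeasure dA {z \<in> ball 0 1. 1 - (norm z)\<^sup>2 < \<eta> \<and> exp (- 2) / 4 * N < (norm (lacunary N z))\<^sup>2}"
proof -
  have \<eta>: "0 < \<eta>" "\<eta> \<le> 1 / 4"
    using N power_decreasing[of 1 N "1 / 4 :: real"] by (auto simp: \<eta>_def)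
  define W where "W r = (of_bool (1 - r\<^sup>2 < \<eta>) :: real)" for r :: real
  have [measurable]: "W \<in> borel_measurable borel" unfolding W_def by measurable
  have [measurable]: "lacunary N \<in> borel_measurable borel"
    unfolding lacunary_def[abs_def] by measurable
  have W0: "0 \<le> W r" "W r \<le> 1" for r by (auto simp: W_def)
  have W_int: "integrable dA (\<lambda>z. W (norm z))"
    using W0 by (intro dA.integrable_const_bound[of _ 1] borel_measurable_dA) auto
  have W_int_pow: "integrable dA (\<lambda>z::complex. W (norm z) * norm z ^ k)" for k
    using W0 by (intro dA.integrable_const_bound[of _ 1] borel_measurable_dA)
      (auto intro!: mult_le_one power_le_one)
  define A where "A = {z \<in> ball (0::complex) 1. 1 - (norm z)\<^sup>2 < \<eta>}"
  have A: "A \<in> sets dA" unfolding A_def by (rule sets_dA_Collect) measurable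
  have "(\<integral>\<^sup>+z. ennreal (W (norm z)) \<partial>dA) = (\<integral>\<^sup>+z. indicator A z \<partial>dA)"
    by (intro nn_integral_cong) (auto simp: W_def A_def)
  also have "\<dots> = ennreal \<eta>"
    using A emeasure_dA_norm_gt(2)[of \<eta>] \<eta> by (simp add: A_def)
  finally have W_nn: "(\<integral>\<^sup>+z. ennreal (W (norm z)) \<partial>dA) = ennreal \<eta>" .
  then have W_eq: "(LINT z|dA. W (norm z)) = \<eta>"
    using \<eta> W0 by (subst integral_eq_nn_integral) (auto intro!: borel_measurable_dA)
  \<comment> \<open>On the annulus (1 - |z|^2) 4^j < 1 for all j \<le> N, so none of the N monomials
    has decayed.\<close>
  have second: "ennreal (exp (- 2) * N * \<eta>) \<le> (\<integral>\<^sup>+z. ennreal (W (norm z) * (norm (lacunary N z))\<^sup>2) \<partial>dA)"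
  proof -
    have "exp (- 2) * \<eta> \<le> (LINT z|dA. W (norm z) * norm z ^ (2 * 4 ^ j))" if j: "j \<in> {1..N}" for j
    proof -
      have "exp (- 2) * \<eta> = (LINT z|dA. exp (- 2) * W (norm z))"
        by (simp add: W_eq)
      also have "\<dots> \<le> (LINT z|dA. W (norm z) * norm z ^ (2 * 4 ^ j))"
      proof (intro integral_mono integrable_mult_right W_int W_int_pow)
        fix z :: complex assume "z \<in> space dA"
        then have t: "0 < 1 - (norm z)\<^sup>2" using one_minus_norm_squared[of z] by simp
        show "exp (- 2) * W (norm z) \<le> W (norm z) * norm z ^ (2 * 4 ^ j)"
        proof (cases "1 - (norm z)\<^sup>2 < \<eta>")
          case True
          have "(1 - (norm z)\<^sup>2) * real (4 ^ j) \<le> \<eta> * real (4 ^ N)"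
            using True t j \<eta> by (intro mult_mono) (auto intro: power_increasing)
          also have "\<dots> = 1"
            by (simp add: \<eta>_def flip: power_mult_distrib)
          finally have "exp (- 2) \<le> (1 - (1 - (norm z)\<^sup>2)) ^ 4 ^ j"
            using True t \<eta> by (intro exp_minus_two_le_power) auto
          then show ?thesis
            using True by (simp add: W_def power_mult)
        qed (simp add: W_def)
      qed
      finally show ?thesis .
    qed
    then have "(\<Sum>j=1..N. exp (- 2) * \<eta>) \<le> (\<Sum>j=1..N. (norm (1::complex))\<^sup>2 * (LINT z|dA. W (norm z) * norm z ^ (2 * 4 ^ j)))"
      by (intro sum_mono) simp
    then have "ennreal (exp (- 2) * N * \<eta>) \<le> ennreal (\<Sum>j=1..N. (norm (1::complex))\<^sup>2 * (LINT z|dA. W (norm z) * norm z ^ (2 * 4 ^ j)))"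
      by (intro ennreal_leI) (simp add: mult_ac)
    also have "\<dots> = (\<integral>\<^sup>+z. ennreal (W (norm z) * (norm (\<Sum>j=1..N. 1 * z ^ 4 ^ j))\<^sup>2) \<partial>dA)"
      by (rule nn_integral_dA_norm_sum_monomials[symmetric]) (auto simp: W0 W_int inj_on_def)
    finally show ?thesis by (simp add: lacunary_def)
  qed
  \<comment> \<open>At most N^2 pairs, each with squared coefficient at most 4 and moment at most
    \<eta>.\<close>
  have fourth: "(\<integral>\<^sup>+z. ennreal (W (norm z) * (norm ((lacunary N z)\<^sup>2))\<^sup>2) \<partial>dA) \<le> ennreal (4 * (real N)\<^sup>2 * \<eta>)"
  proof -
    let ?P = "{(i, j). 1 \<le> i \<and> i \<le> j \<and> j \<le> N}"
    let ?a = "\<lambda>(i::nat, j::nat). if i = j then 1 else 2 :: complex"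
    let ?n = "\<lambda>(i, j). 4 ^ i + 4 ^ j :: nat"
    have sub: "?P \<subseteq> {1..N} \<times> {1..N}" by auto
    then have fin: "finite ?P" by (rule finite_subset) auto
    have "card ?P \<le> card ({1..N} \<times> {1..N})"
      by (rule card_mono[OF _ sub]) auto
    then have "card ?P \<le> N\<^sup>2" by (simp add: card_cartesian_product power2_eq_square)
    then have card: "real (card ?P) \<le> (real N)\<^sup>2"
      by (simp only: of_nat_power[symmetric] of_nat_le_iff)
    have "(lacunary N z)\<^sup>2 = (\<Sum>p\<in>?P. ?a p * z ^ ?n p)" for z
      by (rule lacunary_power2)
    then have "(\<integral>\<^sup>+z. ennreal (W (norm z) * (norm ((lacunary N z)\<^sup>2))\<^sup>2) \<partial>dA) =
        (\<integral>\<^sup>+z. ennreal (W (norm z) * (norm (\<Sum>p\<in>?P. ?a p * z ^ ?n p))\<^sup>2) \<partial>dA)"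
      by (simp only:)
    also have "\<dots> = ennreal (\<Sum>p\<in>?P. (norm (?a p))\<^sup>2 * (LINT z|dA. W (norm z) * norm z ^ (2 * ?n p)))"
      by (rule nn_integral_dA_norm_sum_monomials[OF fin])
         (rule inj_on_subset[OF inj_on_four_powers], auto intro: W0 W_int)
    also have "\<dots> \<le> ennreal (\<Sum>p\<in>?P. 4 * \<eta>)"
    proof (intro ennreal_leI sum_mono mult_mono)
      fix p
      show "(LINT z|dA. W (norm z) * norm z ^ (2 * ?n p)) \<le> \<eta>"
        unfolding W_eq[symmetric] using W_int W_int_pow W0
        by (intro integral_mono) (auto intro!: mult_left_le power_le_one)
      show "0 \<le> (LINT z|dA. W (norm z) * norm z ^ (2 * ?n p))"
        using W0 by (intro integral_nonneg_AE AE_I2) auto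
    qed (auto split: if_splits)
    also have "\<dots> \<le> ennreal (4 * (real N)\<^sup>2 * \<eta>)"
      using card \<eta> by (intro ennreal_leI) (auto simp: mult_right_mono)
    finally show ?thesis .
  qed
  define E where "E = {z \<in> ball 0 1. 1 - (norm z)\<^sup>2 < \<eta> \<and> exp (- 2) / 4 * N < (norm (lacunary N z))\<^sup>2}"
  have E [measurable]: "E \<in> sets dA" unfolding E_def by (rule sets_dA_Collect) measurable
  \<comment> \<open>The second moment is at least e^(-2) N \<eta>. Off \<open>E\<close> the
    integrand costs a quarter of this. On \<open>E\<close>, x \<le> B + x^2 / B with B = 16 e^2 N,
    so that the fourth moment bound 4 N^2 \<eta> divided by B is another quarter. The remaining half
    must be paid by B times the measure of \<open>E\<close>, which gives e^(-4) / 32.\<close>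
  have ptw: "W (norm z) * (norm (lacunary N z))\<^sup>2 \<le>
      exp (- 2) / 4 * N * W (norm z) + 16 * exp 2 * N * indicator E z +
      1 / (16 * exp 2 * N) * (W (norm z) * (norm ((lacunary N z)\<^sup>2))\<^sup>2)" if z: "z \<in> space dA" for z
  proof (cases "z \<in> E")
    case True
    define x where "x = (norm (lacunary N z))\<^sup>2"
    define B where "B = 16 * exp 2 * real N"
    have B: "0 < B" using N by (simp add: B_def)
    have "2 * x * B \<le> x\<^sup>2 + B\<^sup>2" by (rule sum_squares_bound)
    moreover have "0 \<le> x * B" using B by (simp add: x_def)
    ultimately have "x * B \<le> x\<^sup>2 + B\<^sup>2" by linarith
    then have "x \<le> B + 1 / B * x\<^sup>2"
      using B by (simp add: field_simps power2_eq_square)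
    moreover have "W (norm z) = 1" using True by (simp add: E_def W_def)
    moreover have "0 \<le> exp (- 2) / 4 * real N" by simp
    ultimately have "W (norm z) * x \<le> exp (- 2) / 4 * N * W (norm z) + B + 1 / B * (W (norm z) * x\<^sup>2)"
      by (simp only: mult_1 mult_1_right)
    then show ?thesis
      using True by (simp add: B_def x_def norm_power)
  next
    case False
    then have "W (norm z) = 0 \<or> (norm (lacunary N z))\<^sup>2 \<le> exp (- 2) / 4 * N"
      using z by (auto simp: E_def W_def)
    then have "W (norm z) * (norm (lacunary N z))\<^sup>2 \<le> W (norm z) * (exp (- 2) / 4 * N)"
    proof
      assume "(norm (lacunary N z))\<^sup>2 \<le> exp (- 2) / 4 * N"
      then show ?thesis by (rule mult_left_mono) (rule W0)
    qed simp
    also have "\<dots> = exp (- 2) / 4 * N * W (norm z)"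
      by (rule mult.commute)
    also have "\<dots> \<le> exp (- 2) / 4 * N * W (norm z) + 16 * exp 2 * N * indicator E z +
      1 / (16 * exp 2 * N) * (W (norm z) * (norm ((lacunary N z)\<^sup>2))\<^sup>2)"
      using W0 by simp
    finally show ?thesis .
  qed
  have "ennreal (exp (- 2) * N * \<eta>) \<le> (\<integral>\<^sup>+z. ennreal (W (norm z) * (norm (lacunary N z))\<^sup>2) \<partial>dA)"
    by (rule second)
  also have "\<dots> \<le> (\<integral>\<^sup>+z. ennreal (exp (- 2) / 4 * N) * ennreal (W (norm z)) + ennreal (16 * exp 2 * N) * indicator E z +
      ennreal (1 / (16 * exp 2 * N)) * ennreal (W (norm z) * (norm ((lacunary N z)\<^sup>2))\<^sup>2) \<partial>dA)"
    using W0 ptw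
    by (intro nn_integral_mono)
       (auto simp: ennreal_leI simp flip: ennreal_mult ennreal_plus ennreal_indicator)
  also have "\<dots> = ennreal (exp (- 2) / 4 * N) * (\<integral>\<^sup>+z. ennreal (W (norm z)) \<partial>dA) + ennreal (16 * exp 2 * N) * emeasure dA E +
      ennreal (1 / (16 * exp 2 * N)) * (\<integral>\<^sup>+z. ennreal (W (norm z) * (norm ((lacunary N z)\<^sup>2))\<^sup>2) \<partial>dA)"
  proof -
    have [measurable]: "(\<lambda>z. ennreal (W (norm z))) \<in> borel_measurable dA"
      "(\<lambda>z. ennreal (W (norm z) * (norm ((lacunary N z)\<^sup>2))\<^sup>2)) \<in> borel_measurable dA"
      by (rule borel_measurable_dA, measurable)+
    show ?thesis
      by (simp add: nn_integral_add nn_integral_cmult nn_integral_cmult_indicator)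
  qed
  also have "\<dots> \<le> ennreal (exp (- 2) / 4 * N) * ennreal \<eta> + ennreal (16 * exp 2 * N) * emeasure dA E +
      ennreal (1 / (16 * exp 2 * N)) * ennreal (4 * (real N)\<^sup>2 * \<eta>)"
    unfolding W_nn by (intro add_mono mult_left_mono fourth) auto
  also have "\<dots> = ennreal (exp (- 2) / 4 * N * \<eta> + 16 * exp 2 * N * measure dA E + 1 / (16 * exp 2 * N) * (4 * (real N)\<^sup>2 * \<eta>))"
    using \<eta> by (simp add: dA.emeasure_eq_measure flip: ennreal_mult ennreal_plus)
  finally have "exp (- 2) * N * \<eta> \<le> exp (- 2) / 4 * N * \<eta> + 16 * exp 2 * N * measure dA E + 1 / (16 * exp 2 * N) * (4 * (real N)\<^sup>2 * \<eta>)"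
    using \<eta> by (subst (asm) ennreal_le_iff) auto
  also have "1 / (16 * exp 2 * N) * (4 * (real N)\<^sup>2 * \<eta>) = exp (- 2) / 4 * N * \<eta>"
    using N by (simp add: power2_eq_square exp_minus field_simps)
  finally have "N * (exp (- 2) * \<eta>) \<le> N * (exp (- 2) / 2 * \<eta> + 16 * exp 2 * measure dA E)"
    by (simp add: algebra_simps)
  then have "exp (- 2) * \<eta> \<le> exp (- 2) / 2 * \<eta> + 16 * exp 2 * measure dA E"
    using N by (subst (asm) mult_le_cancel_left_pos) auto
  then have "exp (- 2) / 2 * \<eta> \<le> 16 * exp 2 * measure dA E" by simp
  then have "exp (- 2) * (exp (- 2) / 2 * \<eta>) \<le> exp (- 2) * (16 * exp 2 * measure dA E)"
    by (intro mult_left_mono) auto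
  also have "exp (- 2) * (16 * exp 2 * measure dA E) = 16 * measure dA E"
    by (simp add: exp_minus)
  also have "exp (- 2) * (exp (- 2) / 2 * \<eta>) = exp (- 4) / 2 * \<eta>"
    by (simp flip: exp_add)
  finally have "exp (- 4) / 32 * \<eta> \<le> measure dA E" by simp
  then show ?thesis
    unfolding E_def[symmetric] by (simp add: dA.emeasure_eq_measure ennreal_leI)
qed

text \<open>On this annulus the weight is of order n^(2-c), the measure is 1 / (2n) and |w|^(2n)
  \<ge> e^(-2). The resulting n^(1-c) offsets the growth n^(c-1) of the binomial
  coefficients.\<close>

lemma radial_moment_ge:
  fixes n :: nat
  assumes c: "1 < c" and n: "2 \<le> n"
  defines "W \<equiv> \<lambda>r::real. (1 - r\<^sup>2) powr (c - 2) * of_bool (1 / (2 * n) \<le> 1 - r\<^sup>2 \<and> 1 - r\<^sup>2 \<le> 1 / n)"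
  shows "integrable dA (\<lambda>w. W (norm w))"
    and "exp (- 2) * 2 powr - c * real n powr (1 - c) \<le> (LINT w|dA. W (norm w) * norm w ^ (2 * n))"
proof -
  have [measurable]: "W \<in> borel_measurable borel" unfolding W_def by measurable
  define a where "a = 1 / (2 * real n)"
  have a: "0 < a" "2 * a = 1 / n" "2 * a \<le> 1 / 2"
    using n by (auto simp: a_def field_simps)
  have W0: "0 \<le> W r" for r by (simp add: W_def)
  \<comment> \<open>The sign of c - 2 is unknown. As a quotient of two increasing functions of 1 -
    r^2, the weight is estimated at the endpoints a and 2 a in all cases.\<close>
  have W_split: "W r = (1 - r\<^sup>2) powr (c - 1) / (1 - r\<^sup>2) * of_bool (a \<le> 1 - r\<^sup>2 \<and> 1 - r\<^sup>2 \<le> 2 * a)" for r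
    using a powr_diff[of "1 - r\<^sup>2" "c - 1" 1] by (simp add: W_def a_def)
  have W_le: "W r \<le> 1 / a" for r
  proof (cases "a \<le> 1 - r\<^sup>2 \<and> 1 - r\<^sup>2 \<le> 2 * a")
    case True
    have "(1 - r\<^sup>2) powr (c - 1) \<le> 1"
      using True a c by (intro powr_le1) auto
    then show ?thesis
      using True a by (simp add: W_split frac_le)
  next
    case False
    then have "W r = 0" unfolding W_split by (simp only: of_bool_eq mult_zero_right)
    then show ?thesis using a by simp
  qed
  show int: "integrable dA (\<lambda>w. W (norm w))"
    using W0 W_le by (intro dA.integrable_const_bound[of _ "1 / a"] borel_measurable_dA) auto
  have int_pow: "integrable dA (\<lambda>w::complex. W (norm w) * norm w ^ (2 * n))"
  proof (rule Bochner_Integration.integrable_bound[OF int])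
    show "AE w in dA. norm (W (norm w) * norm (w::complex) ^ (2 * n)) \<le> norm (W (norm w))"
      using W0 by (intro AE_I2) (auto intro!: mult_left_le power_le_one)
  qed (rule borel_measurable_dA, measurable)
  define K where "K = exp (- 2) * (a powr (c - 1) / (2 * a))"
  have K: "0 \<le> K" using a by (simp add: K_def)
  define A where "A = {w \<in> ball (0::complex) 1. a \<le> 1 - (norm w)\<^sup>2 \<and> 1 - (norm w)\<^sup>2 \<le> 2 * a}"
  have A: "A \<in> sets dA" unfolding A_def by (rule sets_dA_Collect) measurable
  have "emeasure dA A = (\<integral>\<^sup>+w. indicator {a..2 * a} (1 - (norm w)\<^sup>2) \<partial>dA)"
    unfolding nn_integral_indicator[OF A, symmetric]
    by (intro nn_integral_cong) (auto simp: A_def split: split_indicator)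
  also have "\<dots> = (\<integral>\<^sup>+t. indicator {a..2 * a} t * indicator {0..1} t \<partial>lborel)"
    by (rule nn_integral_dA_radial) measurable
  also have "\<dots> = (\<integral>\<^sup>+t. indicator {a..2 * a} t \<partial>lborel)"
    using a by (intro nn_integral_cong) (auto split: split_indicator)
  also have "\<dots> = ennreal a"
    using a by simp
  finally have "measure dA A = a"
    using a by (simp add: measure_def)
  then have "K * a = (LINT w|dA. K * indicator A w)"
    using sets.Int_space_eq2[OF A] by simp
  also have "\<dots> \<le> (LINT w|dA. W (norm w) * norm w ^ (2 * n))"
  proof (rule integral_mono[OF _ int_pow])
    show "integrable dA (\<lambda>w. K * indicator A w)"
      using A by (intro integrable_mult_right integrable_real_indicator) (auto simp: dA.emeasure_eq_measure)
    fix w :: complex assume w: "w \<in> space dA"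
    show "K * indicator A w \<le> W (norm w) * norm w ^ (2 * n)"
    proof (cases "w \<in> A")
      case True
      define t where "t = 1 - (norm w)\<^sup>2"
      have t: "a \<le> t" "t \<le> 2 * a" using True by (auto simp: A_def t_def)
      have "t * real n \<le> 2 * a * n" using t by (intro mult_right_mono) auto
      then have tn: "t * real n \<le> 1" using a(2) n by simp
      have t0: "0 \<le> t" "t \<le> 1 / 2" using t a(1,3) by linarith+
      have "exp (- 2) \<le> (1 - t) ^ n"
        by (rule exp_minus_two_le_power[OF t0 tn])
      moreover have "a powr (c - 1) / (2 * a) \<le> t powr (c - 1) / t"
        using t a c by (intro frac_le powr_mono2) auto
      ultimately have "K \<le> (1 - t) ^ n * (t powr (c - 1) / t)"
        unfolding K_def using a t by (intro mult_mono) (auto intro: order_trans[OF exp_ge_zero])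
      also have "\<dots> = W (norm w) * norm w ^ (2 * n)"
        using True by (simp add: W_split A_def t_def power_mult)
      finally show ?thesis using True by simp
    qed (use W0 in simp)
  qed
  also have "K * a = exp (- 2) * 2 powr - c * real n powr (1 - c)"
  proof -
    have "a powr (c - 1) = 2 powr (1 - c) * real n powr (1 - c)"
      using n by (simp add: a_def powr_divide powr_mult powr_diff field_simps)
    moreover have "2 powr (1 - c) = 2 * 2 powr - c"
      using powr_add[of 2 1 "- c"] by simp
    moreover have "K * a = exp (- 2) * (a powr (c - 1) / 2)"
      using a(1) by (simp add: K_def)
    ultimately show ?thesis by simp
  qed
  finally show "exp (- 2) * 2 powr - c * real n powr (1 - c) \<le> (LINT w|dA. W (norm w) * norm w ^ (2 * n))" .
qed

text \<open>The summands of the test function live on the disjoint annuli on which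
  \<open>1 - (norm w)\<^sup>2\<close> is comparable to \<open>1 / 4 ^ j\<close>, where \<open>norm w ^ 4 ^ j\<close> is bounded below.\<close>

lemma exists_lacunary_preimage:
  assumes c: "1 < c"
  obtains D where "0 < D"
    "\<forall>N s. 0 \<le> s \<longrightarrow> 1 \<le> N \<longrightarrow> (\<exists>f \<in> borel_measurable dA.
      (\<forall>w. norm w < 1 \<longrightarrow> norm (f w) \<le> D * (1 - (norm w)\<^sup>2) powr - s * of_bool ((1 / 4) ^ N / 2 \<le> 1 - (norm w)\<^sup>2)) \<and>
      (\<forall>z. norm z < 1 \<longrightarrow> cauchy_int c (\<lambda>w. of_real ((1 - (norm w)\<^sup>2) powr (s + c - 2)) * f w) z = lacunary N z))"
proof -
  obtain \<kappa> where \<kappa>: "0 < \<kappa>" "\<And>n. 0 < n \<Longrightarrow> \<kappa> * real n powr (c - 1) \<le> binom_coeff c n"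
    using c by (auto intro: binom_coeff_ge[of c])
  \<comment> \<open>A lower bound, uniform in j, for the multiplier \<open>\<mu> j\<close> below:
    \<kappa> from the binomial coefficient, the rest from the radial moment, with the powers of 4^j
    cancelling.\<close>
  define \<rho> where "\<rho> = \<kappa> * (exp (- 2) * 2 powr - c)"
  have \<rho>: "0 < \<rho>" using \<kappa> by (simp add: \<rho>_def)
  define S where "S j = {t::real. 1 / (2 * real (4 ^ j)) \<le> t \<and> t \<le> 1 / real (4 ^ j)}" for j :: nat
  define W where "W j r = (1 - r\<^sup>2) powr (c - 2) * of_bool (1 - r\<^sup>2 \<in> S j)" for j and r :: real
  have W_meas [measurable]: "W j \<in> borel_measurable borel" for j
    unfolding W_def S_def mem_Collect_eq by measurable
  define \<mu> where "\<mu> j = binom_coeff c (4 ^ j) * (LINT w|dA. W j (norm w) * norm w ^ (2 * 4 ^ j))" for j :: nat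
  have W_int: "integrable dA (\<lambda>w. W j (norm w))" and \<mu>: "\<rho> \<le> \<mu> j" if "1 \<le> j" for j
  proof -
    have n: "2 \<le> (4::nat) ^ j"
      using power_increasing[OF that, of "4::nat"] by simp
    note m = radial_moment_ge[OF c n, folded W_def]
    show "integrable dA (\<lambda>w. W j (norm w))"
      using m(1) by (simp add: W_def S_def)
    have "\<rho> = (\<kappa> * real (4 ^ j) powr (c - 1)) * (exp (- 2) * 2 powr - c * real (4 ^ j) powr (1 - c))"
      using powr_add[of "real (4 ^ j)" "c - 1" "1 - c"] by (simp add: \<rho>_def)
    also have "\<dots> \<le> \<mu> j"
      unfolding \<mu>_def
    proof (rule mult_mono)
      show "\<kappa> * real (4 ^ j) powr (c - 1) \<le> binom_coeff c (4 ^ j)"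
        by (rule \<kappa>(2)) simp
      show "exp (- 2) * 2 powr - c * real (4 ^ j) powr (1 - c) \<le> (LINT w|dA. W j (norm w) * norm w ^ (2 * 4 ^ j))"
        using m(2) by (simp add: W_def S_def)
    qed (use c in \<open>auto intro: less_imp_le[OF binom_coeff_pos]\<close>)
    finally show "\<rho> \<le> \<mu> j" .
  qed
  show thesis
  proof (rule that[of "1 / \<rho>"])
    show "0 < 1 / \<rho>" using \<rho> by simp
    show "\<forall>N s. 0 \<le> s \<longrightarrow> 1 \<le> N \<longrightarrow> (\<exists>f \<in> borel_measurable dA.
      (\<forall>w. norm w < 1 \<longrightarrow> norm (f w) \<le> 1 / \<rho> * (1 - (norm w)\<^sup>2) powr - s * of_bool ((1 / 4) ^ N / 2 \<le> 1 - (norm w)\<^sup>2)) \<and>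
      (\<forall>z. norm z < 1 \<longrightarrow> cauchy_int c (\<lambda>w. of_real ((1 - (norm w)\<^sup>2) powr (s + c - 2)) * f w) z = lacunary N z))"
    proof (intro allI impI)
      fix N :: nat and s :: real assume s: "0 \<le> s" and N: "1 \<le> N"
      \<comment> \<open>The factors 1 / \<open>\<mu> j\<close> normalize the images to pure
        monomials. The power - s absorbs the s in the kernel weight, which leaves \<open>W j\<close>
        for every s.\<close>
      define f where "f w = (\<Sum>j=1..N. of_real (1 / \<mu> j) * (of_real ((1 - (norm w)\<^sup>2) powr - s * of_bool (1 - (norm w)\<^sup>2 \<in> S j)) * w ^ 4 ^ j))" for w :: complex
      have "f \<in> borel_measurable dA"
        unfolding f_def S_def mem_Collect_eq by (rule borel_measurable_dA) measurable
      moreover have "norm (f w) \<le> 1 / \<rho> * (1 - (norm w)\<^sup>2) powr - s * of_bool ((1 / 4) ^ N / 2 \<le> 1 - (norm w)\<^sup>2)"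
        if w: "norm w < 1" for w
      proof -
        define t where "t = 1 - (norm w)\<^sup>2"
        have t: "0 < t" using one_minus_norm_squared[OF w] by (simp add: t_def)
        have "norm (f w) \<le> (\<Sum>j=1..N. 1 / \<rho> * t powr - s * of_bool (t \<in> S j))"
          unfolding f_def
        proof (rule sum_norm_le)
          fix j assume "j \<in> {1..N}"
          then have \<mu>j: "\<rho> \<le> \<mu> j" using \<mu> by simp
          then have "norm (of_real (1 / \<mu> j) * (of_real (t powr - s * of_bool (t \<in> S j)) * w ^ 4 ^ j)) =
              (1 / \<mu> j * (t powr - s * of_bool (t \<in> S j))) * norm w ^ 4 ^ j"
            using \<rho> by (simp add: norm_mult norm_power del: of_real_mult of_real_divide)
          also have "\<dots> \<le> 1 / \<mu> j * (t powr - s * of_bool (t \<in> S j))"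
            using w \<mu>j \<rho> by (intro mult_left_le power_le_one) auto
          also have "\<dots> \<le> 1 / \<rho> * (t powr - s * of_bool (t \<in> S j))"
            using \<mu>j \<rho> by (intro mult_right_mono frac_le) auto
          finally show "norm (of_real (1 / \<mu> j) * (of_real ((1 - (norm w)\<^sup>2) powr - s * of_bool (1 - (norm w)\<^sup>2 \<in> S j)) * w ^ 4 ^ j))
              \<le> 1 / \<rho> * t powr - s * of_bool (t \<in> S j)"
            by (simp add: t_def mult.assoc)
        qed
        also have "\<dots> = 1 / \<rho> * t powr - s * real (card {j \<in> {1..N}. t \<in> S j})"
          unfolding sum_distrib_left[symmetric] by (simp add: of_bool_def sum.If_cases Int_def)
        also have "\<dots> \<le> 1 / \<rho> * t powr - s * of_bool ((1 / 4) ^ N / 2 \<le> t)"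
        proof (rule mult_left_mono)
          \<comment> \<open>Within one annulus t varies by a factor 2, from one annulus to the next
            by a factor 4; so at most one summand is nonzero at each point and the bound does not
            grow with N.\<close>
          have disj: "j = k" if "t \<in> S j" "t \<in> S k" for j k
          proof -
            have False if "t \<in> S j" "t \<in> S k" "j < k" for j k
            proof -
              have "1 / (2 * real (4 ^ j)) \<le> 1 / real (4 ^ k)"
                using that by (auto simp: S_def)
              then have "real (4 ^ k) \<le> 2 * real (4 ^ j)"
                by (simp add: field_simps)
              moreover have "real (4 ^ Suc j) \<le> real (4 ^ k)"
                using that by (intro of_nat_mono power_increasing) auto
              moreover have "0 < (4::real) ^ j" by simp
              ultimately show False unfolding of_nat_power by simp
            qed
            from this[of j k] this[of k j] that show ?thesis by fastforce
          qed
          then have "card {j \<in> {1..N}. t \<in> S j} \<le> Suc 0"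
            by (subst card_le_Suc0_iff_eq) auto
          moreover have "{j \<in> {1..N}. t \<in> S j} = {}" if "\<not> (1 / 4) ^ N / 2 \<le> t"
          proof -
            have "t < 1 / (2 * real (4 ^ j))" if "j \<le> N" for j
            proof -
              have "real (4 ^ j) \<le> real (4 ^ N)"
                using that by (intro of_nat_mono power_increasing) auto
              then have "1 / (2 * real (4 ^ N)) \<le> 1 / (2 * real (4 ^ j))"
                by (intro divide_left_mono) auto
              with \<open>\<not> (1 / 4) ^ N / 2 \<le> t\<close> show ?thesis by (simp add: power_divide)
            qed
            then show ?thesis by (auto simp: S_def not_le)
          qed
          ultimately show "real (card {j \<in> {1..N}. t \<in> S j}) \<le> of_bool ((1 / 4) ^ N / 2 \<le> t)"
            by (cases "(1 / 4) ^ N / 2 \<le> t") auto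
        qed (use \<rho> in simp)
        finally show ?thesis by (simp add: t_def)
      qed
      moreover have "cauchy_int c (\<lambda>w. of_real ((1 - (norm w)\<^sup>2) powr (s + c - 2)) * f w) z = lacunary N z"
        if z: "norm z < 1" for z
      proof -
        have "of_real ((1 - (norm w)\<^sup>2) powr (s + c - 2)) * f w =
            (\<Sum>j=1..N. of_real (1 / \<mu> j) * (of_real (W j (norm w)) * w ^ 4 ^ j))" for w
        proof -
          have "(1 - (norm w)\<^sup>2) powr (s + c - 2) * (1 - (norm w)\<^sup>2) powr - s = (1 - (norm w)\<^sup>2) powr (c - 2)"
            by (simp flip: powr_add)
          then have W_eq: "complex_of_real ((1 - (norm w)\<^sup>2) powr (s + c - 2)) * of_real ((1 - (norm w)\<^sup>2) powr - s * of_bool (1 - (norm w)\<^sup>2 \<in> S j)) =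
              of_real (W j (norm w))" for j
            unfolding W_def of_real_mult[symmetric] mult.assoc[symmetric] by simp
          have rearrange: "x * (m * (y * v)) = m * ((x * y) * v)" for x m y v :: complex
            by (simp add: mult_ac)
          show ?thesis
            unfolding f_def sum_distrib_left rearrange W_eq ..
        qed
        then have "cauchy_int c (\<lambda>w. of_real ((1 - (norm w)\<^sup>2) powr (s + c - 2)) * f w) z =
            cauchy_int c (\<lambda>w. \<Sum>j=1..N. of_real (1 / \<mu> j) * (of_real (W j (norm w)) * w ^ 4 ^ j)) z"
          by (simp only:)
        also have "\<dots> = (\<Sum>j=1..N. of_real (1 / \<mu> j) * cauchy_int c (\<lambda>w. of_real (W j (norm w)) * w ^ 4 ^ j) z)"
          using c z W_int by (intro cauchy_int_sum cauchy_int_monomial(1)[of c]) auto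
        also have "\<dots> = (\<Sum>j=1..N. z ^ 4 ^ j)"
        proof (intro sum.cong refl)
          fix j assume "j \<in> {1..N}"
          then have j: "1 \<le> j" by simp
          have "cauchy_int c (\<lambda>w. of_real (W j (norm w)) * w ^ 4 ^ j) z = of_real (\<mu> j) * z ^ 4 ^ j"
            unfolding \<mu>_def using c z W_int[OF j] by (intro cauchy_int_monomial(2)) auto
          then show "of_real (1 / \<mu> j) * cauchy_int c (\<lambda>w. of_real (W j (norm w)) * w ^ 4 ^ j) z = z ^ 4 ^ j"
            using \<mu>[OF j] \<rho> by simp
        qed
        finally show ?thesis by (simp add: lacunary_def)
      qed
      ultimately show "\<exists>f \<in> borel_measurable dA.
        (\<forall>w. norm w < 1 \<longrightarrow> norm (f w) \<le> 1 / \<rho> * (1 - (norm w)\<^sup>2) powr - s * of_bool ((1 / 4) ^ N / 2 \<le> 1 - (norm w)\<^sup>2)) \<and>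
        (\<forall>z. norm z < 1 \<longrightarrow> cauchy_int c (\<lambda>w. of_real ((1 - (norm w)\<^sup>2) powr (s + c - 2)) * f w) z = lacunary N z)"
      by blast
    qed
  qed
qed

section \<open>Unboundedness of the analytic operator for s < 1/2\<close>

lemma unbounded_kernel_op_T:
  assumes c: "1 < c" and s: "0 \<le> s" "s < 1 / 2" and b: "b = s + c - 2"
  shows "\<not> bounded_kernel_op (-1) (T_kernel b c) (Lp_norm (recip_exponent s)) weak_L1_norm"
proof
  assume "bounded_kernel_op (-1) (T_kernel b c) (Lp_norm (recip_exponent s)) weak_L1_norm"
  then obtain C where C: "\<And>f. f \<in> norm_space (Lp_norm (recip_exponent s)) \<Longrightarrow>
        kernel_op (-1) (T_kernel b c) f \<in> norm_space weak_L1_norm \<and>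
        weak_L1_norm (kernel_op (-1) (T_kernel b c) f) \<le> ennreal C * Lp_norm (recip_exponent s) f"
    unfolding bounded_kernel_op_def by blast
  obtain D where D: "0 < D" and ex: "\<forall>N s. 0 \<le> s \<longrightarrow> 1 \<le> N \<longrightarrow> (\<exists>f \<in> borel_measurable dA.
      (\<forall>w. norm w < 1 \<longrightarrow> norm (f w) \<le> D * (1 - (norm w)\<^sup>2) powr - s * of_bool ((1 / 4) ^ N / 2 \<le> 1 - (norm w)\<^sup>2)) \<and>
      (\<forall>z. norm z < 1 \<longrightarrow> cauchy_int c (\<lambda>w. of_real ((1 - (norm w)\<^sup>2) powr (s + c - 2)) * f w) z = lacunary N z))"
    by (rule exists_lacunary_preimage[OF c])
  \<comment> \<open>The proportion of the annulus on which the lacunary sum is large, times the size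
    sqrt (e^(-2) / 4) it has there relative to sqrt N.\<close>
  define k where "k = exp (- 4) / 32 * sqrt (exp (- 2) / 4 :: real)"
  have k: "0 < k" by (simp add: k_def)
  have bound: "k * real N powr (1 / 2) \<le> \<bar>C\<bar> * D * 3 * real N powr s" if N: "1 \<le> N" for N
  proof -
    obtain f where f [measurable]: "f \<in> borel_measurable dA"
      and f_le: "\<And>w. norm w < 1 \<Longrightarrow> norm (f w) \<le> D * (1 - (norm w)\<^sup>2) powr - s * of_bool ((1 / 4) ^ N / 2 \<le> 1 - (norm w)\<^sup>2)"
      and f_eq: "\<And>z. norm z < 1 \<Longrightarrow> cauchy_int c (\<lambda>w. of_real ((1 - (norm w)\<^sup>2) powr b) * f w) z = lacunary N z"
      using ex[rule_format, OF s(1) N] unfolding b by blast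
    define \<eta> :: real where "\<eta> = (1 / 4) ^ N"
    have \<eta>: "0 < \<eta>" "\<eta> \<le> 1 / 4"
      using N power_decreasing[of 1 N "1 / 4 :: real"] by (auto simp: \<eta>_def)
    \<comment> \<open>The cutoff is \<eta> / 2, the inner end of the N-th interval
      \<open>S N\<close>, so the logarithm is linear in N.\<close>
    have "ln (1 / (\<eta> / 2)) = ln 2 + N * ln 4"
      by (simp add: \<eta>_def ln_div ln_mult ln_realpow power_divide)
    also have "ln 4 = 2 * ln (2::real)"
      using ln_realpow[of 2 2] by simp
    also have "ln 2 + N * (2 * ln 2) = (1 + 2 * real N) * ln 2"
      by (simp add: algebra_simps)
    also have "\<dots> \<le> (1 + 2 * real N) * 1"
      using ln_le_minus_one[of 2] by (intro mult_left_mono) auto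
    also have "\<dots> \<le> 3 * N" using N by simp
    finally have L: "ln (1 / (\<eta> / 2)) \<le> 3 * N" .
    have L0: "0 < ln (1 / (\<eta> / 2))" using \<eta> by (intro ln_gt_zero) (simp add: less_divide_eq)
    have "Lp_norm (recip_exponent s) f \<le> ennreal (D * ln (1 / (\<eta> / 2)) powr s)"
      using s D \<eta> f_le by (intro Lp_norm_recip_exponent_le) (auto simp: \<eta>_def)
    also have "\<dots> \<le> ennreal (D * (3 * real N powr s))"
    proof (intro ennreal_leI mult_left_mono)
      have "ln (1 / (\<eta> / 2)) powr s \<le> (3 * real N) powr s"
        using L L0 s by (intro powr_mono2) auto
      also have "\<dots> = 3 powr s * real N powr s" by (simp add: powr_mult)
      also have "\<dots> \<le> 3 powr 1 * real N powr s"
        using s by (intro mult_right_mono powr_mono) auto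
      finally show "ln (1 / (\<eta> / 2)) powr s \<le> 3 * real N powr s" by simp
    qed (use D in simp)
    finally have Lp: "Lp_norm (recip_exponent s) f \<le> ennreal (D * (3 * real N powr s))" .
    then have "f \<in> norm_space (Lp_norm (recip_exponent s))"
      by (auto simp: norm_space_def intro: le_less_trans)
    note * = C[OF this]
    let ?F = "kernel_op (-1) (T_kernel b c) f"
    have [measurable]: "?F \<in> borel_measurable dA"
      using * by (simp add: norm_space_def)
    \<comment> \<open>Dividing by 1 - |z|^2 < \<eta> lifts the level to y / \<eta>, while the set
      has measure of order \<eta>; the product is of order sqrt N.\<close>
    define y where "y = sqrt (exp (- 2) / 4 * N)"
    have y: "0 < y" using N by (simp add: y_def)
    let ?E = "{z \<in> ball 0 1. 1 - (norm z)\<^sup>2 < \<eta> \<and> exp (- 2) / 4 * N < (norm (lacunary N z))\<^sup>2}"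
    have "k * real N powr (1 / 2) = y / \<eta> * (exp (- 4) / 32 * \<eta>)"
      using \<eta> by (simp add: k_def y_def real_sqrt_mult real_sqrt_divide powr_half_sqrt)
    then have "ennreal (k * real N powr (1 / 2)) = ennreal (y / \<eta>) * ennreal (exp (- 4) / 32 * \<eta>)"
      using \<eta> y by (simp only: ennreal_mult[symmetric]) (simp flip: ennreal_mult)
    also have "\<dots> \<le> ennreal (y / \<eta>) * emeasure dA ?E"
      unfolding \<eta>_def by (intro mult_left_mono emeasure_lacunary_ge N) simp
    also have "\<dots> \<le> ennreal (y / \<eta>) * emeasure dA {z \<in> space dA. y / \<eta> < norm (?F z)}"
    proof (rule mult_left_mono[OF emeasure_mono])
      show "?E \<subseteq> {z \<in> space dA. y / \<eta> < norm (?F z)}"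
      proof safe
        fix z :: complex assume z: "z \<in> ball 0 1" and t: "1 - (norm z)\<^sup>2 < \<eta>"
          and large: "exp (- 2) / 4 * N < (norm (lacunary N z))\<^sup>2"
        show "z \<in> space dA" using z by simp
        have "y / \<eta> * (1 - (norm z)\<^sup>2) \<le> y / \<eta> * \<eta>"
          using t y \<eta> by (intro mult_left_mono) auto
        also have "\<dots> = y" using \<eta> by simp
        also have "y < norm (lacunary N z)"
          using large unfolding y_def by (intro real_less_lsqrt) auto
        finally show "y / \<eta> < norm (?F z)"
          using z by (simp only: norm_kernel_op_T_gt_iff) (simp add: f_eq)
      qed
      show "{z \<in> space dA. y / \<eta> < norm (?F z)} \<in> sets dA"
        by measurable
    qed simp
    also have "\<dots> \<le> weak_L1_norm ?F"
      using y \<eta> by (intro weak_L1_norm_ge) auto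
    also have "\<dots> \<le> ennreal C * Lp_norm (recip_exponent s) f"
      using * by simp
    also have "\<dots> \<le> ennreal \<bar>C\<bar> * ennreal (D * (3 * real N powr s))"
      by (intro mult_mono Lp ennreal_leI) auto
    also have "\<dots> = ennreal (\<bar>C\<bar> * D * 3 * real N powr s)"
      using D by (simp add: mult_ac flip: ennreal_mult)
    finally show ?thesis
      using D by (subst (asm) ennreal_le_iff) auto
  qed
  \<comment> \<open>The bound amounts to N^(1/2 - s) \<le> X for every N \<ge> 1. As 1/2 - s > 0, an
    N at least (X + 1)^(1 / (1/2 - s)) violates it.\<close>
  define X where "X = \<bar>C\<bar> * D * 3 / k"
  have X: "0 \<le> X" using D k by (simp add: X_def)
  define N where "N = nat \<lceil>(X + 1) powr (1 / (1 / 2 - s))\<rceil>"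
  have N_ge: "(X + 1) powr (1 / (1 / 2 - s)) \<le> real N"
    by (simp add: N_def real_nat_ceiling_ge)
  have "1 \<le> (X + 1) powr (1 / (1 / 2 - s))"
    using X s by (intro ge_one_powr_ge_zero) auto
  with N_ge have N: "1 \<le> N" by linarith
  have "real N powr (1 / 2) = real N powr (1 / 2 - s) * real N powr s"
    using N by (simp flip: powr_add)
  then have "k * real N powr (1 / 2 - s) * real N powr s \<le> \<bar>C\<bar> * D * 3 * real N powr s"
    using bound[OF N] by (simp only: mult.assoc)
  then have "k * real N powr (1 / 2 - s) \<le> \<bar>C\<bar> * D * 3"
    using N by (subst (asm) mult_le_cancel_right_pos) auto
  then have "real N powr (1 / 2 - s) \<le> X"
    using k by (simp add: X_def le_divide_eq mult.commute)
  moreover have "X + 1 = ((X + 1) powr (1 / (1 / 2 - s))) powr (1 / 2 - s)"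
    using X s by (simp add: powr_powr)
  moreover have "\<dots> \<le> real N powr (1 / 2 - s)"
    using N_ge s by (intro powr_mono2) auto
  ultimately show False by simp
qed

theorem theorem11p5:
  fixes b c :: real
  assumes "b > -1" and "0 \<le> 2 - c + b" and "2 - c + b < 1" and "c > 1"
  shows
    "\<not> bounded_kernel_op (-1) (S_kernel b c) (Lp_norm (recip_exponent (2 - c + b))) weak_L1_norm \<and>
     (0 \<le> 2 - c + b \<and> 2 - c + b < 1 / 2 \<longrightarrow>
       \<not> bounded_kernel_op (-1) (T_kernel b c) (Lp_norm (recip_exponent (2 - c + b))) weak_L1_norm) \<and>
     (1 / 2 \<le> 2 - c + b \<and> 2 - c + b < 1 \<longrightarrow>
       bounded_kernel_op (-1) (T_kernel b c) (Lp_norm (recip_exponent (2 - c + b))) weak_L1_norm)"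
  using assms
  by (intro conjI impI unbounded_kernel_op_S unbounded_kernel_op_T bounded_kernel_op_T) auto

end
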